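(* Let $\mathbb{K}$ be a field, let $1\le k\le n$ be integers, and let $\beta\le\gamma$ be $k$-element subsets of $[n]$. Then the natural map $\phi: Y_\beta^\gamma\to W_\beta^\gamma$, defined by the ring map $\Delta_\alpha\mapsto\det M_\alpha$ (where $M_\alpha$ is the $k\times k$ submatrix, with column set $\alpha$, of the universal matrix $M$ on $Y_\beta^\gamma$), is an isomorphism of schemes over $\mathbb{K}$.
   Context: $[n]=\{1,\dots,n\}$ and $\mathcal{S}(k,n)$ is the set of $k$-element subsets of $[n]$. For $\alpha\in\mathcal{S}(k,n)$, $\alpha(i)$ is the $i$-th smallest element of $\alpha$. Partial order: $\alpha\le\alpha'$ iff $\alpha(i)\le\alpha'(i)$ for all $i=1,\dots,k$; $[\beta,\gamma]=\{\alpha\in\mathcal{S}(k,n)\mid \beta\le\alpha\le\gamma\}$. $A=\mathbb{K}[\Delta_\alpha\mid\alpha\in\mathcal{S}(k,n)]/I$ is the Plücker coordinate ring of $\mathrm{Gr}(k,n)=\mathrm{Proj}\,A$, where $I$ is the Plücker ideal, i.e. the ideal generated by the quadratic Plücker relations; equivalently, the kernel of the map $\Delta_\alpha\mapsto$ the maximal minor with column set $\alpha$ of a generic $k\times n$ matrix of indeterminates over $\mathbb{K}$. Let $A_\beta^\gamma=A/\langle\Delta_\alpha\mid\alpha\notin[\beta,\gamma]\rangle$. For $0\le t\le k$ let $\delta_t=\{\beta(1),\dots,\beta(t),\gamma(t+1),\dots,\gamma(k)\}\in\mathcal{S}(k,n)$, so $\delta_0=\gamma$ and $\delta_k=\beta$.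 Let $B_\beta^\gamma=A_\beta^\gamma[\Delta_{\delta_0}^{-1},\dots,\Delta_{\delta_k}^{-1}]$ and $W_\beta^\gamma=\mathrm{Proj}\,B_\beta^\gamma=\mathrm{Spec}\,B_\beta^\gamma/\langle\Delta_\gamma-1\rangle$. $Y_\beta^\gamma$ is the affine scheme of $k\times n$ matrices $M$ such that, for each $i=1,\dots,k$: $M_{i,\beta(i)}$ is invertible, $M_{i,\gamma(i)}=1$, $M_{i,j}$ is arbitrary for $\beta(i)<j<\gamma(i)$, and $M_{i,j}=0$ for all other $j$. (If $\beta(i)=\gamma(i)$ this entry is $1$.) Thus its coordinate ring is the polynomial ring over $\mathbb{K}$ in the free entries $M_{i,j}$, $\beta(i)\le j<\gamma(i)$, localized at the entries $M_{i,\beta(i)}$ with $\beta(i)<\gamma(i)$. For such $M$ one has $\det M_\gamma=1$. *)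

theory Defs
  imports
    "HOL-Library.Poly_Mapping"
    "HOL-Algebra.QuotRing"
    "HOL-Algebra.RingHom"
    "HOL-Algebra.Algebraic_Closure_Type"
    "HOL-Analysis.Abstract_Topology"
    "Jordan_Normal_Form.Determinant"
begin

section \<open>Localization of a commutative ring\<close>

text \<open>The fraction \<open>a/s\<close> is its equivalence class, the set of all pairs \<open>(b, t)\<close> with
  \<open>b/t = a/s\<close>.\<close>

definition fraction :: "'a ring \<Rightarrow> 'a set \<Rightarrow> 'a \<Rightarrow> 'a \<Rightarrow> ('a \<times> 'a) set" where
  "fraction R S a s =
    {(b, t). b \<in> carrier R \<and> t \<in> S \<and>
      (\<exists>u\<in>S. u \<otimes>\<^bsub>R\<^esub> (a \<otimes>\<^bsub>R\<^esub> t \<ominus>\<^bsub>R\<^esub> b \<otimes>\<^bsub>R\<^esub> s) = \<zero>\<^bsub>R\<^esub>)}"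

text \<open>The unions below are over representatives; all the fractions in such a union coincide.\<close>

definition localization :: "'a ring \<Rightarrow> 'a set \<Rightarrow> ('a \<times> 'a) set ring" where
  "localization R S =
    \<lparr>carrier = {fraction R S a s | a s. a \<in> carrier R \<and> s \<in> S},
     monoid.mult = (\<lambda>A B. \<Union>(a, s)\<in>A. \<Union>(b, t)\<in>B. fraction R S (a \<otimes>\<^bsub>R\<^esub> b) (s \<otimes>\<^bsub>R\<^esub> t)),
     one = fraction R S \<one>\<^bsub>R\<^esub> \<one>\<^bsub>R\<^esub>,
     ring.zero = fraction R S \<zero>\<^bsub>R\<^esub> \<one>\<^bsub>R\<^esub>,
     add = (\<lambda>A B. \<Union>(a, s)\<in>A. \<Union>(b, t)\<in>B.
       fraction R S (a \<otimes>\<^bsub>R\<^esub> t \<oplus>\<^bsub>R\<^esub> b \<otimes>\<^bsub>R\<^esub> s) (s \<otimes>\<^bsub>R\<^esub> t))\<rparr>"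

definition mult_closure :: "'a ring \<Rightarrow> 'a set \<Rightarrow> 'a set" where
  "mult_closure R E = (\<lambda>H. submonoid H R) hull E"

section \<open>Affine schemes\<close>

text \<open>\<open>restr U V\<close> is the restriction map from \<open>U\<close> to \<open>V \<subseteq> U\<close>.\<close>

record ('p, 's) ringed_space =
  points :: "'p topology"
  sect :: "'p set \<Rightarrow> 's ring"
  restr :: "'p set \<Rightarrow> 'p set \<Rightarrow> 's \<Rightarrow> 's"

definition prime_spectrum :: "'a ring \<Rightarrow> 'a set set" where
  "prime_spectrum R = {p. primeideal p R}"

definition zariski :: "'a ring \<Rightarrow> 'a set topology" where
  "zariski R = topology (\<lambda>U. \<exists>E \<subseteq> carrier R. U = {p \<in> prime_spectrum R. \<not> E \<subseteq> p})"

lemma istopology_zariski: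
  assumes "cring R"
  shows "istopology (\<lambda>U. \<exists>E \<subseteq> carrier R. U = {p \<in> prime_spectrum R. \<not> E \<subseteq> p})"
proof -
  interpret cring R by fact
  show ?thesis
    unfolding istopology_def
  proof safe
    fix E F assume EF: "E \<subseteq> carrier R" "F \<subseteq> carrier R"
    let ?G = "{e \<otimes>\<^bsub>R\<^esub> f | e f. e \<in> E \<and> f \<in> F}"
    have "\<not> ?G \<subseteq> p \<longleftrightarrow> \<not> E \<subseteq> p \<and> \<not> F \<subseteq> p" if "primeideal p R" for p
    proof -
      interpret p: primeideal p R by fact
      show ?thesis
      proof
        assume "\<not> ?G \<subseteq> p"
        then obtain e f where "e \<in> E" "f \<in> F" "e \<otimes>\<^bsub>R\<^esub> f \<notin> p" by blast
        moreover from this have "e \<notin> p" "f \<notin> p"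
          using p.I_l_closed p.I_r_closed EF by blast+
        ultimately show "\<not> E \<subseteq> p \<and> \<not> F \<subseteq> p" by blast
      next
        assume "\<not> E \<subseteq> p \<and> \<not> F \<subseteq> p"
        then obtain e f where ef: "e \<in> E" "f \<in> F" "e \<notin> p" "f \<notin> p" by blast
        then have "e \<otimes>\<^bsub>R\<^esub> f \<notin> p" using p.I_prime[of e f] EF by blast
        with ef show "\<not> ?G \<subseteq> p" by blast
      qed
    qed
    then have "{p \<in> prime_spectrum R. \<not> E \<subseteq> p} \<inter> {p \<in> prime_spectrum R. \<not> F \<subseteq> p} =
        {p \<in> prime_spectrum R. \<not> ?G \<subseteq> p}"
      unfolding prime_spectrum_def by blast
    moreover have "?G \<subseteq> carrier R" using EF by auto
    ultimately show "\<exists>G\<subseteq>carrier R.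
        {p \<in> prime_spectrum R. \<not> E \<subseteq> p} \<inter> {p \<in> prime_spectrum R. \<not> F \<subseteq> p} =
        {p \<in> prime_spectrum R. \<not> G \<subseteq> p}" by blast
  next
    fix \<U> assume "\<forall>U\<in>\<U>. \<exists>E\<subseteq>carrier R. U = {p \<in> prime_spectrum R. \<not> E \<subseteq> p}"
    then obtain E where E: "\<forall>U\<in>\<U>. E U \<subseteq> carrier R \<and> U = {p \<in> prime_spectrum R. \<not> E U \<subseteq> p}"
      by metis
    have "x \<in> \<Union>\<U> \<longleftrightarrow> x \<in> {p \<in> prime_spectrum R. \<not> \<Union>(E ` \<U>) \<subseteq> p}" for x
    proof -
      have "x \<in> U \<longleftrightarrow> x \<in> prime_spectrum R \<and> \<not> E U \<subseteq> x" if "U \<in> \<U>" for U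
        using E that by blast
      then show ?thesis by auto
    qed
    then have "\<Union>\<U> = {p \<in> prime_spectrum R. \<not> \<Union>(E ` \<U>) \<subseteq> p}" by blast
    moreover have "\<Union>(E ` \<U>) \<subseteq> carrier R" using E by blast
    ultimately show "\<exists>E\<subseteq>carrier R. \<Union>\<U> = {p \<in> prime_spectrum R. \<not> E \<subseteq> p}" by blast
  qed
qed

lemma openin_zariski:
  "cring R \<Longrightarrow> openin (zariski R) U \<longleftrightarrow>
    (\<exists>E \<subseteq> carrier R. U = {p \<in> prime_spectrum R. \<not> E \<subseteq> p})"
  by (simp add: zariski_def topology_inverse' istopology_zariski)

abbreviation stalk :: "'a ring \<Rightarrow> 'a set \<Rightarrow> ('a \<times> 'a) set ring" where
  "stalk R p \<equiv> localization R (carrier R - p)"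

definition structure_sheaf ::
  "'a ring \<Rightarrow> 'a set set \<Rightarrow> ('a set \<Rightarrow> ('a \<times> 'a) set) ring" where
  "structure_sheaf R U =
    \<lparr>carrier = {s \<in> (\<Pi>\<^sub>E p\<in>U. carrier (stalk R p)).
       \<forall>p\<in>U. \<exists>V a f. openin (zariski R) V \<and> p \<in> V \<and> V \<subseteq> U \<and> a \<in> carrier R \<and> f \<in> carrier R \<and>
         (\<forall>q\<in>V. f \<notin> q \<and> s q = fraction R (carrier R - q) a f)},
     monoid.mult = (\<lambda>s t. \<lambda>p\<in>U. s p \<otimes>\<^bsub>stalk R p\<^esub> t p),
     one = (\<lambda>p\<in>U. \<one>\<^bsub>stalk R p\<^esub>),
     ring.zero = (\<lambda>p\<in>U. \<zero>\<^bsub>stalk R p\<^esub>),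
     add = (\<lambda>s t. \<lambda>p\<in>U. s p \<oplus>\<^bsub>stalk R p\<^esub> t p)\<rparr>"

definition Spec :: "'a ring \<Rightarrow> ('a set, 'a set \<Rightarrow> ('a \<times> 'a) set) ringed_space" where
  "Spec R =
    \<lparr>points = zariski R, sect = structure_sheaf R, restr = (\<lambda>U V s. restrict s V)\<rparr>"

text \<open>A morphism \<open>T \<rightarrow> S\<close> is a map of points together with, for every open set \<open>V\<close> of \<open>S\<close>,
  a map from the sections over \<open>V\<close> to the sections over its preimage.\<close>

type_synonym ('p, 's, 'q, 't) morphism = "('p \<Rightarrow> 'q) \<times> ('q set \<Rightarrow> 't \<Rightarrow> 's)"

definition preimage ::
  "('p, 's) ringed_space \<Rightarrow> ('p, 's, 'q, 't) morphism \<Rightarrow> 'q set \<Rightarrow> 'p set" where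
  "preimage T F V = {x \<in> topspace (points T). fst F x \<in> V}"

definition Spec_map ::
  "'a ring \<Rightarrow> 'b ring \<Rightarrow> ('a \<Rightarrow> 'b) \<Rightarrow>
    ('b set, 'b set \<Rightarrow> ('b \<times> 'b) set, 'a set, 'a set \<Rightarrow> ('a \<times> 'a) set) morphism" where
  "Spec_map R S \<phi> =
    (let f = (\<lambda>q. {a \<in> carrier R. \<phi> a \<in> q})
     in (f, \<lambda>V s. \<lambda>q\<in>{q \<in> prime_spectrum S. f q \<in> V}.
              \<Union>(a, t)\<in>s (f q). fraction S (carrier S - q) (\<phi> a) (\<phi> t)))"

text \<open>An isomorphism of schemes is an isomorphism of the underlying ringed spaces: the
  homomorphisms it induces on stalks are isomorphisms, hence automatically local.\<close>

definition scheme_iso ::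
  "('p, 's) ringed_space \<Rightarrow> ('q, 't) ringed_space \<Rightarrow> ('p, 's, 'q, 't) morphism \<Rightarrow> bool" where
  "scheme_iso T S F \<longleftrightarrow>
    homeomorphic_map (points T) (points S) (fst F) \<and>
    (\<forall>V. openin (points S) V \<longrightarrow> snd F V \<in> ring_iso (sect S V) (sect T (preimage T F V))) \<and>
    (\<forall>U V s. openin (points S) U \<longrightarrow> openin (points S) V \<longrightarrow> V \<subseteq> U \<longrightarrow> s \<in> carrier (sect S U) \<longrightarrow>
       snd F V (restr S U V s) = restr T (preimage T F U) (preimage T F V) (snd F U s))"

text \<open>\<open>\<pi>T\<close> and \<open>\<pi>S\<close> are the structure morphisms of \<open>T\<close> and \<open>S\<close> over the base \<open>Z\<close>; the last two
  conditions say \<open>\<pi>S \<circ> F = \<pi>T\<close>.\<close>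

definition scheme_iso_over ::
  "('r, 'u) ringed_space \<Rightarrow>
   ('p, 's) ringed_space \<Rightarrow> ('p, 's, 'r, 'u) morphism \<Rightarrow>
   ('q, 't) ringed_space \<Rightarrow> ('q, 't, 'r, 'u) morphism \<Rightarrow>
   ('p, 's, 'q, 't) morphism \<Rightarrow> bool" where
  "scheme_iso_over Z T \<pi>T S \<pi>S F \<longleftrightarrow>
    scheme_iso T S F \<and>
    (\<forall>x \<in> topspace (points T). fst \<pi>S (fst F x) = fst \<pi>T x) \<and>
    (\<forall>U. openin (points Z) U \<longrightarrow> (\<forall>s \<in> carrier (sect Z U).
       snd F (preimage S \<pi>S U) (snd \<pi>S U s) = snd \<pi>T U s))"

section \<open>Polynomial rings\<close>

type_synonym ('v, 'k) mpoly = "('v \<Rightarrow>\<^sub>0 nat) \<Rightarrow>\<^sub>0 'k"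

definition Const :: "'k::comm_ring_1 \<Rightarrow> ('v, 'k) mpoly" where
  "Const c = Poly_Mapping.single 0 c"

definition Var :: "'v \<Rightarrow> ('v, 'k::comm_ring_1) mpoly" where
  "Var v = Poly_Mapping.single (Poly_Mapping.single v 1) 1"

definition mpoly_ring :: "'v set \<Rightarrow> ('v, 'k::comm_ring_1) mpoly ring" where
  "mpoly_ring V = ring_of_type_algebra
    \<lparr>carrier := {p. \<forall>m \<in> Poly_Mapping.keys p. Poly_Mapping.keys m \<subseteq> V}\<rparr>"

definition poly_subst ::
  "('v \<Rightarrow> ('w, 'k) mpoly) \<Rightarrow> ('v, 'k::comm_ring_1) mpoly \<Rightarrow> ('w, 'k) mpoly" where
  "poly_subst f p = (\<Sum>m \<in> Poly_Mapping.keys p.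
     Const (Poly_Mapping.lookup p m) *
       (\<Prod>v \<in> Poly_Mapping.keys m. f v ^ Poly_Mapping.lookup m v))"

section \<open>Pluecker coordinates\<close>

definition ksubsets :: "nat \<Rightarrow> nat \<Rightarrow> nat set set" where
  "ksubsets k n = {\<alpha>. \<alpha> \<subseteq> {1..n} \<and> card \<alpha> = k}"

text \<open>\<open>elt \<alpha> i\<close> is the \<open>i\<close>-th smallest element of \<open>\<alpha>\<close>, where \<open>1 \<le> i \<le> card \<alpha>\<close>.\<close>

definition elt :: "nat set \<Rightarrow> nat \<Rightarrow> nat" where
  "elt \<alpha> i = sorted_list_of_set \<alpha> ! (i - 1)"

definition bruhat_le :: "nat \<Rightarrow> nat set \<Rightarrow> nat set \<Rightarrow> bool" where
  "bruhat_le k \<alpha> \<alpha>' \<longleftrightarrow> (\<forall>i\<in>{1..k}. elt \<alpha> i \<le> elt \<alpha>' i)"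

definition bruhat_interval :: "nat \<Rightarrow> nat \<Rightarrow> nat set \<Rightarrow> nat set \<Rightarrow> nat set set" where
  "bruhat_interval k n \<beta> \<gamma> = {\<alpha> \<in> ksubsets k n. bruhat_le k \<beta> \<alpha> \<and> bruhat_le k \<alpha> \<gamma>}"

text \<open>Rows and columns of \<open>M\<close> are numbered from 1, those of \<^term>\<open>mat k k\<close> from 0.\<close>

definition maximal_minor :: "nat \<Rightarrow> (nat \<Rightarrow> nat \<Rightarrow> 'r::comm_ring_1) \<Rightarrow> nat set \<Rightarrow> 'r" where
  "maximal_minor k M \<alpha> = det (mat k k (\<lambda>(i, j). M (i + 1) (elt \<alpha> (j + 1))))"

definition pluecker_ideal :: "nat \<Rightarrow> nat \<Rightarrow> (nat set, 'k::field) mpoly set" where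
  "pluecker_ideal k n =
    a_kernel (mpoly_ring (ksubsets k n)) (mpoly_ring ({1..k} \<times> {1..n}) :: (nat \<times> nat, 'k) mpoly ring)
      (poly_subst (maximal_minor k (\<lambda>i j. Var (i, j))))"

definition pluecker_ring :: "nat \<Rightarrow> nat \<Rightarrow> (nat set, 'k::field) mpoly set ring" where
  "pluecker_ring k n = mpoly_ring (ksubsets k n) Quot pluecker_ideal k n"

definition pluecker_class ::
  "nat \<Rightarrow> nat \<Rightarrow> (nat set, 'k::field) mpoly \<Rightarrow> (nat set, 'k) mpoly set" where
  "pluecker_class k n p = pluecker_ideal k n +>\<^bsub>mpoly_ring (ksubsets k n)\<^esub> p"

section \<open>The scheme \<open>W\<close>\<close>

definition interval_ideal ::
  "nat \<Rightarrow> nat \<Rightarrow> nat set \<Rightarrow> nat set \<Rightarrow> (nat set, 'k::field) mpoly set set" where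
  "interval_ideal k n \<beta> \<gamma> = Idl\<^bsub>pluecker_ring k n\<^esub>
    (pluecker_class k n ` Var ` (ksubsets k n - bruhat_interval k n \<beta> \<gamma>))"

definition interval_ring ::
  "nat \<Rightarrow> nat \<Rightarrow> nat set \<Rightarrow> nat set \<Rightarrow> (nat set, 'k::field) mpoly set set ring" where
  "interval_ring k n \<beta> \<gamma> = pluecker_ring k n Quot interval_ideal k n \<beta> \<gamma>"

definition interval_class ::
  "nat \<Rightarrow> nat \<Rightarrow> nat set \<Rightarrow> nat set \<Rightarrow> (nat set, 'k::field) mpoly \<Rightarrow> (nat set, 'k) mpoly set set"
  where
  "interval_class k n \<beta> \<gamma> p =
    interval_ideal k n \<beta> \<gamma> +>\<^bsub>pluecker_ring k n\<^esub> pluecker_class k n p"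

definition delta_set :: "nat \<Rightarrow> nat set \<Rightarrow> nat set \<Rightarrow> nat \<Rightarrow> nat set" where
  "delta_set k \<beta> \<gamma> t = elt \<beta> ` {1..t} \<union> elt \<gamma> ` {t+1..k}"

definition B_denominators ::
  "nat \<Rightarrow> nat \<Rightarrow> nat set \<Rightarrow> nat set \<Rightarrow> (nat set, 'k::field) mpoly set set set" where
  "B_denominators k n \<beta> \<gamma> = mult_closure (interval_ring k n \<beta> \<gamma>)
    (interval_class k n \<beta> \<gamma> ` Var ` delta_set k \<beta> \<gamma> ` {0..k})"

type_synonym 'k B_elem =
  "((nat set, 'k) mpoly set set \<times> (nat set, 'k) mpoly set set) set"

definition B_ring :: "nat \<Rightarrow> nat \<Rightarrow> nat set \<Rightarrow> nat set \<Rightarrow> 'k::field B_elem ring" where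
  "B_ring k n \<beta> \<gamma> = localization (interval_ring k n \<beta> \<gamma>) (B_denominators k n \<beta> \<gamma>)"

definition B_class ::
  "nat \<Rightarrow> nat \<Rightarrow> nat set \<Rightarrow> nat set \<Rightarrow> (nat set, 'k::field) mpoly \<Rightarrow> 'k B_elem" where
  "B_class k n \<beta> \<gamma> p = fraction (interval_ring k n \<beta> \<gamma>) (B_denominators k n \<beta> \<gamma>)
    (interval_class k n \<beta> \<gamma> p) \<one>\<^bsub>interval_ring k n \<beta> \<gamma>\<^esub>"

definition W_ideal :: "nat \<Rightarrow> nat \<Rightarrow> nat set \<Rightarrow> nat set \<Rightarrow> 'k::field B_elem set" where
  "W_ideal k n \<beta> \<gamma> = Idl\<^bsub>B_ring k n \<beta> \<gamma>\<^esub>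
    {B_class k n \<beta> \<gamma> (Var \<gamma>) \<ominus>\<^bsub>B_ring k n \<beta> \<gamma>\<^esub> \<one>\<^bsub>B_ring k n \<beta> \<gamma>\<^esub>}"

type_synonym 'k W_elem = "'k B_elem set"

definition W_ring :: "nat \<Rightarrow> nat \<Rightarrow> nat set \<Rightarrow> nat set \<Rightarrow> 'k::field W_elem ring" where
  "W_ring k n \<beta> \<gamma> = B_ring k n \<beta> \<gamma> Quot W_ideal k n \<beta> \<gamma>"

definition W_class ::
  "nat \<Rightarrow> nat \<Rightarrow> nat set \<Rightarrow> nat set \<Rightarrow> (nat set, 'k::field) mpoly \<Rightarrow> 'k W_elem" where
  "W_class k n \<beta> \<gamma> p = W_ideal k n \<beta> \<gamma> +>\<^bsub>B_ring k n \<beta> \<gamma>\<^esub> B_class k n \<beta> \<gamma> p"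

section \<open>The scheme \<open>Y\<close>\<close>

definition Y_vars :: "nat \<Rightarrow> nat set \<Rightarrow> nat set \<Rightarrow> (nat \<times> nat) set" where
  "Y_vars k \<beta> \<gamma> = {(i, j). i \<in> {1..k} \<and> elt \<beta> i \<le> j \<and> j < elt \<gamma> i}"

definition Y_denominators ::
  "nat \<Rightarrow> nat set \<Rightarrow> nat set \<Rightarrow> (nat \<times> nat, 'k::field) mpoly set" where
  "Y_denominators k \<beta> \<gamma> = mult_closure (mpoly_ring (Y_vars k \<beta> \<gamma>))
    {Var (i, elt \<beta> i) | i. i \<in> {1..k} \<and> elt \<beta> i < elt \<gamma> i}"

type_synonym 'k Y_elem = "((nat \<times> nat, 'k) mpoly \<times> (nat \<times> nat, 'k) mpoly) set"

definition Y_ring :: "nat \<Rightarrow> nat set \<Rightarrow> nat set \<Rightarrow> 'k::field Y_elem ring" where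
  "Y_ring k \<beta> \<gamma> = localization (mpoly_ring (Y_vars k \<beta> \<gamma>)) (Y_denominators k \<beta> \<gamma>)"

definition Y_class ::
  "nat \<Rightarrow> nat set \<Rightarrow> nat set \<Rightarrow> (nat \<times> nat, 'k::field) mpoly \<Rightarrow> 'k Y_elem" where
  "Y_class k \<beta> \<gamma> p = fraction (mpoly_ring (Y_vars k \<beta> \<gamma>)) (Y_denominators k \<beta> \<gamma>) p 1"

text \<open>All entries of the universal matrix already lie in the polynomial ring, so its minors are
  computed there and then mapped to the localization.\<close>

definition Y_matrix ::
  "nat set \<Rightarrow> nat set \<Rightarrow> nat \<Rightarrow> nat \<Rightarrow> (nat \<times> nat, 'k::field) mpoly" where
  "Y_matrix \<beta> \<gamma> i j =
    (if j = elt \<gamma> i then 1 else if elt \<beta> i \<le> j \<and> j < elt \<gamma> i then Var (i, j) else 0)"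

section \<open>The natural map\<close>

text \<open>\<open>\<phi>\<close> is the homomorphism of \<open>\<K>\<close>-algebras from the coordinate ring of \<open>W\<close> to that of \<open>Y\<close>
  sending each Pluecker coordinate to the corresponding minor of the universal matrix.\<close>

definition natural_ring_map ::
  "nat \<Rightarrow> nat \<Rightarrow> nat set \<Rightarrow> nat set \<Rightarrow> ('k::field W_elem \<Rightarrow> 'k Y_elem) \<Rightarrow> bool" where
  "natural_ring_map k n \<beta> \<gamma> \<phi> \<longleftrightarrow>
    \<phi> \<in> Ring.ring_hom (W_ring k n \<beta> \<gamma>) (Y_ring k \<beta> \<gamma>) \<and>
    (\<forall>c. \<phi> (W_class k n \<beta> \<gamma> (Const c)) = Y_class k \<beta> \<gamma> (Const c)) \<and>
    (\<forall>\<alpha> \<in> ksubsets k n.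
       \<phi> (W_class k n \<beta> \<gamma> (Var \<alpha>)) = Y_class k \<beta> \<gamma> (maximal_minor k (Y_matrix \<beta> \<gamma>) \<alpha>))"

definition ground_ring :: "'k::field ring" where
  "ground_ring = ring_of_type_algebra"

end

theory Submission
  imports Defs
begin

text \<open>
  The universal matrix \<open>M\<close> of \<open>Y\<close>, a staircase matrix, can be recovered from its maximal minors. For a row \<open>i\<close> and a column \<open>j\<close>, let
  \<open>N i j\<close> be the Pluecker coordinate of the column sequence
  \<open>\<beta>(1), \<dots>, \<beta>(i-1), j, \<gamma>(i+1), \<dots>, \<gamma>(k)\<close>, with the sign of the sorting permutation and with value zero
  if a column is repeated (\<open>entry\<close>). For \<open>\<beta>(i) \<le> j \<le> \<gamma>(i)\<close> the corresponding minor of \<open>M\<close> has a single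
  nonzero term and equals \<open>M i j\<close> times the product of the \<open>M l \<beta>(l)\<close> with \<open>l < i\<close>; this product is the
  minor for \<open>\<delta>\<close> at \<open>i - 1\<close> (\<open>pivot i\<close>). So \<open>M i j = N i j / pivot i\<close> (\<open>Y_minor_entry\<close>), and this formula
  defines a map \<open>\<psi>\<close> from the coordinate ring of \<open>Y\<close> to that of \<open>W\<close> with \<open>\<phi> \<circ> \<psi> = id\<close>.

  For \<open>\<psi> \<circ> \<phi> = id\<close> it has to be shown that the matrix with entries \<open>N i j / pivot i\<close> over the coordinate ring of
  \<open>W\<close> has the Pluecker coordinates as its maximal minors. On a generic matrix \<open>X\<close>, cofactor expansion gives
  \<open>N = C * X\<close> for a square matrix \<open>C\<close>. Hence \<open>det N\<^sub>\<alpha> * \<Delta>\<^sub>\<gamma> = det N\<^sub>\<gamma> * \<Delta>\<^sub>\<alpha>\<close> holds among the minors of \<open>X\<close>,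
  that is, modulo the Pluecker ideal (\<open>pluecker_relation\<close>); no explicit Pluecker relation is needed. Modulo
  the coordinates outside \<open>[\<beta>, \<gamma>]\<close>, \<open>N i j\<close> vanishes unless \<open>\<beta>(i) \<le> j \<le> \<gamma>(i)\<close>. Therefore \<open>N\<^sub>\<gamma>\<close> is
  triangular with the pivots on its diagonal, and with \<open>\<Delta>\<^sub>\<gamma> = 1\<close> the relation becomes
  \<open>det N\<^sub>\<alpha> = (\<Prod>i. pivot i) * \<Delta>\<^sub>\<alpha>\<close> (\<open>entry_minor\<close>), which is the claim (\<open>minor_from_entries\<close>).

  The map \<open>\<phi>\<close> is well defined because the minor of \<open>M\<close> on \<open>\<alpha>\<close> vanishes for \<open>\<alpha>\<close> outside the interval
  (\<open>Y_minor_zero\<close>) and because the minors for the \<open>\<delta>\<close> are products of invertible entries. The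
  coordinate rings enter only through their universal properties. Finally, mutually inverse ring homomorphisms
  over the ground field induce an isomorphism of schemes over it, since \<open>Spec\<close> is a functor
  (\<open>Spec_map_scheme_iso_over\<close>).
\<close>

section \<open>Localization\<close>

text \<open>A commutative ring together with a multiplicative subset; \<open>0 \<in> S\<close> is not excluded.\<close>

locale cring_submonoid = cring R + submonoid S R for R :: "'a ring" (structure) and S
begin

text \<open>A fraction is the set of its representatives, so \<open>(b, t) \<in> fraction R S a s\<close> says that
  \<open>a/s = b/t\<close>. The first lemmas say that this is an equivalence relation.\<close>

lemma frac_rel_iff:
  assumes "a \<in> carrier R" "b \<in> carrier R" "s \<in> S" "t \<in> S"
  shows "(b, t) \<in> fraction R S a s \<longleftrightarrow> (\<exists>u\<in>S. u \<otimes> (a \<otimes> t \<ominus> b \<otimes> s) = \<zero>)"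
  using assms by (simp add: fraction_def)

lemma frac_self:
  assumes "a \<in> carrier R" "s \<in> S"
  shows "(a, s) \<in> fraction R S a s"
proof -
  have "s \<in> carrier R" using assms by simp
  then have "\<one> \<otimes> (a \<otimes> s \<ominus> a \<otimes> s) = \<zero>" using assms by algebra
  then show ?thesis using assms one_closed by (auto simp: frac_rel_iff simp del: l_one)
qed

lemma frac_rel_sym:
  assumes "a \<in> carrier R" "s \<in> S" "(b, t) \<in> fraction R S a s"
  shows "(a, s) \<in> fraction R S b t"
proof -
  from assms obtain u where bt: "b \<in> carrier R" "t \<in> S" and u: "u \<in> S" "u \<otimes> (a \<otimes> t \<ominus> b \<otimes> s) = \<zero>"
    by (auto simp: fraction_def)
  have c: "s \<in> carrier R" "t \<in> carrier R" "u \<in> carrier R" using assms bt u by simp_all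
  have "u \<otimes> (b \<otimes> s \<ominus> a \<otimes> t) = \<ominus> (u \<otimes> (a \<otimes> t \<ominus> b \<otimes> s))" using c bt assms by algebra
  then have "u \<otimes> (b \<otimes> s \<ominus> a \<otimes> t) = \<zero>" using u by simp
  then show ?thesis using assms bt u by (auto simp: frac_rel_iff)
qed

lemma frac_rel_trans:
  assumes "a \<in> carrier R" "s \<in> S" "(b, t) \<in> fraction R S a s" "(c, r) \<in> fraction R S b t"
  shows "(c, r) \<in> fraction R S a s"
proof -
  from assms obtain u v where bt: "b \<in> carrier R" "t \<in> S" "c \<in> carrier R" "r \<in> S"
    and u: "u \<in> S" "u \<otimes> (a \<otimes> t \<ominus> b \<otimes> s) = \<zero>"
    and v: "v \<in> S" "v \<otimes> (b \<otimes> r \<ominus> c \<otimes> t) = \<zero>"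
    by (auto simp: fraction_def)
  have cc: "s \<in> carrier R" "t \<in> carrier R" "u \<in> carrier R" "v \<in> carrier R" "r \<in> carrier R"
    using assms bt u v by simp_all
  have "(u \<otimes> v \<otimes> t) \<otimes> (a \<otimes> r \<ominus> c \<otimes> s) =
      (v \<otimes> r) \<otimes> (u \<otimes> (a \<otimes> t \<ominus> b \<otimes> s)) \<oplus> (u \<otimes> s) \<otimes> (v \<otimes> (b \<otimes> r \<ominus> c \<otimes> t))"
    using cc bt assms(1) by algebra
  also have "\<dots> = \<zero>" using u v cc by simp
  finally have "(u \<otimes> v \<otimes> t) \<otimes> (a \<otimes> r \<ominus> c \<otimes> s) = \<zero>" .
  moreover have "u \<otimes> v \<otimes> t \<in> S" using u v bt by simp
  ultimately show ?thesis using assms bt by (auto simp: frac_rel_iff)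
qed

lemma fraction_eqI:
  assumes "a \<in> carrier R" "s \<in> S" "(b, t) \<in> fraction R S a s"
  shows "fraction R S a s = fraction R S b t"
proof -
  have bt: "b \<in> carrier R" "t \<in> S" using assms(3) by (auto simp: fraction_def)
  show ?thesis
  proof (rule Set.set_eqI)
    fix p
    show "p \<in> fraction R S a s \<longleftrightarrow> p \<in> fraction R S b t"
      using frac_rel_trans[OF assms] frac_rel_trans[OF bt frac_rel_sym[OF assms]]
      by (cases p) blast
  qed
qed

lemma fraction_eq_iff:
  assumes "a \<in> carrier R" "b \<in> carrier R" "s \<in> S" "t \<in> S"
  shows "fraction R S a s = fraction R S b t \<longleftrightarrow> (\<exists>u\<in>S. u \<otimes> (a \<otimes> t) = u \<otimes> (b \<otimes> s))"
proof -
  have "u \<otimes> (a \<otimes> t \<ominus> b \<otimes> s) = \<zero> \<longleftrightarrow> u \<otimes> (a \<otimes> t) = u \<otimes> (b \<otimes> s)" if "u \<in> S" for u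
  proof -
    have "u \<otimes> (a \<otimes> t \<ominus> b \<otimes> s) = u \<otimes> (a \<otimes> t) \<ominus> u \<otimes> (b \<otimes> s)"
      using that assms by (simp add: minus_eq r_distr r_minus)
    then show ?thesis using that assms by (simp add: r_right_minus_eq)
  qed
  moreover have "fraction R S a s = fraction R S b t \<longleftrightarrow> (b, t) \<in> fraction R S a s"
    using fraction_eqI[of a s b t] frac_self[of b t] assms by metis
  ultimately show ?thesis
    using assms by (simp add: frac_rel_iff)
qed

lemma fraction_eqI_cross:
  assumes "a \<in> carrier R" "b \<in> carrier R" "s \<in> S" "t \<in> S" "a \<otimes> t = b \<otimes> s"
  shows "fraction R S a s = fraction R S b t"
  using assms one_closed[of ] by (subst fraction_eq_iff) (auto intro!: bexI[of _ \<one>])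

lemma in_fractionD:
  assumes "(b, t) \<in> fraction R S a s" "a \<in> carrier R" "s \<in> S"
  shows "b \<in> carrier R" "t \<in> S" "fraction R S b t = fraction R S a s"
  using assms fraction_eqI[OF assms(2,3,1)] by (auto simp: fraction_def)

lemma localization_carrier:
  "x \<in> carrier (localization R S) \<longleftrightarrow> (\<exists>a\<in>carrier R. \<exists>s\<in>S. x = fraction R S a s)"
  by (auto simp: localization_def)

lemma fraction_closed [simp, intro]:
  "a \<in> carrier R \<Longrightarrow> s \<in> S \<Longrightarrow> fraction R S a s \<in> carrier (localization R S)"
  by (auto simp: localization_carrier)

text \<open>A union over the representatives of a fraction, of a value not depending on the
  representative, is that value.\<close>

lemma Union_fraction:
  assumes "a \<in> carrier R" "s \<in> S"
    and "\<And>b t. b \<in> carrier R \<Longrightarrow> t \<in> S \<Longrightarrow> fraction R S b t = fraction R S a s \<Longrightarrow> F b t = F a s"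
  shows "(\<Union>(b, t)\<in>fraction R S a s. F b t) = F a s"
proof -
  have "F b t = F a s" if "(b, t) \<in> fraction R S a s" for b t
    by (rule assms(3)) (use assms in_fractionD[OF that] in blast)+
  then show ?thesis using frac_self[OF assms(1,2)] by fast
qed

lemma fraction_mult:
  assumes "a \<in> carrier R" "b \<in> carrier R" "s \<in> S" "t \<in> S"
  shows "fraction R S a s \<otimes>\<^bsub>localization R S\<^esub> fraction R S b t = fraction R S (a \<otimes> b) (s \<otimes> t)"
proof -
  have *: "fraction R S (a' \<otimes> b') (s' \<otimes> t') = fraction R S (a \<otimes> b) (s \<otimes> t)"
    if h: "a' \<in> carrier R" "s' \<in> S" "fraction R S a' s' = fraction R S a s"
      "b' \<in> carrier R" "t' \<in> S" "fraction R S b' t' = fraction R S b t" for a' b' s' t'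
  proof -
    obtain u where u: "u \<in> S" "u \<otimes> (a' \<otimes> s) = u \<otimes> (a \<otimes> s')"
      using h(3) fraction_eq_iff[OF h(1) assms(1) h(2) assms(3)] by blast
    obtain v where v: "v \<in> S" "v \<otimes> (b' \<otimes> t) = v \<otimes> (b \<otimes> t')"
      using h(6) fraction_eq_iff[OF h(4) assms(2) h(5) assms(4)] by blast
    have cc: "s \<in> carrier R" "t \<in> carrier R" "u \<in> carrier R" "v \<in> carrier R" "s' \<in> carrier R" "t' \<in> carrier R"
      using assms h u v by simp_all
    have "(u \<otimes> v) \<otimes> ((a' \<otimes> b') \<otimes> (s \<otimes> t)) = (u \<otimes> (a' \<otimes> s)) \<otimes> (v \<otimes> (b' \<otimes> t))"
      using cc assms(1,2) h(1,4) by (simp add: m_ac)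
    also have "\<dots> = (u \<otimes> v) \<otimes> ((a \<otimes> b) \<otimes> (s' \<otimes> t'))"
      using cc assms(1,2) h(1,4) by (simp add: u(2) v(2)) (simp add: m_ac)
    finally show ?thesis using assms h(1,2,4,5) u(1) v(1)
      by (subst fraction_eq_iff) (auto intro!: bexI[of _ "u \<otimes> v"])
  qed
  have "fraction R S a s \<otimes>\<^bsub>localization R S\<^esub> fraction R S b t =
    (\<Union>(a', s')\<in>fraction R S a s. \<Union>(b', t')\<in>fraction R S b t. fraction R S (a' \<otimes> b') (s' \<otimes> t'))"
    by (simp add: localization_def)
  also have "\<dots> = (\<Union>(b', t')\<in>fraction R S b t. fraction R S (a \<otimes> b') (s \<otimes> t'))"
  proof (rule Union_fraction)
    fix a' s' assume h: "a' \<in> carrier R" "s' \<in> S" "fraction R S a' s' = fraction R S a s"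
    show "(\<Union>(b', t')\<in>fraction R S b t. fraction R S (a' \<otimes> b') (s' \<otimes> t')) = (\<Union>(b', t')\<in>fraction R S b t. fraction R S (a \<otimes> b') (s \<otimes> t'))"
    proof (rule SUP_cong, rule refl, clarify)
      fix b' t' assume "(b', t') \<in> fraction R S b t"
      then have h': "b' \<in> carrier R" "t' \<in> S" "fraction R S b' t' = fraction R S b t"
        using in_fractionD assms by blast+
      show "fraction R S (a' \<otimes> b') (s' \<otimes> t') = fraction R S (a \<otimes> b') (s \<otimes> t')"
        using *[OF h h'] *[OF assms(1,3) refl h'] by simp
    qed
  qed fact+
  also have "\<dots> = fraction R S (a \<otimes> b) (s \<otimes> t)"
    by (rule Union_fraction[OF assms(2,4)], rule *[OF assms(1,3) refl])
  finally show ?thesis .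
qed

lemma fraction_add:
  assumes "a \<in> carrier R" "b \<in> carrier R" "s \<in> S" "t \<in> S"
  shows "fraction R S a s \<oplus>\<^bsub>localization R S\<^esub> fraction R S b t =
    fraction R S (a \<otimes> t \<oplus> b \<otimes> s) (s \<otimes> t)"
proof -
  have *: "fraction R S (a' \<otimes> t' \<oplus> b' \<otimes> s') (s' \<otimes> t') = fraction R S (a \<otimes> t \<oplus> b \<otimes> s) (s \<otimes> t)"
    if h: "a' \<in> carrier R" "s' \<in> S" "fraction R S a' s' = fraction R S a s"
      "b' \<in> carrier R" "t' \<in> S" "fraction R S b' t' = fraction R S b t" for a' b' s' t'
  proof -
    obtain u where u: "u \<in> S" "u \<otimes> (a' \<otimes> s) = u \<otimes> (a \<otimes> s')"
      using h(3) fraction_eq_iff[OF h(1) assms(1) h(2) assms(3)] by blast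
    obtain v where v: "v \<in> S" "v \<otimes> (b' \<otimes> t) = v \<otimes> (b \<otimes> t')"
      using h(6) fraction_eq_iff[OF h(4) assms(2) h(5) assms(4)] by blast
    have cc: "s \<in> carrier R" "t \<in> carrier R" "u \<in> carrier R" "v \<in> carrier R" "s' \<in> carrier R" "t' \<in> carrier R"
      using assms h u v by simp_all
    have "(u \<otimes> v) \<otimes> ((a' \<otimes> t' \<oplus> b' \<otimes> s') \<otimes> (s \<otimes> t)) =
        (v \<otimes> (t \<otimes> t')) \<otimes> (u \<otimes> (a' \<otimes> s)) \<oplus> (u \<otimes> (s \<otimes> s')) \<otimes> (v \<otimes> (b' \<otimes> t))"
      using cc assms(1,2) h(1,4) by (simp add: l_distr r_distr m_ac)
    also have "\<dots> = (u \<otimes> v) \<otimes> ((a \<otimes> t \<oplus> b \<otimes> s) \<otimes> (s' \<otimes> t'))"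
      using cc assms(1,2) h(1,4) by (simp add: u(2) v(2)) (simp add: l_distr r_distr m_ac)
    finally show ?thesis using assms h(1,2,4,5) u(1) v(1)
      by (subst fraction_eq_iff) (auto intro!: bexI[of _ "u \<otimes> v"])
  qed
  have "fraction R S a s \<oplus>\<^bsub>localization R S\<^esub> fraction R S b t =
    (\<Union>(a', s')\<in>fraction R S a s. \<Union>(b', t')\<in>fraction R S b t.
       fraction R S (a' \<otimes> t' \<oplus> b' \<otimes> s') (s' \<otimes> t'))"
    by (simp add: localization_def)
  also have "\<dots> = (\<Union>(b', t')\<in>fraction R S b t. fraction R S (a \<otimes> t' \<oplus> b' \<otimes> s) (s \<otimes> t'))"
  proof (rule Union_fraction)
    fix a' s' assume h: "a' \<in> carrier R" "s' \<in> S" "fraction R S a' s' = fraction R S a s"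
    show "(\<Union>(b', t')\<in>fraction R S b t. fraction R S (a' \<otimes> t' \<oplus> b' \<otimes> s') (s' \<otimes> t')) = (\<Union>(b', t')\<in>fraction R S b t. fraction R S (a \<otimes> t' \<oplus> b' \<otimes> s) (s \<otimes> t'))"
    proof (rule SUP_cong, rule refl, clarify)
      fix b' t' assume "(b', t') \<in> fraction R S b t"
      then have h': "b' \<in> carrier R" "t' \<in> S" "fraction R S b' t' = fraction R S b t"
        using in_fractionD assms by blast+
      show "fraction R S (a' \<otimes> t' \<oplus> b' \<otimes> s') (s' \<otimes> t') = fraction R S (a \<otimes> t' \<oplus> b' \<otimes> s) (s \<otimes> t')"
        using *[OF h h'] *[OF assms(1,3) refl h'] by simp
    qed
  qed fact+
  also have "\<dots> = fraction R S (a \<otimes> t \<oplus> b \<otimes> s) (s \<otimes> t)"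
    by (rule Union_fraction[where F = "\<lambda>b' t'. fraction R S (a \<otimes> t' \<oplus> b' \<otimes> s) (s \<otimes> t')", OF assms(2,4)])
      (rule *[OF assms(1,3) refl])
  finally show ?thesis .
qed

lemma fraction_one: "\<one>\<^bsub>localization R S\<^esub> = fraction R S \<one> \<one>"
  and fraction_zero: "\<zero>\<^bsub>localization R S\<^esub> = fraction R S \<zero> \<one>"
  by (simp_all add: localization_def)

lemmas fraction_ops = fraction_mult fraction_add fraction_one fraction_zero

lemma localization_cring: "cring (localization R S)"
proof -
  let ?L = "localization R S"
  have rep: "\<exists>a\<in>carrier R. \<exists>s\<in>S. x = fraction R S a s" if "x \<in> carrier ?L" for x
    using that by (simp add: localization_carrier)
  have S: "s \<in> carrier R" if "s \<in> S" for s using that by simp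
  show ?thesis
  proof (intro cringI abelian_groupI comm_monoidI)
    show "\<one>\<^bsub>?L\<^esub> \<in> carrier ?L" "\<zero>\<^bsub>?L\<^esub> \<in> carrier ?L" by (simp_all add: fraction_ops fraction_closed)
  next
    fix x assume "x \<in> carrier ?L"
    then obtain a s where 1: "a \<in> carrier R" "s \<in> S" and x: "x = fraction R S a s" using rep by blast
    have "fraction R S (\<ominus> a) s \<oplus>\<^bsub>?L\<^esub> x = fraction R S (\<ominus> a \<otimes> s \<oplus> a \<otimes> s) (s \<otimes> s)"
      using 1 by (simp add: fraction_ops x)
    also have "\<dots> = fraction R S \<zero> \<one>"
      using 1 S by (intro fraction_eqI_cross) (auto simp: l_minus l_neg)
    finally show "\<exists>y\<in>carrier ?L. y \<oplus>\<^bsub>?L\<^esub> x = \<zero>\<^bsub>?L\<^esub>"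
      using 1 fraction_closed[of "\<ominus> a" s] by (auto simp: fraction_zero)
    show "\<zero>\<^bsub>?L\<^esub> \<oplus>\<^bsub>?L\<^esub> x = x" "\<one>\<^bsub>?L\<^esub> \<otimes>\<^bsub>?L\<^esub> x = x"
      using 1 S by (simp_all add: fraction_ops x)
  next
    fix x y assume "x \<in> carrier ?L" "y \<in> carrier ?L"
    then obtain a s b t where 1: "a \<in> carrier R" "s \<in> S" "b \<in> carrier R" "t \<in> S"
      and x: "x = fraction R S a s" and y: "y = fraction R S b t" using rep by metis
    show "x \<oplus>\<^bsub>?L\<^esub> y \<in> carrier ?L" "x \<otimes>\<^bsub>?L\<^esub> y \<in> carrier ?L"
      using 1 S by (simp_all add: fraction_ops x y fraction_closed)
    show "x \<oplus>\<^bsub>?L\<^esub> y = y \<oplus>\<^bsub>?L\<^esub> x" "x \<otimes>\<^bsub>?L\<^esub> y = y \<otimes>\<^bsub>?L\<^esub> x"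
      using 1 S by (simp_all add: fraction_ops x y m_comm a_comm)
  next
    fix x y z assume "x \<in> carrier ?L" "y \<in> carrier ?L" "z \<in> carrier ?L"
    then obtain a s b t c r where 1: "a \<in> carrier R" "s \<in> S" "b \<in> carrier R" "t \<in> S" "c \<in> carrier R" "r \<in> S"
      and x: "x = fraction R S a s" and y: "y = fraction R S b t" and z: "z = fraction R S c r"
      using rep by metis
    have cc: "s \<in> carrier R" "t \<in> carrier R" "r \<in> carrier R" using 1 by simp_all
    have "((a \<otimes> t \<oplus> b \<otimes> s) \<otimes> r \<oplus> c \<otimes> (s \<otimes> t)) = (a \<otimes> (t \<otimes> r) \<oplus> (b \<otimes> r \<oplus> c \<otimes> t) \<otimes> s)"
      using 1(1,3,5) cc by (simp add: l_distr r_distr a_assoc m_ac)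
    then show "x \<oplus>\<^bsub>?L\<^esub> y \<oplus>\<^bsub>?L\<^esub> z = x \<oplus>\<^bsub>?L\<^esub> (y \<oplus>\<^bsub>?L\<^esub> z)"
      using 1 cc by (simp add: fraction_ops x y z m_assoc)
    show "x \<otimes>\<^bsub>?L\<^esub> y \<otimes>\<^bsub>?L\<^esub> z = x \<otimes>\<^bsub>?L\<^esub> (y \<otimes>\<^bsub>?L\<^esub> z)"
      using 1 cc by (simp add: fraction_ops x y z m_assoc)
    have "((a \<otimes> t \<oplus> b \<otimes> s) \<otimes> c) \<otimes> ((s \<otimes> r) \<otimes> (t \<otimes> r)) =
        ((a \<otimes> c) \<otimes> (t \<otimes> r) \<oplus> (b \<otimes> c) \<otimes> (s \<otimes> r)) \<otimes> ((s \<otimes> t) \<otimes> r)"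
      using 1(1,3,5) cc by (simp add: l_distr r_distr m_ac)
    then have "fraction R S ((a \<otimes> t \<oplus> b \<otimes> s) \<otimes> c) (s \<otimes> t \<otimes> r) =
        fraction R S ((a \<otimes> c) \<otimes> (t \<otimes> r) \<oplus> (b \<otimes> c) \<otimes> (s \<otimes> r)) ((s \<otimes> r) \<otimes> (t \<otimes> r))"
      using 1 cc by (intro fraction_eqI_cross) simp_all
    then show "(x \<oplus>\<^bsub>?L\<^esub> y) \<otimes>\<^bsub>?L\<^esub> z = x \<otimes>\<^bsub>?L\<^esub> z \<oplus>\<^bsub>?L\<^esub> y \<otimes>\<^bsub>?L\<^esub> z"
      using 1 cc by (simp add: fraction_ops x y z)
  qed
qed

lemma localization_hom: "(\<lambda>a. fraction R S a \<one>) \<in> Ring.ring_hom R (localization R S)"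
  by (rule ring_hom_memI) (auto simp: fraction_ops)

lemma fraction_inverse:
  assumes "s \<in> S"
  shows "fraction R S s \<one> \<otimes>\<^bsub>localization R S\<^esub> fraction R S \<one> s = \<one>\<^bsub>localization R S\<^esub>"
  using assms by (simp add: fraction_ops) (intro fraction_eqI_cross, auto)

lemma fraction_unit:
  assumes "s \<in> S" shows "fraction R S s \<one> \<in> Units (localization R S)"
proof -
  interpret L: cring "localization R S" by (rule localization_cring)
  show ?thesis
    using fraction_inverse[OF assms] assms L.m_comm[of "fraction R S s \<one>" "fraction R S \<one> s"]
    by (auto simp: Units_def intro!: bexI[of _ "fraction R S \<one> s"])
qed

lemma fraction_split:
  assumes "a \<in> carrier R" "s \<in> S"
  shows "fraction R S a s \<otimes>\<^bsub>localization R S\<^esub> fraction R S s \<one> = fraction R S a \<one>"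
  using assms by (simp add: fraction_ops) (intro fraction_eqI_cross, auto)

lemma localization_universal:
  assumes "cring T" and h: "h \<in> Ring.ring_hom R T" and units: "\<And>s. s \<in> S \<Longrightarrow> h s \<in> Units T"
  obtains g where "g \<in> Ring.ring_hom (localization R S) T" "\<And>a. a \<in> carrier R \<Longrightarrow> g (fraction R S a \<one>) = h a"
proof -
  interpret T: cring T by fact
  interpret h: ring_hom_cring R T h using h by unfold_locales
  \<comment> \<open>The value is computed on an arbitrary representative of the fraction.\<close>
  define g where "g x = (let (a, s) = SOME p. p \<in> x in h a \<otimes>\<^bsub>T\<^esub> inv\<^bsub>T\<^esub> h s)" for x
  have g: "g (fraction R S a s) = h a \<otimes>\<^bsub>T\<^esub> inv\<^bsub>T\<^esub> h s" if as: "a \<in> carrier R" "s \<in> S" for a s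
  proof -
    obtain b t where bt: "(SOME p. p \<in> fraction R S a s) = (b, t)" by (cases "SOME p. p \<in> fraction R S a s")
    have "(SOME p. p \<in> fraction R S a s) \<in> fraction R S a s"
      using frac_self[OF as] by (rule someI)
    then have mem: "(b, t) \<in> fraction R S a s" using bt by simp
    then have bt': "b \<in> carrier R" "t \<in> S" "fraction R S b t = fraction R S a s"
      using in_fractionD as by blast+
    then obtain u where u: "u \<in> S" "u \<otimes> (b \<otimes> s) = u \<otimes> (a \<otimes> t)"
      using as by (auto simp: fraction_eq_iff)
    have cc: "u \<in> carrier R" "t \<in> carrier R" "s \<in> carrier R" using u(1) bt'(2) as(2) by simp_all
    have U: "h u \<in> Units T" "h s \<in> Units T" "h t \<in> Units T" using units u(1) bt'(2) as(2) by auto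
    have "h u \<otimes>\<^bsub>T\<^esub> (h a \<otimes>\<^bsub>T\<^esub> h t) = h (u \<otimes> (a \<otimes> t))" using cc as by simp
    also have "\<dots> = h (u \<otimes> (b \<otimes> s))" by (simp only: u(2))
    also have "\<dots> = h u \<otimes>\<^bsub>T\<^esub> (h b \<otimes>\<^bsub>T\<^esub> h s)" using cc bt'(1) by simp
    finally have "h a \<otimes>\<^bsub>T\<^esub> h t = h b \<otimes>\<^bsub>T\<^esub> h s"
      using T.Units_l_cancel[OF U(1)] cc as(1) bt'(1) by simp
    then have "h b \<otimes>\<^bsub>T\<^esub> inv\<^bsub>T\<^esub> h t = h a \<otimes>\<^bsub>T\<^esub> inv\<^bsub>T\<^esub> h s"
      by (smt (verit) T.Units_inv_closed T.Units_l_inv T.m_assoc T.m_comm T.r_one T.m_closed U(2,3)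
        as(1) bt'(1) cc h.hom_closed)
    then show ?thesis unfolding g_def bt by simp
  qed
  have inv1: "inv\<^bsub>T\<^esub> (h s \<otimes>\<^bsub>T\<^esub> h t) = inv\<^bsub>T\<^esub> h s \<otimes>\<^bsub>T\<^esub> inv\<^bsub>T\<^esub> h t" if "s \<in> S" "t \<in> S" for s t
  proof (rule T.comm_inv_char)
    have U: "h s \<in> Units T" "h t \<in> Units T" using units that by auto
    then have c: "h s \<in> carrier T" "h t \<in> carrier T" "inv\<^bsub>T\<^esub> h s \<in> carrier T" "inv\<^bsub>T\<^esub> h t \<in> carrier T" by auto
    then show "h s \<otimes>\<^bsub>T\<^esub> h t \<in> carrier T" "inv\<^bsub>T\<^esub> h s \<otimes>\<^bsub>T\<^esub> inv\<^bsub>T\<^esub> h t \<in> carrier T" by auto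
    have "h s \<otimes>\<^bsub>T\<^esub> h t \<otimes>\<^bsub>T\<^esub> (inv\<^bsub>T\<^esub> h s \<otimes>\<^bsub>T\<^esub> inv\<^bsub>T\<^esub> h t) =
      (h s \<otimes>\<^bsub>T\<^esub> inv\<^bsub>T\<^esub> h s) \<otimes>\<^bsub>T\<^esub> (h t \<otimes>\<^bsub>T\<^esub> inv\<^bsub>T\<^esub> h t)" using c by (simp add: T.m_ac)
    also have "\<dots> = \<one>\<^bsub>T\<^esub>" using U by simp
    finally show "h s \<otimes>\<^bsub>T\<^esub> h t \<otimes>\<^bsub>T\<^esub> (inv\<^bsub>T\<^esub> h s \<otimes>\<^bsub>T\<^esub> inv\<^bsub>T\<^esub> h t) = \<one>\<^bsub>T\<^esub>" .
  qed
  show ?thesis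
  proof
    show "g \<in> Ring.ring_hom (localization R S) T"
    proof (rule ring_hom_memI)
      fix x y assume "x \<in> carrier (localization R S)" "y \<in> carrier (localization R S)"
      then obtain a s b t where 1: "a \<in> carrier R" "s \<in> S" "b \<in> carrier R" "t \<in> S"
        "x = fraction R S a s" "y = fraction R S b t"
        by (auto simp: localization_carrier)
      have cc: "t \<in> carrier R" "s \<in> carrier R" using 1 by simp_all
      have U: "h s \<in> Units T" "h t \<in> Units T" using units 1 by auto
      have c: "h s \<in> carrier T" "h t \<in> carrier T" "h a \<in> carrier T" "h b \<in> carrier T"
         "inv\<^bsub>T\<^esub> h s \<in> carrier T" "inv\<^bsub>T\<^esub> h t \<in> carrier T" using 1 cc U by auto
      show "g (x \<otimes>\<^bsub>localization R S\<^esub> y) = g x \<otimes>\<^bsub>T\<^esub> g y"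
        using 1 cc c by (simp add: fraction_ops g inv1 T.m_ac)
      have i: "h s \<otimes>\<^bsub>T\<^esub> inv\<^bsub>T\<^esub> h s = \<one>\<^bsub>T\<^esub>" "h t \<otimes>\<^bsub>T\<^esub> inv\<^bsub>T\<^esub> h t = \<one>\<^bsub>T\<^esub>" using U by simp_all
      have "(h a \<otimes>\<^bsub>T\<^esub> h t \<oplus>\<^bsub>T\<^esub> h b \<otimes>\<^bsub>T\<^esub> h s) \<otimes>\<^bsub>T\<^esub> (inv\<^bsub>T\<^esub> h s \<otimes>\<^bsub>T\<^esub> inv\<^bsub>T\<^esub> h t) =
        (h a \<otimes>\<^bsub>T\<^esub> inv\<^bsub>T\<^esub> h s) \<otimes>\<^bsub>T\<^esub> (h t \<otimes>\<^bsub>T\<^esub> inv\<^bsub>T\<^esub> h t) \<oplus>\<^bsub>T\<^esub> (h b \<otimes>\<^bsub>T\<^esub> inv\<^bsub>T\<^esub> h t) \<otimes>\<^bsub>T\<^esub> (h s \<otimes>\<^bsub>T\<^esub> inv\<^bsub>T\<^esub> h s)"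
        using c by (simp add: T.l_distr T.r_distr T.m_ac)
      then show "g (x \<oplus>\<^bsub>localization R S\<^esub> y) = g x \<oplus>\<^bsub>T\<^esub> g y"
        using 1 cc c by (simp add: fraction_ops g inv1 i)
      show "g x \<in> carrier T" using 1 c by (simp add: g)
    qed (simp add: fraction_ops g)
    show "g (fraction R S a \<one>) = h a" if "a \<in> carrier R" for a
      using that by (simp add: g)
  qed
qed

end

text \<open>The value of the map of localizations induced by \<open>h\<close>, for a definition by union over
  representatives as in \<^const>\<open>Spec_map\<close>.\<close>

lemma fraction_map:
  assumes "cring_submonoid R S" "cring_submonoid R' S'" "h \<in> Ring.ring_hom R R'" "h ` S \<subseteq> S'"
    and "a \<in> carrier R" "s \<in> S"
  shows "(\<Union>(b, t)\<in>fraction R S a s. fraction R' S' (h b) (h t)) = fraction R' S' (h a) (h s)"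
proof -
  interpret A: cring_submonoid R S by fact
  interpret B: cring_submonoid R' S' by fact
  interpret h: ring_hom_cring R R' h using assms by unfold_locales
  show ?thesis
  proof (rule A.Union_fraction)
    fix b t assume bt: "b \<in> carrier R" "t \<in> S" "fraction R S b t = fraction R S a s"
    then obtain u where u: "u \<in> S" "u \<otimes>\<^bsub>R\<^esub> (b \<otimes>\<^bsub>R\<^esub> s) = u \<otimes>\<^bsub>R\<^esub> (a \<otimes>\<^bsub>R\<^esub> t)"
      using assms(5,6) by (auto simp: A.fraction_eq_iff)
    have "h u \<otimes>\<^bsub>R'\<^esub> (h b \<otimes>\<^bsub>R'\<^esub> h s) = h (u \<otimes>\<^bsub>R\<^esub> (b \<otimes>\<^bsub>R\<^esub> s))"
      using u(1) bt(1) assms(6) by simp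
    also have "\<dots> = h (u \<otimes>\<^bsub>R\<^esub> (a \<otimes>\<^bsub>R\<^esub> t))" by (simp only: u(2))
    also have "\<dots> = h u \<otimes>\<^bsub>R'\<^esub> (h a \<otimes>\<^bsub>R'\<^esub> h t)"
      using u(1) bt(2) assms(5) by simp
    finally have "h u \<otimes>\<^bsub>R'\<^esub> (h b \<otimes>\<^bsub>R'\<^esub> h s) = h u \<otimes>\<^bsub>R'\<^esub> (h a \<otimes>\<^bsub>R'\<^esub> h t)" .
    then show "fraction R' S' (h b) (h t) = fraction R' S' (h a) (h s)"
      using assms u bt by (subst B.fraction_eq_iff) auto
  qed fact+
qed

text \<open>For \<open>S\<close> the complement of a prime ideal, membership in \<open>S\<close> is itself unfolded to membership in
  the carrier, so that this rule would make the simplifier loop.\<close>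

declare (in cring_submonoid) mem_carrier [simp del]

section \<open>The spectrum as a functor\<close>

lemma prime_submonoid:
  assumes "cring R" "p \<in> prime_spectrum R"
  shows "cring_submonoid R (carrier R - p)"
proof -
  interpret cring R by fact
  interpret p: primeideal p R using assms(2) by (simp add: prime_spectrum_def)
  have "\<one>\<^bsub>R\<^esub> \<notin> p" using p.one_imp_carrier p.I_notcarr by blast
  then show ?thesis
    by (intro cring_submonoid.intro submonoid.intro) (auto intro: cring_axioms dest: p.I_prime)
qed

lemma prime_subset:
  assumes "p \<in> prime_spectrum R"
  shows "p \<subseteq> carrier R"
proof -
  interpret primeideal p R using assms by (simp add: prime_spectrum_def)
  show ?thesis by (rule a_subset)
qed

lemma topspace_zariski:
  assumes "cring R" shows "topspace (zariski R) = prime_spectrum R"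
proof -
  have "openin (zariski R) U \<Longrightarrow> U \<subseteq> prime_spectrum R" for U
    using assms by (auto simp: openin_zariski)
  moreover have "openin (zariski R) (prime_spectrum R)"
  proof -
    have "\<not> carrier R \<subseteq> p" if "p \<in> prime_spectrum R" for p
      using that primeideal.I_notcarr[of p R] prime_subset[OF that]
      by (auto simp: prime_spectrum_def)
    then show ?thesis using assms by (auto simp: openin_zariski intro!: exI[of _ "carrier R"])
  qed
  ultimately show ?thesis unfolding topspace_def by blast
qed

lemma Spec_sel [simp]:
  "points (Spec R) = zariski R"
  "sect (Spec R) = structure_sheaf R"
  "restr (Spec R) U V s = restrict s V"
  by (simp_all add: Spec_def)

lemma structure_sheaf_sel:
  "\<one>\<^bsub>structure_sheaf R U\<^esub> = (\<lambda>p\<in>U. \<one>\<^bsub>stalk R p\<^esub>)"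
  "s \<otimes>\<^bsub>structure_sheaf R U\<^esub> t = (\<lambda>p\<in>U. s p \<otimes>\<^bsub>stalk R p\<^esub> t p)"
  "s \<oplus>\<^bsub>structure_sheaf R U\<^esub> t = (\<lambda>p\<in>U. s p \<oplus>\<^bsub>stalk R p\<^esub> t p)"
  by (simp_all add: structure_sheaf_def)

lemma structure_sheaf_carrier:
  "s \<in> carrier (structure_sheaf R U) \<longleftrightarrow> s \<in> (\<Pi>\<^sub>E p\<in>U. carrier (stalk R p)) \<and>
    (\<forall>p\<in>U. \<exists>V a f. openin (zariski R) V \<and> p \<in> V \<and> V \<subseteq> U \<and> a \<in> carrier R \<and> f \<in> carrier R \<and>
         (\<forall>q\<in>V. f \<notin> q \<and> s q = fraction R (carrier R - q) a f))"
  by (simp add: structure_sheaf_def)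

text \<open>The preimage of \<open>q\<close> in the carrier of \<open>R\<close>: this is \<^const>\<open>Spec_map\<close> on points.\<close>

definition contraction :: "'a ring \<Rightarrow> ('a \<Rightarrow> 'b) \<Rightarrow> 'b set \<Rightarrow> 'a set" where
  "contraction R h q = {a \<in> carrier R. h a \<in> q}"

text \<open>The map from the stalk at the contraction of \<open>q\<close> to the stalk at \<open>q\<close>, \<open>a/t \<mapsto> h a/h t\<close>, as a
  union over representatives; \<^const>\<open>Spec_map\<close> applies it to sections pointwise.\<close>

definition stalk_map :: "'b ring \<Rightarrow> ('a \<Rightarrow> 'b) \<Rightarrow> 'b set \<Rightarrow> ('a \<times> 'a) set \<Rightarrow> ('b \<times> 'b) set" where
  "stalk_map S h q x = (\<Union>(a, t)\<in>x. fraction S (carrier S - q) (h a) (h t))"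

lemma Spec_map_sel:
  "fst (Spec_map R S h) = contraction R h"
  "snd (Spec_map R S h) V s =
     (\<lambda>q\<in>{q \<in> prime_spectrum S. contraction R h q \<in> V}. stalk_map S h q (s (contraction R h q)))"
  by (simp_all add: Spec_map_def contraction_def [abs_def] stalk_map_def Let_def)

lemma preimage_Spec_map:
  assumes "cring S"
  shows "preimage (Spec S) (Spec_map R S h) V = {q \<in> prime_spectrum S. contraction R h q \<in> V}"
  using assms by (simp add: preimage_def topspace_zariski Spec_map_sel)

text \<open>A homomorphism of commutative rings, for rings of the plain record type that the
  localization requires.\<close>

locale cring_hom = R: cring R + S: cring S for R :: "'a ring" and S :: "'b ring" +
  fixes h
  assumes h: "h \<in> Ring.ring_hom R S"
begin

sublocale ring_hom_cring R S h by unfold_locales (rule h)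

lemma contraction_prime:
  assumes "q \<in> prime_spectrum S"
  shows "contraction R h q \<in> prime_spectrum R"
  using assms ring.primeideal_vimage[OF R.is_cring]
  by (simp add: prime_spectrum_def contraction_def)

lemma openin_preimage:
  assumes "openin (zariski R) V"
  shows "openin (zariski S) {q \<in> prime_spectrum S. contraction R h q \<in> V}"
proof -
  from assms obtain E where E: "E \<subseteq> carrier R" "V = {p \<in> prime_spectrum R. \<not> E \<subseteq> p}"
    by (auto simp: openin_zariski R.is_cring)
  have "{q \<in> prime_spectrum S. contraction R h q \<in> V} = {q \<in> prime_spectrum S. \<not> h ` E \<subseteq> q}"
    using E contraction_prime by (auto simp: contraction_def)
  moreover have "h ` E \<subseteq> carrier S" using E by auto
  ultimately show ?thesis by (auto simp: openin_zariski S.is_cring)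
qed

lemma continuous_contraction: "continuous_map (zariski S) (zariski R) (contraction R h)"
  unfolding continuous_map_alt
proof (intro conjI allI impI)
  show "contraction R h \<in> topspace (zariski S) \<rightarrow> topspace (zariski R)"
    using contraction_prime by (simp add: topspace_zariski R.is_cring S.is_cring)
  fix V assume "openin (zariski R) V"
  moreover have "contraction R h -` V \<inter> topspace (zariski S) = {q \<in> prime_spectrum S. contraction R h q \<in> V}"
    by (auto simp: topspace_zariski S.is_cring)
  ultimately show "openin (zariski S) (contraction R h -` V \<inter> topspace (zariski S))"
    using openin_preimage by simp
qed

context
  fixes q assumes q: "q \<in> prime_spectrum S"
begin

interpretation SR: cring_submonoid R "carrier R - contraction R h q"
  by (rule prime_submonoid[OF R.is_cring contraction_prime[OF q]])

interpretation SS: cring_submonoid S "carrier S - q"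
  by (rule prime_submonoid[OF S.is_cring q])

lemma stalk_map_fraction:
  assumes "a \<in> carrier R" "t \<in> carrier R - contraction R h q"
  shows "stalk_map S h q (fraction R (carrier R - contraction R h q) a t) =
    fraction S (carrier S - q) (h a) (h t)"
  unfolding stalk_map_def
  by (rule fraction_map[OF SR.cring_submonoid_axioms SS.cring_submonoid_axioms h _ assms])
    (auto simp: contraction_def)

lemma stalk_map_hom: "stalk_map S h q \<in> Ring.ring_hom (stalk R (contraction R h q)) (stalk S q)"
proof -
  have mem: "h t \<in> carrier S - q" if "t \<in> carrier R - contraction R h q" for t
    using that by (auto simp: contraction_def)
  show ?thesis
  proof (rule ring_hom_memI)
    fix x y assume "x \<in> carrier (stalk R (contraction R h q))" "y \<in> carrier (stalk R (contraction R h q))"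
    then obtain a s b t where 1: "a \<in> carrier R" "b \<in> carrier R"
      "s \<in> carrier R - contraction R h q" "t \<in> carrier R - contraction R h q"
      and x: "x = fraction R (carrier R - contraction R h q) a s"
      and y: "y = fraction R (carrier R - contraction R h q) b t"
      unfolding SR.localization_carrier by blast
    have st: "s \<otimes>\<^bsub>R\<^esub> t \<in> carrier R - contraction R h q" using 1 SR.m_closed by blast
    note m = mem[OF 1(3)] mem[OF 1(4)]
    have c: "s \<in> carrier R" "t \<in> carrier R" using 1 by auto
    show "stalk_map S h q x \<in> carrier (stalk S q)"
      using 1 m by (simp add: x stalk_map_fraction SS.fraction_closed del: Diff_iff)
    show "stalk_map S h q (x \<otimes>\<^bsub>stalk R (contraction R h q)\<^esub> y) =
        stalk_map S h q x \<otimes>\<^bsub>stalk S q\<^esub> stalk_map S h q y"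
      using 1 m st c by (simp add: x y stalk_map_fraction SS.fraction_mult SR.fraction_mult del: Diff_iff)
    show "stalk_map S h q (x \<oplus>\<^bsub>stalk R (contraction R h q)\<^esub> y) =
        stalk_map S h q x \<oplus>\<^bsub>stalk S q\<^esub> stalk_map S h q y"
      using 1 m st c by (simp add: x y stalk_map_fraction SS.fraction_add SR.fraction_add del: Diff_iff)
  next
    show "stalk_map S h q \<one>\<^bsub>stalk R (contraction R h q)\<^esub> = \<one>\<^bsub>stalk S q\<^esub>"
      using SR.one_closed by (simp add: SR.fraction_one SS.fraction_one stalk_map_fraction del: Diff_iff)
  qed
qed

end

lemma sheaf_map_hom:
  assumes V: "openin (zariski R) V"
  shows "snd (Spec_map R S h) V \<in>
    Ring.ring_hom (structure_sheaf R V) (structure_sheaf S {q \<in> prime_spectrum S. contraction R h q \<in> V})"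
    (is "_ \<in> Ring.ring_hom _ (structure_sheaf S ?W)")
proof (rule ring_hom_memI)
  have W: "q \<in> prime_spectrum S" "contraction R h q \<in> V" if "q \<in> ?W" for q using that by auto
  have val: "s (contraction R h q) \<in> carrier (stalk R (contraction R h q))"
    if "s \<in> carrier (structure_sheaf R V)" "q \<in> ?W" for s q
    using that by (auto simp: structure_sheaf_carrier)
  show "snd (Spec_map R S h) V s \<in> carrier (structure_sheaf S ?W)"
    if s: "s \<in> carrier (structure_sheaf R V)" for s
      unfolding structure_sheaf_carrier
    proof (intro conjI ballI)
      show "snd (Spec_map R S h) V s \<in> (\<Pi>\<^sub>E q\<in>?W. carrier (stalk S q))"
        using val[OF s] ring_hom_closed[OF stalk_map_hom] by (auto simp: Spec_map_sel)
      fix q assume q: "q \<in> ?W"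
      then obtain U a f where U: "openin (zariski R) U" "contraction R h q \<in> U" "U \<subseteq> V"
        and af: "a \<in> carrier R" "f \<in> carrier R"
        and eq: "\<forall>p\<in>U. f \<notin> p \<and> s p = fraction R (carrier R - p) a f"
        using s unfolding structure_sheaf_carrier by blast
      show "\<exists>U a f. openin (zariski S) U \<and> q \<in> U \<and> U \<subseteq> ?W \<and> a \<in> carrier S \<and> f \<in> carrier S \<and>
         (\<forall>r\<in>U. f \<notin> r \<and> snd (Spec_map R S h) V s r = fraction S (carrier S - r) a f)"
      proof (rule exI[of _ "{q \<in> prime_spectrum S. contraction R h q \<in> U}"], rule exI[of _ "h a"],
          rule exI[of _ "h f"], intro conjI ballI)
        fix r assume r: "r \<in> {q \<in> prime_spectrum S. contraction R h q \<in> U}"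
        then have f: "f \<notin> contraction R h r" "s (contraction R h r) = fraction R (carrier R - contraction R h r) a f"
          using eq by auto
        then show "h f \<notin> r" using af by (simp add: contraction_def)
        have "r \<in> ?W" using r U by auto
        then show "snd (Spec_map R S h) V s r = fraction S (carrier S - r) (h a) (h f)"
          using r f af by (simp add: Spec_map_sel stalk_map_fraction)
      qed (use U q af openin_preimage in auto)
    qed
  fix s t assume s: "s \<in> carrier (structure_sheaf R V)" and t: "t \<in> carrier (structure_sheaf R V)"
  show "snd (Spec_map R S h) V (s \<otimes>\<^bsub>structure_sheaf R V\<^esub> t) =
      snd (Spec_map R S h) V s \<otimes>\<^bsub>structure_sheaf S ?W\<^esub> snd (Spec_map R S h) V t"
    unfolding Spec_map_sel structure_sheaf_sel
    by (rule restrict_ext) (use val[OF s] val[OF t] ring_hom_mult[OF stalk_map_hom] in simp)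
  show "snd (Spec_map R S h) V (s \<oplus>\<^bsub>structure_sheaf R V\<^esub> t) =
      snd (Spec_map R S h) V s \<oplus>\<^bsub>structure_sheaf S ?W\<^esub> snd (Spec_map R S h) V t"
    unfolding Spec_map_sel structure_sheaf_sel
    by (rule restrict_ext) (use val[OF s] val[OF t] ring_hom_add[OF stalk_map_hom] in simp)
next
  show "snd (Spec_map R S h) V \<one>\<^bsub>structure_sheaf R V\<^esub> = \<one>\<^bsub>structure_sheaf S ?W\<^esub>"
    unfolding Spec_map_sel structure_sheaf_sel
    by (rule restrict_ext) (use ring_hom_one[OF stalk_map_hom] in simp)
qed

end

lemma contraction_comp:
  assumes "h \<in> Ring.ring_hom R S" "\<And>a. a \<in> carrier R \<Longrightarrow> g (h a) = k a"
  shows "contraction R h (contraction S g q) = contraction R k q"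
  using assms ring_hom_closed[OF assms(1)] by (auto simp: contraction_def)

lemma stalk_map_comp:
  assumes "cring_hom R S h" "cring_hom S T g" and gh: "\<And>a. a \<in> carrier R \<Longrightarrow> g (h a) = k a"
    and q: "q \<in> prime_spectrum T" and x: "x \<in> carrier (stalk R (contraction R k q))"
  shows "stalk_map T g q (stalk_map S h (contraction S g q) x) = stalk_map T k q x"
proof -
  interpret h: cring_hom R S h by fact
  interpret g: cring_hom S T g by fact
  have k: "k \<in> Ring.ring_hom R T"
    by (rule ring_hom_memI) (simp_all flip: gh)
  interpret k: cring_hom R T k by unfold_locales (rule k)
  have q': "contraction S g q \<in> prime_spectrum S" by (rule g.contraction_prime[OF q])
  note comp = contraction_comp[where g = g and k = k, OF h.h gh]
  interpret SR: cring_submonoid R "carrier R - contraction R k q"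
    by (rule prime_submonoid[OF h.R.is_cring k.contraction_prime[OF q]])
  obtain a t where at: "a \<in> carrier R" "t \<in> carrier R - contraction R k q"
    and x': "x = fraction R (carrier R - contraction R k q) a t"
    using x unfolding SR.localization_carrier by blast
  have 1: "stalk_map S h (contraction S g q) x = fraction S (carrier S - contraction S g q) (h a) (h t)"
    using h.stalk_map_fraction[OF q', of a t] at by (simp add: comp x')
  have "h t \<in> carrier S - contraction S g q" using at gh by (auto simp: contraction_def)
  then have "stalk_map T g q (stalk_map S h (contraction S g q) x) = fraction T (carrier T - q) (g (h a)) (g (h t))"
    unfolding 1 using at by (intro g.stalk_map_fraction[OF q]) auto
  also have "\<dots> = stalk_map T k q x"
    using k.stalk_map_fraction[OF q at] at gh by (simp add: x')
  finally show ?thesis .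
qed

lemma Spec_map_comp:
  assumes "cring_hom R S h" "cring_hom S T g" and gh: "\<And>a. a \<in> carrier R \<Longrightarrow> g (h a) = k a"
    and s: "s \<in> carrier (structure_sheaf R V)"
  shows "snd (Spec_map S T g) (preimage (Spec S) (Spec_map R S h) V) (snd (Spec_map R S h) V s) =
    snd (Spec_map R T k) V s"
proof -
  interpret h: cring_hom R S h by fact
  interpret g: cring_hom S T g by fact
  note comp = contraction_comp[where g = g and k = k, OF h.h gh]
  show ?thesis
  proof
    fix q
    show "snd (Spec_map S T g) (preimage (Spec S) (Spec_map R S h) V) (snd (Spec_map R S h) V s) q =
        snd (Spec_map R T k) V s q"
    proof (cases "q \<in> prime_spectrum T \<and> contraction R k q \<in> V")
      case True
      then have "s (contraction R k q) \<in> carrier (stalk R (contraction R k q))"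
        using s by (auto simp: structure_sheaf_carrier)
      then show ?thesis
        using True stalk_map_comp[where k = k, OF assms(1,2) gh] g.contraction_prime
        by (simp add: Spec_map_sel preimage_Spec_map[OF h.S.is_cring] comp)
    next
      case False
      then show ?thesis
        using g.contraction_prime
        by (auto simp: Spec_map_sel preimage_Spec_map[OF h.S.is_cring] comp)
    qed
  qed
qed

lemma Spec_map_id:
  assumes "cring R" "\<And>a. a \<in> carrier R \<Longrightarrow> k a = a"
    and V: "openin (zariski R) V" and s: "s \<in> carrier (structure_sheaf R V)"
  shows "snd (Spec_map R R k) V s = s"
proof
  fix p
  have k: "k \<in> Ring.ring_hom R R"
    using assms(1) cring.axioms(1)[of R] by (intro ring_hom_memI) (simp_all add: assms(2) ring.ring_simprules)
  interpret cring R by fact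
  interpret k: cring_hom R R k by unfold_locales (rule k)
  have sub: "V \<subseteq> prime_spectrum R" using V openin_subset topspace_zariski[OF assms(1)] by metis
  have id: "contraction R k q = q" if "q \<in> prime_spectrum R" for q
    using prime_subset[OF that] assms(2) by (auto simp: contraction_def)
  show "snd (Spec_map R R k) V s p = s p"
  proof (cases "p \<in> V")
    case True
    then have p: "p \<in> prime_spectrum R" using sub by blast
    interpret cring_submonoid R "carrier R - p" by (rule prime_submonoid[OF assms(1) p])
    have "s p \<in> carrier (stalk R p)" using s True by (auto simp: structure_sheaf_carrier)
    then obtain a t where at: "a \<in> carrier R" "t \<in> carrier R - p" "s p = fraction R (carrier R - p) a t"
      unfolding localization_carrier by blast
    then have "stalk_map R k p (s p) = s p"
      using k.stalk_map_fraction[OF p, of a t] assms(2) by (simp add: id[OF p])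
    then show ?thesis using True p by (simp add: Spec_map_sel id)
  next
    case False
    then have "s p = undefined" using s by (auto simp: structure_sheaf_carrier)
    then show ?thesis using False id by (auto simp: Spec_map_sel)
  qed
qed

text \<open>By functoriality, the maps on points and on sections induced by \<open>g\<close> are inverse to those
  induced by \<open>h\<close>.\<close>

lemma Spec_map_scheme_iso:
  assumes "cring_hom R S h" "cring_hom S R g"
    and gh: "\<And>a. a \<in> carrier R \<Longrightarrow> g (h a) = a" and hg: "\<And>b. b \<in> carrier S \<Longrightarrow> h (g b) = b"
  shows "scheme_iso (Spec S) (Spec R) (Spec_map R S h)"
proof -
  interpret h: cring_hom R S h by fact
  interpret g: cring_hom S R g by fact
  have cgh: "contraction R h (contraction S g p) = p" if "p \<in> prime_spectrum R" for p
    using prime_subset[OF that] gh by (auto simp: contraction_def)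
  have chg: "contraction S g (contraction R h q) = q" if "q \<in> prime_spectrum S" for q
    using prime_subset[OF that] hg by (auto simp: contraction_def)
  let ?pre = "preimage (Spec S) (Spec_map R S h)"
  have pre: "?pre V = {q \<in> prime_spectrum S. contraction R h q \<in> V}" for V
    by (rule preimage_Spec_map[OF h.S.is_cring])
  have prepre: "preimage (Spec R) (Spec_map S R g) (?pre V) = V" if "openin (zariski R) V" for V
  proof -
    have "V \<subseteq> prime_spectrum R" using that openin_subset topspace_zariski[OF h.R.is_cring] by metis
    then show ?thesis
      using cgh g.contraction_prime by (auto simp: preimage_Spec_map h.R.is_cring pre)
  qed
  show ?thesis
    unfolding scheme_iso_def Spec_sel
  proof (intro conjI allI impI)
    show "homeomorphic_map (zariski S) (zariski R) (fst (Spec_map R S h))"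
      unfolding Spec_map_sel
      using h.continuous_contraction g.continuous_contraction
      by (intro homeomorphic_maps_imp_map[of _ _ _ "contraction S g"])
        (simp add: homeomorphic_maps_def topspace_zariski h.R.is_cring h.S.is_cring cgh chg)
  next
    fix V assume V: "openin (zariski R) V"
    have W: "openin (zariski S) (?pre V)" unfolding pre by (rule h.openin_preimage[OF V])
    have hV: "snd (Spec_map R S h) V \<in> Ring.ring_hom (structure_sheaf R V) (structure_sheaf S (?pre V))"
      unfolding pre by (rule h.sheaf_map_hom[OF V])
    have gW: "snd (Spec_map S R g) (?pre V) \<in> Ring.ring_hom (structure_sheaf S (?pre V)) (structure_sheaf R V)"
      using g.sheaf_map_hom[OF W] prepre[OF V] by (simp add: preimage_Spec_map h.R.is_cring)
    have 1: "snd (Spec_map S R g) (?pre V) (snd (Spec_map R S h) V s) = s"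
      if "s \<in> carrier (structure_sheaf R V)" for s
      using Spec_map_comp[where k = "\<lambda>a. a", OF assms(1,2) gh that]
        Spec_map_id[OF h.R.is_cring refl V that] by simp
    have 2: "snd (Spec_map R S h) V (snd (Spec_map S R g) (?pre V) s) = s"
      if "s \<in> carrier (structure_sheaf S (?pre V))" for s
      using Spec_map_comp[where k = "\<lambda>a. a", OF assms(2,1) hg that]
        Spec_map_id[OF h.S.is_cring refl W that] prepre[OF V] by simp
    show "snd (Spec_map R S h) V \<in> ring_iso (structure_sheaf R V) (structure_sheaf S (?pre V))"
      unfolding ring_iso_def
      by (intro CollectI conjI hV bij_betw_byWitness[where f' = "snd (Spec_map S R g) (?pre V)"])
        (use 1 2 ring_hom_closed[OF hV] ring_hom_closed[OF gW] in auto)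
  next
    fix U V s assume "openin (zariski R) U" "openin (zariski R) V" "V \<subseteq> U"
      "s \<in> carrier (structure_sheaf R U)"
    then show "snd (Spec_map R S h) V (restrict s V) =
        restrict (snd (Spec_map R S h) U s) (?pre V)"
      by (auto simp: Spec_map_sel pre fun_eq_iff)
  qed
qed

lemma Spec_map_scheme_iso_over:
  assumes "cring_hom R S h" "cring_hom S R g"
    and "\<And>a. a \<in> carrier R \<Longrightarrow> g (h a) = a" "\<And>b. b \<in> carrier S \<Longrightarrow> h (g b) = b"
    and i: "cring_hom K R i" and j: "cring_hom K S j" and hi: "\<And>c. c \<in> carrier K \<Longrightarrow> h (i c) = j c"
  shows "scheme_iso_over (Spec K) (Spec S) (Spec_map K S j) (Spec R) (Spec_map K R i) (Spec_map R S h)"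
  unfolding scheme_iso_over_def
proof (intro conjI ballI allI impI)
  show "scheme_iso (Spec S) (Spec R) (Spec_map R S h)"
    by (rule Spec_map_scheme_iso[OF assms(1-4)])
  interpret i: cring_hom K R i by fact
  show "fst (Spec_map K R i) (fst (Spec_map R S h) x) = fst (Spec_map K S j) x" for x
    unfolding Spec_map_sel by (rule contraction_comp[where g = h and k = j, OF i.h hi])
  fix U s assume "s \<in> carrier (sect (Spec K) U)"
  then show "snd (Spec_map R S h) (preimage (Spec R) (Spec_map K R i) U) (snd (Spec_map K R i) U s) =
      snd (Spec_map K S j) U s"
    by (intro Spec_map_comp[where k = j, OF i assms(1) hi]) simp_all
qed

section \<open>Universal properties of quotients and of polynomial rings\<close>

lemma quotient_universal:
  assumes "ideal I R" "ring T" and h: "h \<in> Ring.ring_hom R T" and ker: "\<And>x. x \<in> I \<Longrightarrow> h x = \<zero>\<^bsub>T\<^esub>"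
  obtains g where "g \<in> Ring.ring_hom (R Quot I) T" "\<And>a. a \<in> carrier R \<Longrightarrow> g (I +>\<^bsub>R\<^esub> a) = h a"
proof -
  interpret I: ideal I R by fact
  interpret T: ring T by fact
  interpret h: ring_hom_ring R T h using h by unfold_locales
  define g where "g x = h (SOME z. z \<in> x)" for x
  have g: "g (I +>\<^bsub>R\<^esub> a) = h a" if a: "a \<in> carrier R" for a
  proof -
    have "(SOME x. x \<in> I +>\<^bsub>R\<^esub> a) \<in> I +>\<^bsub>R\<^esub> a"
      using I.a_rcos_self[OF a] by (rule someI)
    then obtain i where i: "i \<in> I" "(SOME x. x \<in> I +>\<^bsub>R\<^esub> a) = i \<oplus>\<^bsub>R\<^esub> a"
      by (auto simp: a_r_coset_def')
    then show ?thesis using a ker[OF i(1)] I.a_Hcarr[OF i(1)] by (simp add: g_def)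
  qed
  have rep: "\<exists>a\<in>carrier R. x = I +>\<^bsub>R\<^esub> a" if "x \<in> carrier (R Quot I)" for x
    using that by (auto simp: FactRing_def A_RCOSETS_def')
  note q = ring_hom_mult[OF I.rcos_ring_hom, symmetric] ring_hom_add[OF I.rcos_ring_hom, symmetric]
    ring_hom_one[OF I.rcos_ring_hom, symmetric]
  show ?thesis
  proof
    show "g \<in> Ring.ring_hom (R Quot I) T"
    proof (rule ring_hom_memI)
      fix x y assume "x \<in> carrier (R Quot I)" "y \<in> carrier (R Quot I)"
      then obtain a b where ab: "a \<in> carrier R" "b \<in> carrier R" and x: "x = I +>\<^bsub>R\<^esub> a" and y: "y = I +>\<^bsub>R\<^esub> b"
        using rep by meson
      show "g x \<in> carrier T" "g (x \<otimes>\<^bsub>R Quot I\<^esub> y) = g x \<otimes>\<^bsub>T\<^esub> g y"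
        "g (x \<oplus>\<^bsub>R Quot I\<^esub> y) = g x \<oplus>\<^bsub>T\<^esub> g y"
        using ab by (simp_all add: x y q g)
    qed (simp add: q g)
  qed (rule g)
qed

lemma quotient_carrierE:
  assumes "ring R" "x \<in> carrier (R Quot I)"
  obtains a where "a \<in> carrier R" "x = I +>\<^bsub>R\<^esub> a"
  using assms by (auto simp: FactRing_def A_RCOSETS_def')

lemma type_ring_sel [simp]:
  "carrier ring_of_type_algebra = (UNIV :: 'a::ring_1 set)"
  "x \<otimes>\<^bsub>ring_of_type_algebra\<^esub> y = (x * y :: 'a)"
  "x \<oplus>\<^bsub>ring_of_type_algebra\<^esub> y = (x + y :: 'a)"
  "\<one>\<^bsub>ring_of_type_algebra\<^esub> = (1 :: 'a)"
  "\<zero>\<^bsub>ring_of_type_algebra\<^esub> = (0 :: 'a)"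
  by (simp_all add: ring_of_type_algebra_def)

lemma type_cring: "cring (ring_of_type_algebra :: 'a::comm_ring_1 ring)"
  by (rule cring_from_type_algebra)

lemma type_pow: "x [^]\<^bsub>ring_of_type_algebra\<^esub> (n::nat) = (x ^ n :: 'a::comm_ring_1)"
proof -
  interpret T: cring "ring_of_type_algebra :: 'a ring" by (rule type_cring)
  show ?thesis by (induction n) (simp_all add: mult.commute)
qed

lemma type_finsum:
  "finite A \<Longrightarrow> finsum ring_of_type_algebra f A = (sum f A :: 'a::comm_ring_1)"
proof (induction A rule: finite_induct)
  interpret T: cring "ring_of_type_algebra :: 'a ring" by (rule type_cring)
  { case empty show ?case by simp }
  case (insert x F) then show ?case by (simp add: T.finsum_insert)
qed

lemma type_finprod:
  "finite A \<Longrightarrow> finprod ring_of_type_algebra f A = (prod f A :: 'a::comm_ring_1)"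
proof (induction A rule: finite_induct)
  interpret T: cring "ring_of_type_algebra :: 'a ring" by (rule type_cring)
  { case empty show ?case by simp }
  case (insert x F) then show ?case by (simp add: T.finprod_insert)
qed

lemma Const_add: "Const (a + b) = Const a + (Const b :: ('v, 'k::comm_ring_1) mpoly)"
  and Const_mult: "Const (a * b) = Const a * (Const b :: ('v, 'k) mpoly)"
  and Const_one: "Const 1 = (1 :: ('v, 'k) mpoly)"
  and Const_zero: "Const 0 = (0 :: ('v, 'k) mpoly)"
  by (simp_all add: Const_def single_add mult_single)

lemma Const_hom: "Const \<in> Ring.ring_hom ring_of_type_algebra (ring_of_type_algebra :: ('v, 'k::comm_ring_1) mpoly ring)"
  by (rule ring_hom_memI) (simp_all add: Const_add Const_mult Const_one)

text \<open>The value of the monomial \<open>m\<close> when each variable \<open>v\<close> is given the value \<open>f v\<close> in \<open>S\<close>.\<close>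

definition monom_eval :: "'a ring \<Rightarrow> ('v \<Rightarrow> 'a) \<Rightarrow> ('v \<Rightarrow>\<^sub>0 nat) \<Rightarrow> 'a" where
  "monom_eval S f m = finprod S (\<lambda>v. f v [^]\<^bsub>S\<^esub> Poly_Mapping.lookup m v) (Poly_Mapping.keys m)"

text \<open>The value of a polynomial in a ring \<open>S\<close> given by a record, where \<open>c\<close> is the structure map on
  coefficients and \<open>f\<close> gives the values of the variables. Every variable of the type gets a value, so
  that evaluation is a homomorphism on all polynomials over the type.\<close>

definition poly_eval :: "'a ring \<Rightarrow> ('k \<Rightarrow> 'a) \<Rightarrow> ('v \<Rightarrow> 'a) \<Rightarrow> ('v, 'k::comm_ring_1) mpoly \<Rightarrow> 'a" where
  "poly_eval S c f p = finsum S (\<lambda>m. c (Poly_Mapping.lookup p m) \<otimes>\<^bsub>S\<^esub> monom_eval S f m) (Poly_Mapping.keys p)"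

lemma update_as_add:
  assumes "k \<notin> Poly_Mapping.keys p"
  shows "Poly_Mapping.update k v p = Poly_Mapping.single k v + p"
  by (rule poly_mapping_eqI)
    (use assms in \<open>auto simp: lookup_update lookup_add lookup_single when_def in_keys_iff\<close>)

text \<open>The data of an evaluation: \<open>S\<close> is a commutative algebra via \<open>c\<close>, and \<open>f\<close> takes values in it.\<close>

locale poly_evaluation = S: cring S for S :: "'a ring" +
  fixes c :: "'k::comm_ring_1 \<Rightarrow> 'a" and f :: "'v \<Rightarrow> 'a"
  assumes c: "c \<in> Ring.ring_hom ring_of_type_algebra S" and f: "\<And>v. f v \<in> carrier S"
begin

interpretation C: cring "ring_of_type_algebra :: 'k ring" by (rule type_cring)
interpretation c: ring_hom_cring "ring_of_type_algebra :: 'k ring" S c using c by unfold_locales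

lemma c_simps [simp]: "c x \<in> carrier S" "c (x + y) = c x \<oplus>\<^bsub>S\<^esub> c y" "c (x * y) = c x \<otimes>\<^bsub>S\<^esub> c y"
  "c 1 = \<one>\<^bsub>S\<^esub>" "c 0 = \<zero>\<^bsub>S\<^esub>"
  using c.hom_closed[of x] c.hom_add[of x y] c.hom_mult[of x y] c.hom_one c.hom_zero by simp_all

declare f [simp]

lemma monom_eval_closed [simp]: "monom_eval S f m \<in> carrier S"
  unfolding monom_eval_def by (rule S.finprod_closed) auto

lemma monom_eval_superset:
  assumes "finite A" "Poly_Mapping.keys m \<subseteq> A"
  shows "monom_eval S f m = finprod S (\<lambda>v. f v [^]\<^bsub>S\<^esub> Poly_Mapping.lookup m v) A"
  unfolding monom_eval_def using assms
  by (intro S.finprod_mono_neutral_cong_left) (auto simp: in_keys_iff)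

lemma monom_eval_add: "monom_eval S f (m + m') = monom_eval S f m \<otimes>\<^bsub>S\<^esub> monom_eval S f m'"
proof -
  let ?A = "Poly_Mapping.keys m \<union> Poly_Mapping.keys m'"
  have "monom_eval S f (m + m') = finprod S (\<lambda>v. f v [^]\<^bsub>S\<^esub> Poly_Mapping.lookup (m + m') v) ?A"
    by (rule monom_eval_superset) (auto dest: subsetD[OF Poly_Mapping.keys_add])
  also have "\<dots> = finprod S (\<lambda>v. f v [^]\<^bsub>S\<^esub> Poly_Mapping.lookup m v \<otimes>\<^bsub>S\<^esub> f v [^]\<^bsub>S\<^esub> Poly_Mapping.lookup m' v) ?A"
    by (rule S.finprod_cong') (auto simp: lookup_add S.nat_pow_mult)
  also have "\<dots> = finprod S (\<lambda>v. f v [^]\<^bsub>S\<^esub> Poly_Mapping.lookup m v) ?A \<otimes>\<^bsub>S\<^esub> finprod S (\<lambda>v. f v [^]\<^bsub>S\<^esub> Poly_Mapping.lookup m' v) ?A"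
    by (rule S.finprod_multf) auto
  also have "\<dots> = monom_eval S f m \<otimes>\<^bsub>S\<^esub> monom_eval S f m'"
    by (subst (1 2) monom_eval_superset[of ?A]) auto
  finally show ?thesis .
qed

lemma monom_eval_zero: "monom_eval S f 0 = \<one>\<^bsub>S\<^esub>"
  by (simp add: monom_eval_def)

lemma poly_eval_closed [simp]: "poly_eval S c f p \<in> carrier S"
  unfolding poly_eval_def by (rule S.finsum_closed) auto

lemma poly_eval_superset:
  assumes "finite A" "Poly_Mapping.keys p \<subseteq> A"
  shows "poly_eval S c f p = finsum S (\<lambda>m. c (Poly_Mapping.lookup p m) \<otimes>\<^bsub>S\<^esub> monom_eval S f m) A"
  unfolding poly_eval_def using assms
  by (intro S.add.finprod_mono_neutral_cong_left) (auto simp: in_keys_iff)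

lemma poly_eval_add: "poly_eval S c f (p + q) = poly_eval S c f p \<oplus>\<^bsub>S\<^esub> poly_eval S c f q"
proof -
  let ?A = "Poly_Mapping.keys p \<union> Poly_Mapping.keys q"
  let ?t = "\<lambda>p m. c (Poly_Mapping.lookup p m) \<otimes>\<^bsub>S\<^esub> monom_eval S f m"
  have "poly_eval S c f (p + q) = finsum S (?t (p + q)) ?A"
    by (rule poly_eval_superset) (auto dest: subsetD[OF Poly_Mapping.keys_add])
  also have "\<dots> = finsum S (\<lambda>m. ?t p m \<oplus>\<^bsub>S\<^esub> ?t q m) ?A"
    by (rule S.finsum_cong') (auto simp: lookup_add S.l_distr)
  also have "\<dots> = finsum S (?t p) ?A \<oplus>\<^bsub>S\<^esub> finsum S (?t q) ?A"
    by (rule S.finsum_addf) auto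
  also have "\<dots> = poly_eval S c f p \<oplus>\<^bsub>S\<^esub> poly_eval S c f q"
    by (subst (1 2) poly_eval_superset[of ?A]) auto
  finally show ?thesis .
qed

lemma poly_eval_single: "poly_eval S c f (Poly_Mapping.single m a) = c a \<otimes>\<^bsub>S\<^esub> monom_eval S f m"
  by (subst poly_eval_superset[of "{m}"]) (simp_all add: S.finsum_insert)

lemma poly_eval_zero: "poly_eval S c f 0 = \<zero>\<^bsub>S\<^esub>"
  by (simp add: poly_eval_def)

lemma poly_eval_mult: "poly_eval S c f (p * q) = poly_eval S c f p \<otimes>\<^bsub>S\<^esub> poly_eval S c f q"
proof (induction p rule: update_induct)
  case (update p m a)
  have "poly_eval S c f (Poly_Mapping.single m a * q) = (c a \<otimes>\<^bsub>S\<^esub> monom_eval S f m) \<otimes>\<^bsub>S\<^esub> poly_eval S c f q"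
  proof (induction q rule: update_induct)
    case (update q m' b)
    then show ?case
      by (simp add: update_as_add distrib_left poly_eval_add mult_single poly_eval_single monom_eval_add S.r_distr S.m_ac)
  qed (simp add: poly_eval_zero)
  then show ?case using update
    by (simp add: update_as_add distrib_right poly_eval_add poly_eval_single S.l_distr)
qed (simp add: poly_eval_zero)

lemma poly_eval_Const: "poly_eval S c f (Const a) = c a"
  by (simp add: Const_def poly_eval_single monom_eval_zero)

lemma poly_eval_Var: "poly_eval S c f (Var v) = f v"
proof -
  have "monom_eval S f (Poly_Mapping.single v 1) = f v"
    by (subst monom_eval_superset[of "{v}"]) (simp_all)
  then show ?thesis by (simp add: Var_def poly_eval_single)
qed

lemma poly_eval_hom: "poly_eval S c f \<in> Ring.ring_hom ring_of_type_algebra S"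
  by (rule ring_hom_memI)
    (use poly_eval_Const[of 1] in \<open>simp_all add: poly_eval_add poly_eval_mult Const_one\<close>)

end

lemma poly_subst_eval: "poly_subst f = poly_eval ring_of_type_algebra Const f"
  by (rule ext) (simp add: poly_subst_def poly_eval_def monom_eval_def type_finsum type_finprod type_pow)

lemma poly_subst_evaluation: "poly_evaluation ring_of_type_algebra (Const :: 'k::comm_ring_1 \<Rightarrow> ('w, 'k) mpoly) f"
  by (intro poly_evaluation.intro type_cring poly_evaluation_axioms.intro Const_hom) simp

lemma poly_subst_simps [simp]:
  fixes f :: "'v \<Rightarrow> ('a, 'b::comm_ring_1) mpoly"
  shows
  "poly_subst f (p + q) = poly_subst f p + poly_subst f q"
  "poly_subst f (p * q) = poly_subst f p * poly_subst f q"
  "poly_subst f (Const a) = Const a"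
  "poly_subst f (Var v) = f v"
  "poly_subst f 0 = 0"
  "poly_subst f 1 = 1"
proof -
  interpret poly_evaluation ring_of_type_algebra "Const :: 'b \<Rightarrow> ('a, 'b) mpoly" f
    by (rule poly_subst_evaluation)
  show "poly_subst f (p + q) = poly_subst f p + poly_subst f q"
    using poly_eval_add[of p q] by (simp only: poly_subst_eval type_ring_sel)
  show "poly_subst f (p * q) = poly_subst f p * poly_subst f q"
    using poly_eval_mult[of p q] by (simp only: poly_subst_eval type_ring_sel)
  show "poly_subst f (Const a) = Const a" for a
    using poly_eval_Const[of a] by (simp only: poly_subst_eval)
  from this[of 1] show "poly_subst f 1 = 1" by (simp only: Const_one)
  show "poly_subst f (Var v) = f v"
    using poly_eval_Var[of v] by (simp only: poly_subst_eval)
  show "poly_subst f 0 = 0"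
    using poly_eval_zero by (simp only: poly_subst_eval type_ring_sel)
qed

lemma poly_subst_comm_ring_hom: "comm_ring_hom (poly_subst f)"
  by unfold_locales simp_all

lemma poly_subst_uminus [simp]: "poly_subst f (- p) = - poly_subst f p"
  and poly_subst_diff [simp]: "poly_subst f (p - q) = poly_subst f p - poly_subst f q"
proof -
  interpret comm_ring_hom "poly_subst f" by (rule poly_subst_comm_ring_hom)
  show "poly_subst f (- p) = - poly_subst f p" "poly_subst f (p - q) = poly_subst f p - poly_subst f q"
    by (simp_all add: hom_distribs)
qed

lemma mpoly_ring_sel [simp]:
  "x \<otimes>\<^bsub>mpoly_ring V\<^esub> y = x * y" "x \<oplus>\<^bsub>mpoly_ring V\<^esub> y = x + y"
  "\<one>\<^bsub>mpoly_ring V\<^esub> = 1" "\<zero>\<^bsub>mpoly_ring V\<^esub> = 0"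
  by (simp_all add: mpoly_ring_def)

text \<open>The polynomials in the variables from \<open>V\<close>.\<close>

abbreviation polys :: "'v set \<Rightarrow> ('v, 'k::comm_ring_1) mpoly set" where
  "polys V \<equiv> carrier (mpoly_ring V)"

lemma polys_iff: "p \<in> polys V \<longleftrightarrow> (\<forall>m\<in>Poly_Mapping.keys p. Poly_Mapping.keys m \<subseteq> V)"
  by (simp add: mpoly_ring_def)

lemma polys_closed [simp, intro]:
  shows "p \<in> polys V \<Longrightarrow> q \<in> polys V \<Longrightarrow> p + q \<in> polys V"
    and "p \<in> polys V \<Longrightarrow> q \<in> polys V \<Longrightarrow> p * q \<in> polys V"
    and "p \<in> polys V \<Longrightarrow> - p \<in> polys V"
    and "p \<in> polys V \<Longrightarrow> q \<in> polys V \<Longrightarrow> p - q \<in> polys V"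
    and "0 \<in> polys V" "1 \<in> polys V" "Const a \<in> polys V" "v \<in> V \<Longrightarrow> Var v \<in> polys V"
proof -
  show "p \<in> polys V \<Longrightarrow> q \<in> polys V \<Longrightarrow> p + q \<in> polys V"
    using Poly_Mapping.keys_add[of p q] by (auto simp: polys_iff)
  show "p \<in> polys V \<Longrightarrow> q \<in> polys V \<Longrightarrow> p - q \<in> polys V"
    using Poly_Mapping.keys_diff[of p q] by (auto simp: polys_iff)
  show "p \<in> polys V \<Longrightarrow> - p \<in> polys V" by (simp add: polys_iff in_keys_iff)
  show "p * q \<in> polys V" if p: "p \<in> polys V" and q: "q \<in> polys V"
    unfolding polys_iff
  proof
    fix m assume "m \<in> Poly_Mapping.keys (p * q)"
    then obtain a b where "m = a + b" "a \<in> Poly_Mapping.keys p" "b \<in> Poly_Mapping.keys q"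
      using keys_mult[of p q] by blast
    then show "Poly_Mapping.keys m \<subseteq> V"
      using p q Poly_Mapping.keys_add[of a b] unfolding polys_iff by blast
  qed
qed (auto simp: polys_iff Const_def Var_def simp flip: single_one)

lemma polys_sum: "(\<And>x. x \<in> A \<Longrightarrow> f x \<in> polys V) \<Longrightarrow> sum f A \<in> polys V"
  by (induction A rule: infinite_finite_induct) auto

lemma polys_prod: "(\<And>x. x \<in> A \<Longrightarrow> f x \<in> polys V) \<Longrightarrow> prod f A \<in> polys V"
  by (induction A rule: infinite_finite_induct) auto

lemma polys_power: "p \<in> polys V \<Longrightarrow> p ^ n \<in> polys V"
  by (induction n) auto

lemma polys_det:
  assumes "\<And>i j. i < n \<Longrightarrow> j < n \<Longrightarrow> A $$ (i, j) \<in> polys V" "A \<in> carrier_mat n n"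
  shows "det A \<in> polys V"
proof -
  have "signof \<pi> \<in> polys V" for \<pi> by (simp add: sign_def)
  moreover have "\<pi> i < n" if "\<pi> permutes {0..<n}" "i < n" for \<pi> i
    using permutes_in_image[OF that(1), of i] that(2) by simp
  ultimately show ?thesis
    using assms by (auto simp: det_def' intro!: polys_sum polys_prod polys_closed(2))
qed

lemma mpoly_ring_cring: "cring (mpoly_ring V)"
proof (intro cringI abelian_groupI comm_monoidI)
  fix x :: "('a, 'b) mpoly" assume "x \<in> polys V"
  then show "\<exists>y\<in>polys V. y \<oplus>\<^bsub>mpoly_ring V\<^esub> x = \<zero>\<^bsub>mpoly_ring V\<^esub>"
    by (intro bexI[of _ "- x"]) auto
qed (auto simp: algebra_simps)

lemma poly_subst_closed:
  assumes "p \<in> polys V" "\<And>v. v \<in> V \<Longrightarrow> f v \<in> polys W"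
  shows "poly_subst f p \<in> polys W"
proof -
  have "Poly_Mapping.keys m \<subseteq> V" if "m \<in> Poly_Mapping.keys p" for m
    using assms(1) that by (simp add: polys_iff)
  then show ?thesis
    unfolding poly_subst_def
    by (intro polys_sum polys_closed(2) polys_closed(7) polys_prod polys_power assms(2)) blast
qed

lemma polys_induct [consumes 1, case_names Const Var add mult]:
  assumes "p \<in> polys V"
    and C: "\<And>a. P (Const a)" and Va: "\<And>v. v \<in> V \<Longrightarrow> P (Var v)"
    and add: "\<And>p q. p \<in> polys V \<Longrightarrow> q \<in> polys V \<Longrightarrow> P p \<Longrightarrow> P q \<Longrightarrow> P (p + q)"
    and mult: "\<And>p q. p \<in> polys V \<Longrightarrow> q \<in> polys V \<Longrightarrow> P p \<Longrightarrow> P q \<Longrightarrow> P (p * q)"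
  shows "P p"
proof -
  have pow: "P (Var v ^ n)" if "v \<in> V" for v n
  proof (induction n)
    case 0 show ?case using C[of 1] by (simp add: Const_one)
  next
    case (Suc n)
    then show ?case using that by (auto intro!: mult Va polys_power)
  qed
  have mon: "Poly_Mapping.keys m \<subseteq> V \<Longrightarrow> P (Poly_Mapping.single m 1)" for m :: "'a \<Rightarrow>\<^sub>0 nat"
  proof (induction m rule: update_induct)
    case const show ?case using C[of 1] by (simp add: Const_def)
  next
    case (update m v n)
    have V: "v \<in> V" "Poly_Mapping.keys m \<subseteq> V" using update by (auto simp: keys_update)
    have pw: "Var v ^ n = (Poly_Mapping.single (Poly_Mapping.single v n) 1 :: ('a, 'b) mpoly)" for n
      by (induction n) (simp_all add: Var_def mult_single flip: single_add)
    have "Poly_Mapping.single (Poly_Mapping.update v n m) 1 = Var v ^ n * (Poly_Mapping.single m 1 :: ('a, 'b) mpoly)"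
      using update by (simp add: pw mult_single update_as_add)
    then show ?case
      using V update pow by (auto intro!: mult polys_power simp: polys_iff)
  qed
  from assms(1) show ?thesis
  proof (induction p rule: update_induct)
    case const show ?case using C[of 0] by (simp add: Const_zero)
  next
    case (update p m a)
    have "Poly_Mapping.update m a p = Const a * Poly_Mapping.single m 1 + p"
      using update by (simp add: update_as_add Const_def mult_single)
    moreover have "Poly_Mapping.keys m \<subseteq> V" "p \<in> polys V" using update by (auto simp: polys_iff keys_update)
    moreover from this have "Poly_Mapping.single m 1 \<in> polys V" by (simp add: polys_iff)
    ultimately show ?case using update by (auto intro!: add mult C mon)
  qed
qed

lemma polys_hom_eqI:
  assumes "p \<in> polys V" "g \<in> Ring.ring_hom (mpoly_ring V) S" "h \<in> Ring.ring_hom (mpoly_ring V) S"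
    and "\<And>a. g (Const a) = h (Const a)" "\<And>v. v \<in> V \<Longrightarrow> g (Var v) = h (Var v)"
  shows "g p = h p"
  using assms(1)
proof (induction rule: polys_induct)
  case (add p q)
  then show ?case using ring_hom_add[OF assms(2), of p q] ring_hom_add[OF assms(3), of p q] by simp
next
  case (mult p q)
  then show ?case using ring_hom_mult[OF assms(2), of p q] ring_hom_mult[OF assms(3), of p q] by simp
qed (use assms in auto)

lemma mpoly_ring_hom_restrict:
  assumes "h \<in> Ring.ring_hom ring_of_type_algebra S"
  shows "h \<in> Ring.ring_hom (mpoly_ring V) S"
  using ring_hom_closed[OF assms] ring_hom_mult[OF assms] ring_hom_add[OF assms] ring_hom_one[OF assms]
  by (intro ring_hom_memI) simp_all

lemma poly_subst_hom:
  assumes "\<And>v. v \<in> V \<Longrightarrow> f v \<in> polys W"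
  shows "poly_subst f \<in> Ring.ring_hom (mpoly_ring V) (mpoly_ring W)"
  using assms by (intro ring_hom_memI) (auto intro: poly_subst_closed)

lemma poly_subst_comp:
  assumes "\<And>v. v \<in> V \<Longrightarrow> poly_subst f (g v) = h v" "p \<in> polys V"
  shows "poly_subst f (poly_subst g p) = poly_subst h p"
  using assms(2) by (induction rule: polys_induct) (simp_all add: assms(1))

section \<open>Determinants under homomorphisms\<close>

text \<open>Two determinants compared through homomorphisms into a common ring. They are taken in the domains, which
  are type-class rings, whereas the common target is a ring given by a record. The factors \<open>d i\<close> scale the
  rows.\<close>

lemma hom_det_scaled:
  fixes A :: "'a::comm_ring_1 mat" and B :: "'b::comm_ring_1 mat"
  assumes "cring S" and g: "g \<in> Ring.ring_hom ring_of_type_algebra S"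
    and h: "h \<in> Ring.ring_hom ring_of_type_algebra S"
    and A: "A \<in> carrier_mat n n" and B: "B \<in> carrier_mat n n"
    and eq: "\<And>i j. i < n \<Longrightarrow> j < n \<Longrightarrow> g (A $$ (i, j)) \<otimes>\<^bsub>S\<^esub> h (d i) = h (B $$ (i, j))"
  shows "g (det A) \<otimes>\<^bsub>S\<^esub> h (\<Prod>i<n. d i) = h (det B)"
proof -
  interpret S: cring S by fact
  interpret TA: cring "ring_of_type_algebra :: 'a ring" by (rule type_cring)
  interpret TB: cring "ring_of_type_algebra :: 'b ring" by (rule type_cring)
  interpret g: ring_hom_cring "ring_of_type_algebra :: 'a ring" S g using g by unfold_locales
  interpret h: ring_hom_cring "ring_of_type_algebra :: 'b ring" S h using h by unfold_locales
  have g': "g (x + y) = g x \<oplus>\<^bsub>S\<^esub> g y" "g (x * y) = g x \<otimes>\<^bsub>S\<^esub> g y"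
    "g 1 = \<one>\<^bsub>S\<^esub>" "g 0 = \<zero>\<^bsub>S\<^esub>" "g x \<in> carrier S" for x y
    using g.hom_add[of x y] g.hom_mult[of x y] g.hom_one g.hom_zero g.hom_closed[of x] by simp_all
  have h': "h (x + y) = h x \<oplus>\<^bsub>S\<^esub> h y" "h (x * y) = h x \<otimes>\<^bsub>S\<^esub> h y"
    "h 1 = \<one>\<^bsub>S\<^esub>" "h 0 = \<zero>\<^bsub>S\<^esub>" "h x \<in> carrier S" for x y
    using h.hom_add[of x y] h.hom_mult[of x y] h.hom_one h.hom_zero h.hom_closed[of x] by simp_all
  have neg: "g (-1) = h (-1)"
  proof -
    have "g (-1) \<oplus>\<^bsub>S\<^esub> g 1 = \<zero>\<^bsub>S\<^esub>" "h (-1) \<oplus>\<^bsub>S\<^esub> h 1 = \<zero>\<^bsub>S\<^esub>"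
      using g'(1)[of "-1" 1] h'(1)[of "-1" 1] g'(4) h'(4) by simp_all
    then show ?thesis using g'(3,5) h'(3,5) S.minus_equality by metis
  qed
  have sgn: "g (signof \<pi>) = h (signof \<pi>)" for \<pi> :: "nat \<Rightarrow> nat"
    by (simp add: sign_def g' h' neg)
  have summand: "g (signof \<pi> * (\<Prod>i = 0..<n. A $$ (i, \<pi> i))) \<otimes>\<^bsub>S\<^esub> h (\<Prod>i<n. d i) =
      h (signof \<pi> * (\<Prod>i = 0..<n. B $$ (i, \<pi> i)))" if "\<pi> permutes {0..<n}" for \<pi>
  proof -
    have "g (\<Prod>i\<in>I. A $$ (i, \<pi> i)) \<otimes>\<^bsub>S\<^esub> h (\<Prod>i\<in>I. d i) = h (\<Prod>i\<in>I. B $$ (i, \<pi> i))"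
      if "finite I" "I \<subseteq> {0..<n}" for I
      using that
    proof (induction I rule: finite_induct)
      case (insert i I)
      have "\<pi> i < n" using permutes_in_image[OF \<open>\<pi> permutes _\<close>, of i] insert by simp
      then have e: "g (A $$ (i, \<pi> i)) \<otimes>\<^bsub>S\<^esub> h (d i) = h (B $$ (i, \<pi> i))" using eq insert by simp
      have "g (\<Prod>i\<in>insert i I. A $$ (i, \<pi> i)) \<otimes>\<^bsub>S\<^esub> h (\<Prod>i\<in>insert i I. d i) =
         (g (A $$ (i, \<pi> i)) \<otimes>\<^bsub>S\<^esub> h (d i)) \<otimes>\<^bsub>S\<^esub> (g (\<Prod>i\<in>I. A $$ (i, \<pi> i)) \<otimes>\<^bsub>S\<^esub> h (\<Prod>i\<in>I. d i))"
        using insert by (simp add: g' h' S.m_ac)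
      then show ?case using insert e by (simp add: h')
    qed (simp add: g' h')
    from this[of "{0..<n}"] show ?thesis
      by (simp add: g' h' sgn S.m_assoc flip: lessThan_atLeast0)
  qed
  have "g (\<Sum>\<pi>\<in>P. signof \<pi> * (\<Prod>i = 0..<n. A $$ (i, \<pi> i))) \<otimes>\<^bsub>S\<^esub> h (\<Prod>i<n. d i) =
      h (\<Sum>\<pi>\<in>P. signof \<pi> * (\<Prod>i = 0..<n. B $$ (i, \<pi> i)))"
    if "finite P" "P \<subseteq> {\<pi>. \<pi> permutes {0..<n}}" for P
    using that
  proof (induction P rule: finite_induct)
    case (insert \<pi> P)
    then show ?case
      using summand[of \<pi>] by (simp add: g'(1,5) h'(1,5) S.l_distr)
  qed (simp add: g' h')
  from this[of "{\<pi>. \<pi> permutes {0..<n}}"] show ?thesis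
    using A B by (simp add: det_def' finite_permutations)
qed

lemma hom_det_cong:
  fixes A B :: "'a::comm_ring_1 mat"
  assumes "cring S" and h: "h \<in> Ring.ring_hom ring_of_type_algebra S"
    and A: "A \<in> carrier_mat n n" and B: "B \<in> carrier_mat n n"
    and eq: "\<And>i j. i < n \<Longrightarrow> j < n \<Longrightarrow> h (A $$ (i, j)) = h (B $$ (i, j))"
  shows "h (det A) = h (det B)"
proof -
  interpret S: cring S by fact
  have 1: "h x \<in> carrier S" "h 1 = \<one>\<^bsub>S\<^esub>" for x
    using ring_hom_closed[OF h, of x] ring_hom_one[OF h] by simp_all
  show ?thesis
    using hom_det_scaled[OF assms(1) h h A B, of "\<lambda>i. 1"] eq 1 by simp
qed

section \<open>Elements of index sets\<close>

lemma elt_image: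
  assumes "c ` {1..k} = \<alpha>" and mono: "strict_mono_on {1..k} c" and i: "i \<in> {1..k}"
  shows "elt \<alpha> i = (c i :: nat)"
proof -
  let ?l = "map c [1..<Suc k]"
  have sets: "set ?l = \<alpha>" using assms(1) by (auto simp: atLeastLessThanSuc_atLeastAtMost)
  have "sorted_wrt (<) ?l"
    using mono by (auto simp: sorted_wrt_map sorted_wrt_iff_nth_less strict_mono_on_def simp del: upt_Suc)
  then have "sorted_list_of_set \<alpha> = ?l"
    using sets by (metis sorted_list_of_set.idem_if_sorted_distinct strict_sorted_iff)
  then show ?thesis using i by (auto simp: elt_def simp del: upt_Suc)
qed

lemma ksubsets_finite: "\<alpha> \<in> ksubsets k n \<Longrightarrow> finite \<alpha>"
  by (auto simp: ksubsets_def intro: finite_subset)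

lemma elt_less:
  assumes "\<alpha> \<in> ksubsets k n" "1 \<le> i" "i < j" "j \<le> k"
  shows "elt \<alpha> i < elt \<alpha> j"
proof -
  have "length (sorted_list_of_set \<alpha>) = k" using assms(1) by (simp add: ksubsets_def)
  moreover have "sorted_wrt (<) (sorted_list_of_set \<alpha>)" by simp
  ultimately show ?thesis
    using assms(2-4) sorted_wrt_nth_less[of "(<)" "sorted_list_of_set \<alpha>" "i - 1" "j - 1"]
    by (auto simp: elt_def)
qed

lemma elt_bij: "\<alpha> \<in> ksubsets k n \<Longrightarrow> bij_betw (elt \<alpha>) {1..k} \<alpha>"
proof (rule bij_betw_imageI)
  assume a: "\<alpha> \<in> ksubsets k n"
  show "inj_on (elt \<alpha>) {1..k}"
    by (rule linorder_inj_onI) (use elt_less[OF a] in fastforce)+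
  have len: "length (sorted_list_of_set \<alpha>) = k" using a by (simp add: ksubsets_def)
  have "elt \<alpha> ` {1..k} = (\<lambda>i. sorted_list_of_set \<alpha> ! i) ` {..<k}"
    unfolding image_Suc_lessThan[symmetric] image_image by (simp add: elt_def)
  also have "\<dots> = \<alpha>"
    using nth_image[of k "sorted_list_of_set \<alpha>"] len ksubsets_finite[OF a] by (simp add: lessThan_atLeast0)
  finally show "elt \<alpha> ` {1..k} = \<alpha>" .
qed

lemma elt_in: "\<alpha> \<in> ksubsets k n \<Longrightarrow> i \<in> {1..k} \<Longrightarrow> elt \<alpha> i \<in> \<alpha>"
  using elt_bij bij_betwE by blast

lemma elt_range: "\<alpha> \<in> ksubsets k n \<Longrightarrow> i \<in> {1..k} \<Longrightarrow> elt \<alpha> i \<in> {1..n}"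
  using elt_in[of \<alpha> k n i] by (auto simp: ksubsets_def)

text \<open>If at least \<open>i\<close> elements of \<open>\<alpha>\<close> are at most \<open>x\<close>, so is the \<open>i\<close>-th smallest one; \<open>elt_lower\<close> is the
  dual. All comparisons with the interval \<open>[\<beta>, \<gamma>]\<close> are made by these two counting lemmas.\<close>

lemma elt_upper:
  assumes "\<alpha> \<in> ksubsets k n" "A \<subseteq> \<alpha>" "i \<le> card A" "i \<in> {1..k}" "\<And>a. a \<in> A \<Longrightarrow> a \<le> x"
  shows "elt \<alpha> i \<le> x"
proof (rule ccontr)
  assume "\<not> elt \<alpha> i \<le> x"
  then have x: "x < elt \<alpha> i" by simp
  have "A \<subseteq> elt \<alpha> ` {1..<i}"
  proof
    fix a assume a: "a \<in> A"
    then obtain j where j: "j \<in> {1..k}" "a = elt \<alpha> j"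
      using assms(2) elt_bij[OF assms(1)] unfolding bij_betw_def by blast
    have "j < i"
    proof (rule ccontr)
      assume "\<not> j < i"
      then have "elt \<alpha> i \<le> elt \<alpha> j"
        using elt_less[OF assms(1), of i j] assms(4) j by (cases "i = j") auto
      then show False using assms(5)[OF a] x j by simp
    qed
    then show "a \<in> elt \<alpha> ` {1..<i}" using j by auto
  qed
  then have "card A \<le> card (elt \<alpha> ` {1..<i})" by (intro card_mono) auto
  also have "\<dots> \<le> card {1..<i}" by (rule card_image_le) simp
  finally show False
    using assms(3,4) unfolding card_atLeastLessThan card_greaterThanAtMost atLeastAtMost_iff by linarith
qed

lemma elt_lower:
  assumes "\<alpha> \<in> ksubsets k n" "A \<subseteq> \<alpha>" "k + 1 \<le> card A + i" "i \<in> {1..k}" "\<And>a. a \<in> A \<Longrightarrow> x \<le> a"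
  shows "x \<le> elt \<alpha> i"
proof (rule ccontr)
  assume "\<not> x \<le> elt \<alpha> i"
  then have x: "elt \<alpha> i < x" by simp
  have "A \<subseteq> elt \<alpha> ` {i<..k}"
  proof
    fix a assume a: "a \<in> A"
    then obtain j where j: "j \<in> {1..k}" "a = elt \<alpha> j"
      using assms(2) elt_bij[OF assms(1)] unfolding bij_betw_def by blast
    have "i < j"
    proof (rule ccontr)
      assume "\<not> i < j"
      then have "elt \<alpha> j \<le> elt \<alpha> i"
        using elt_less[OF assms(1), of j i] assms(4) j by (cases "i = j") auto
      then show False using assms(5)[OF a] x j by simp
    qed
    then show "a \<in> elt \<alpha> ` {i<..k}" using j by auto
  qed
  then have "card A \<le> card (elt \<alpha> ` {i<..k})" by (intro card_mono) auto
  also have "\<dots> \<le> card {i<..k}" by (rule card_image_le) simp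
  finally show False
    using assms(3,4) unfolding card_atLeastLessThan card_greaterThanAtMost atLeastAtMost_iff by linarith
qed

section \<open>Minors\<close>

text \<open>The minor on the first \<open>k\<close> rows and the columns \<open>c 1, \<dots>, c k\<close> in this order; the sequence of
  columns need not be increasing and may have repetitions.\<close>

definition colminor :: "nat \<Rightarrow> (nat \<Rightarrow> nat \<Rightarrow> 'r::comm_ring_1) \<Rightarrow> (nat \<Rightarrow> nat) \<Rightarrow> 'r" where
  "colminor k M c = det (mat k k (\<lambda>(i, j). M (i + 1) (c (j + 1))))"

lemma maximal_minor_colminor: "maximal_minor k M \<alpha> = colminor k M (elt \<alpha>)"
  by (simp add: maximal_minor_def colminor_def)

lemma colminor_cong:
  assumes "\<And>i j. i \<in> {1..k} \<Longrightarrow> j \<in> {1..k} \<Longrightarrow> M i (c j) = M' i (c' j)"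
  shows "colminor k M c = colminor k M' c'"
  unfolding colminor_def by (rule arg_cong[where f = det], rule eq_matI) (use assms in auto)

lemma poly_subst_colminor: "poly_subst f (colminor k M c) = colminor k (\<lambda>i j. poly_subst f (M i j)) c"
proof -
  interpret comm_ring_hom "poly_subst f" by (rule poly_subst_comm_ring_hom)
  show ?thesis
    unfolding colminor_def hom_det[symmetric]
    by (rule arg_cong[where f = det], rule eq_matI) auto
qed

lemma poly_subst_minor: "poly_subst f (maximal_minor k M \<alpha>) = maximal_minor k (\<lambda>i j. poly_subst f (M i j)) \<alpha>"
  by (simp add: maximal_minor_colminor poly_subst_colminor)

lemma polys_colminor:
  assumes "\<And>i j. i \<in> {1..k} \<Longrightarrow> j \<in> {1..k} \<Longrightarrow> M i (c j) \<in> polys V"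
  shows "colminor k M c \<in> polys V"
  unfolding colminor_def by (rule polys_det[of k]) (use assms in auto)

lemma colminor_permute:
  assumes "\<pi> permutes {0..<k}"
  shows "colminor k M (\<lambda>j. c (\<pi> (j - 1) + 1)) = signof \<pi> * colminor k M c"
proof -
  let ?A = "mat k k (\<lambda>(i, j). M (i + 1) (c (j + 1)))"
  have lt: "\<pi> i < k" if "i < k" for i
    using permutes_in_image[OF assms, of i] that by simp
  have "colminor k M (\<lambda>j. c (\<pi> (j - 1) + 1)) = det (transpose_mat (mat k k (\<lambda>(i, j). transpose_mat ?A $$ (\<pi> i, j))))"
    unfolding colminor_def by (rule arg_cong[where f = det], rule eq_matI) (use lt in auto)
  also have "\<dots> = det (mat k k (\<lambda>(i, j). transpose_mat ?A $$ (\<pi> i, j)))"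
    by (rule det_transpose[where n = k]) simp
  also have "\<dots> = signof \<pi> * det (transpose_mat ?A)"
    by (rule det_permute_rows[OF _ assms]) simp
  also have "det (transpose_mat ?A) = colminor k M c"
    unfolding colminor_def by (rule det_transpose[where n = k]) simp
  finally show ?thesis .
qed

lemma colminor_repeated:
  assumes "\<not> inj_on c {1..k}"
  shows "colminor k M c = 0"
proof -
  obtain a b where ab: "a \<in> {1..k}" "b \<in> {1..k}" "a \<noteq> b" "c a = c b"
    using assms by (auto simp: inj_on_def)
  have l: "a - 1 < k" "b - 1 < k" "a - 1 \<noteq> b - 1" "Suc (a - 1) = a" "Suc (b - 1) = b" using ab by auto
  show ?thesis
    unfolding colminor_def
    by (rule det_identical_columns[of _ k "a - 1" "b - 1"])
      (use ab l in \<open>auto intro!: eq_vecI\<close>)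
qed

text \<open>A minor, as a function of its \<open>i\<close>-th column, is a linear form whose coefficients are cofactors and
  do not depend on that column.\<close>

lemma colminor_linear:
  assumes "i \<in> {1..k}"
  obtains C where "\<And>j. colminor k M (c(i := j)) = (\<Sum>l<k. C l * M (l + 1) j)"
proof -
  let ?A = "\<lambda>j. mat k k (\<lambda>(a, b). M (a + 1) ((c(i := j)) (b + 1)))"
  have i: "i - 1 < k" "Suc (i - 1) = i" using assms by auto
  have del: "mat_delete (?A j) l (i - 1) = mat_delete (?A 0) l (i - 1)" for j l
    unfolding mat_delete_def by (rule eq_matI) (use i in auto)
  have "colminor k M (c(i := j)) = (\<Sum>l<k. cofactor (?A 0) l (i - 1) * M (l + 1) j)" for j
  proof -
    have "colminor k M (c(i := j)) = (\<Sum>l<k. ?A j $$ (l, i - 1) * cofactor (?A j) l (i - 1))"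
      unfolding colminor_def by (rule laplace_expansion_column) (use i in auto)
    also have "\<dots> = (\<Sum>l<k. cofactor (?A 0) l (i - 1) * M (l + 1) j)"
    proof (rule sum.cong[OF refl])
      fix l assume "l \<in> {..<k}"
      then have "?A j $$ (l, i - 1) = M (l + 1) j" using i by simp
      moreover have "cofactor (?A j) l (i - 1) = cofactor (?A 0) l (i - 1)"
        by (simp only: cofactor_def del[of j])
      ultimately show "?A j $$ (l, i - 1) * cofactor (?A j) l (i - 1) = cofactor (?A 0) l (i - 1) * M (l + 1) j"
        by (metis mult.commute)
    qed
    finally show ?thesis .
  qed
  then show ?thesis by (rule that)
qed

lemma colminor_mult:
  "colminor k (\<lambda>i j. \<Sum>l<k. C i l * M (l + 1) j) c =
    det (mat k k (\<lambda>(i, l). C (i + 1) l)) * colminor k M c"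
proof -
  have "colminor k (\<lambda>i j. \<Sum>l<k. C i l * M (l + 1) j) c =
      det (mat k k (\<lambda>(i, l). C (i + 1) l) * mat k k (\<lambda>(i, j). M (i + 1) (c (j + 1))))"
    unfolding colminor_def
    by (rule arg_cong[where f = det], rule eq_matI) (auto simp: scalar_prod_def lessThan_atLeast0)
  also have "\<dots> = det (mat k k (\<lambda>(i, l). C (i + 1) l)) * colminor k M c"
    unfolding colminor_def by (rule det_mult[where n = k]) auto
  finally show ?thesis .
qed

lemma det_zero_terms:
  assumes "A \<in> carrier_mat n n" "\<And>\<pi>. \<pi> permutes {0..<n} \<Longrightarrow> \<exists>i<n. A $$ (i, \<pi> i) = 0"
  shows "det A = 0"
proof -
  have "(\<Prod>i = 0..<n. A $$ (i, \<pi> i)) = 0" if "\<pi> permutes {0..<n}" for \<pi>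
    using assms(2)[OF that] by (intro prod_zero) auto
  then show ?thesis using assms(1) by (simp add: det_def')
qed

lemma det_diagonal_term:
  assumes "A \<in> carrier_mat n n"
    "\<And>\<pi>. \<pi> permutes {0..<n} \<Longrightarrow> (\<And>i. i < n \<Longrightarrow> A $$ (i, \<pi> i) \<noteq> 0) \<Longrightarrow> \<pi> = id"
  shows "det A = (\<Prod>i<n. A $$ (i, i))"
proof -
  have "(\<Prod>i = 0..<n. A $$ (i, \<pi> i)) = 0" if "\<pi> permutes {0..<n}" "\<pi> \<noteq> id" for \<pi>
    using assms(2)[OF that(1)] that(2) by (intro prod_zero) auto
  then have "det A = (\<Sum>\<pi>\<in>{id}. signof \<pi> * (\<Prod>i = 0..<n. A $$ (i, \<pi> i)))"
    using assms(1) by (simp only: det_def') (intro sum.mono_neutral_right, auto simp: finite_permutations permutes_id)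
  then show ?thesis by (simp add: lessThan_atLeast0)
qed

text \<open>A permutation preserving \<open>{i..}\<close>, where it does not increase, and \<open>{..<i}\<close>, where it does not
  decrease, is the identity: starting at \<open>i\<close>, its fixed points spread in both directions.\<close>

lemma permutes_fixed_outwards:
  fixes \<pi> :: "nat \<Rightarrow> nat"
  assumes p: "\<pi> permutes S"
    and up: "\<And>l. l \<in> S \<Longrightarrow> i \<le> l \<Longrightarrow> i \<le> \<pi> l \<and> \<pi> l \<le> l"
    and down: "\<And>l. l \<in> S \<Longrightarrow> l < i \<Longrightarrow> \<pi> l < i \<and> l \<le> \<pi> l"
  shows "\<pi> = id"
proof
  have inj: "a = b" if "\<pi> a = \<pi> b" for a b using permutes_inj[OF p] that by (auto dest: injD)
  have 1: "\<pi> l = l" if "l \<in> S" "i \<le> l" for l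
    using that
  proof (induction l rule: less_induct)
    case (less l)
    show ?case
    proof (rule ccontr)
      assume "\<pi> l \<noteq> l"
      then have "\<pi> l < l" "i \<le> \<pi> l" "\<pi> l \<in> S"
        using up[OF less.prems] permutes_in_image[OF p] less.prems by auto
      then have "\<pi> (\<pi> l) = \<pi> l" using less.IH by blast
      then show False using inj \<open>\<pi> l \<noteq> l\<close> by blast
    qed
  qed
  have 2: "\<pi> l = l" if "l \<in> S" "l < i" for l
    using that
  proof (induction "i - l" arbitrary: l rule: less_induct)
    case less
    show ?case
    proof (rule ccontr)
      assume "\<pi> l \<noteq> l"
      then have "l < \<pi> l" "\<pi> l < i" "\<pi> l \<in> S"
        using down[OF less.prems] permutes_in_image[OF p] less.prems by auto
      then have "\<pi> (\<pi> l) = \<pi> l" using less.hyps[of "\<pi> l"] by auto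
      then show False using inj \<open>\<pi> l \<noteq> l\<close> by blast
    qed
  qed
  show "\<pi> l = id l" for l
    using 1[of l] 2[of l] permutes_not_in[OF p, of l] by (cases "l \<in> S"; cases "i \<le> l") auto
qed

text \<open>The Pluecker coordinate of an arbitrary sequence of columns: alternating in the columns, zero if a
  column is repeated, and a signed variable otherwise. The permutation whose sign is taken sorts the
  sequence; it is unique.\<close>

definition bracket :: "nat \<Rightarrow> (nat \<Rightarrow> nat) \<Rightarrow> (nat set, 'k::comm_ring_1) mpoly" where
  "bracket k c = (if inj_on c {1..k} then
     signof (SOME \<pi>. \<pi> permutes {0..<k} \<and> (\<forall>j<k. c (j + 1) = elt (c ` {1..k}) (\<pi> j + 1))) *
     Var (c ` {1..k}) else 0)"

lemma image_ksubset:
  assumes "inj_on c {1..k}" "\<And>j. j \<in> {1..k} \<Longrightarrow> c j \<in> {1..n}"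
  shows "c ` {1..k} \<in> ksubsets k n"
  using assms by (auto simp: ksubsets_def card_image)

lemma bracket_perm:
  assumes inj: "inj_on c {1..k}" and r: "\<And>j. j \<in> {1..k} \<Longrightarrow> c j \<in> {1..n}"
  obtains \<pi> where "\<pi> permutes {0..<k}" "\<And>j. j < k \<Longrightarrow> c (j + 1) = elt (c ` {1..k}) (\<pi> j + 1)"
    "bracket k c = signof \<pi> * Var (c ` {1..k})"
proof -
  let ?\<alpha> = "c ` {1..k}"
  let ?P = "\<lambda>\<pi>. \<pi> permutes {0..<k} \<and> (\<forall>j<k. c (j + 1) = elt ?\<alpha> (\<pi> j + 1))"
  note a = image_ksubset[OF assms]
  have bij: "bij_betw (elt ?\<alpha>) {1..k} ?\<alpha>" by (rule elt_bij[OF a])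
  define q where "q j = (if j < k then inv_into {1..k} (elt ?\<alpha>) (c (j + 1)) - 1 else j)" for j
  have inv: "inv_into {1..k} (elt ?\<alpha>) (c (j + 1)) \<in> {1..k}" "elt ?\<alpha> (inv_into {1..k} (elt ?\<alpha>) (c (j + 1))) = c (j + 1)"
    if "j < k" for j
  proof -
    have "c (j + 1) \<in> elt ?\<alpha> ` {1..k}" using bij that by (auto simp: bij_betw_def)
    then show "inv_into {1..k} (elt ?\<alpha>) (c (j + 1)) \<in> {1..k}"
      "elt ?\<alpha> (inv_into {1..k} (elt ?\<alpha>) (c (j + 1))) = c (j + 1)"
      by (rule inv_into_into, rule f_inv_into_f)
  qed
  have eq: "c (j + 1) = elt ?\<alpha> (q j + 1)" and lt: "q j < k" if "j < k" for j
    using inv[OF that] that by (auto simp: q_def)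
  have "inj_on q {0..<k}"
  proof (rule inj_onI)
    fix x y assume xy: "x \<in> {0..<k}" "y \<in> {0..<k}" "q x = q y"
    then have "c (x + 1) = c (y + 1)" using eq[of x] eq[of y] by simp
    then show "x = y" using inj xy by (auto dest!: inj_onD)
  qed
  then have "bij_betw q {0..<k} {0..<k}"
    using lt by (intro bij_betw_imageI endo_inj_surj) auto
  then have "q permutes {0..<k}" by (rule bij_imp_permutes) (simp add: q_def)
  then have "\<exists>\<pi>. ?P \<pi>" using eq by blast
  then have P: "?P (SOME \<pi>. ?P \<pi>)" by (rule someI_ex)
  define \<sigma> where "\<sigma> = (SOME \<pi>. ?P \<pi>)"
  have P: "?P \<sigma>" using P unfolding \<sigma>_def .
  have "bracket k c = signof \<sigma> * Var (c ` {1..k})"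
    unfolding bracket_def \<sigma>_def using inj by (simp only: if_True)
  then show ?thesis using that[of \<sigma>] P by blast
qed

lemma bracket_polys:
  assumes "\<And>j. j \<in> {1..k} \<Longrightarrow> c j \<in> {1..n}"
  shows "bracket k c \<in> polys (ksubsets k n)"
proof (cases "inj_on c {1..k}")
  case True
  then have "Var (c ` {1..k}) \<in> polys (ksubsets k n)"
    using image_ksubset[OF True assms] by blast
  then show ?thesis using True by (auto simp: bracket_def sign_def)
qed (simp add: bracket_def)

lemma bracket_minor:
  assumes "\<And>j. j \<in> {1..k} \<Longrightarrow> c j \<in> {1..n}"
  shows "poly_subst (maximal_minor k M) (bracket k c) = colminor k M c"
proof (cases "inj_on c {1..k}")
  case True
  obtain \<pi> where p: "\<pi> permutes {0..<k}" "\<And>j. j < k \<Longrightarrow> c (j + 1) = elt (c ` {1..k}) (\<pi> j + 1)"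
    and b: "bracket k c = (signof \<pi> * Var (c ` {1..k}) :: (nat set, 'b) mpoly)"
    using bracket_perm[OF True assms] by metis
  have "colminor k M c = colminor k M (\<lambda>j. elt (c ` {1..k}) (\<pi> (j - 1) + 1))"
  proof (rule colminor_cong)
    fix i j assume "j \<in> {1..k}"
    then show "M i (c j) = M i (elt (c ` {1..k}) (\<pi> (j - 1) + 1))" using p(2)[of "j - 1"] by auto
  qed
  also have "\<dots> = signof \<pi> * maximal_minor k M (c ` {1..k})"
    unfolding maximal_minor_colminor by (rule colminor_permute[OF p(1)])
  finally show ?thesis by (simp add: b sign_def)
qed (simp add: bracket_def colminor_repeated)

lemma bracket_increasing:
  assumes mono: "strict_mono_on {1..k} c" and r: "\<And>j. j \<in> {1..k} \<Longrightarrow> c j \<in> {1..n}"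
  shows "bracket k c = Var (c ` {1..k})"
proof -
  have inj: "inj_on c {1..k}" using mono by (rule strict_mono_on_imp_inj_on)
  obtain \<pi> where p: "\<pi> permutes {0..<k}" "\<And>j. j < k \<Longrightarrow> c (j + 1) = elt (c ` {1..k}) (\<pi> j + 1)"
    and b: "bracket k c = (signof \<pi> * Var (c ` {1..k}) :: (nat set, 'a) mpoly)"
    using bracket_perm[OF inj r] by metis
  have "\<pi> j = j" for j
  proof (cases "j < k")
    case True
    then have "\<pi> j < k" using permutes_in_image[OF p(1), of j] by simp
    then have "c (j + 1) = c (\<pi> j + 1)"
      using p(2)[OF True] elt_image[OF refl mono, of "\<pi> j + 1"] by simp
    then show ?thesis using inj True \<open>\<pi> j < k\<close> by (auto dest!: inj_onD)
  qed (use permutes_not_in[OF p(1)] in auto)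
  then have "\<pi> = id" by auto
  then show ?thesis by (simp add: b)
qed

section \<open>The staircase matrices of a Bruhat interval\<close>

lemma elt_le:
  assumes "\<alpha> \<in> ksubsets k n" "1 \<le> i" "i \<le> j" "j \<le> k"
  shows "elt \<alpha> i \<le> elt \<alpha> j"
  using elt_less[OF assms(1), of i j] assms by (cases "i = j") auto

text \<open>The end points of a nonempty Bruhat interval.\<close>

locale bruhat_pair =
  fixes k n :: nat and \<beta> \<gamma> :: "nat set"
  assumes k_pos: "1 \<le> k" and \<beta>: "\<beta> \<in> ksubsets k n" and \<gamma>: "\<gamma> \<in> ksubsets k n" and \<beta>\<gamma>: "bruhat_le k \<beta> \<gamma>"
begin

lemma elt_\<beta>\<gamma>: "i \<in> {1..k} \<Longrightarrow> elt \<beta> i \<le> elt \<gamma> i"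
  using \<beta>\<gamma> by (simp add: bruhat_le_def)

text \<open>The column sequence \<open>\<beta>(1), \<dots>, \<beta>(i-1), j, \<gamma>(i+1), \<dots>, \<gamma>(k)\<close>.\<close>

definition seq :: "nat \<Rightarrow> nat \<Rightarrow> nat \<Rightarrow> nat" where
  "seq i j l = (if l < i then elt \<beta> l else if l = i then j else elt \<gamma> l)"

lemma seq_upd: "seq i j = (seq i 0)(i := j)"
  by (auto simp: seq_def)

lemma seq_range:
  "j \<in> {1..n} \<Longrightarrow> l \<in> {1..k} \<Longrightarrow> seq i j l \<in> {1..n}"
  using elt_range[OF \<beta>, of l] elt_range[OF \<gamma>, of l] by (auto simp: seq_def)

lemma seq_mono:
  assumes "i \<in> {1..k}" "elt \<beta> i \<le> j" "j \<le> elt \<gamma> i"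
  shows "strict_mono_on {1..k} (seq i j)"
proof (rule strict_mono_onI)
  fix l m assume lm: "l \<in> {1..k}" "m \<in> {1..k}" "l < m"
  then have "elt \<beta> l < elt \<beta> m" "elt \<gamma> l < elt \<gamma> m" "elt \<beta> l \<le> elt \<gamma> l" "elt \<beta> m \<le> elt \<gamma> m"
    using elt_less[OF \<beta>] elt_less[OF \<gamma>] elt_\<beta>\<gamma> by auto
  then show "seq i j l < seq i j m" using assms lm by (auto simp: seq_def)
qed

text \<open>If \<open>j < \<beta>(i)\<close>, the first \<open>i\<close> columns of the sequence are smaller than \<open>\<beta>(i)\<close>; if \<open>j > \<gamma>(i)\<close>,
  the last \<open>k - i + 1\<close> are larger than \<open>\<gamma>(i)\<close>. Either way the column set leaves the interval.\<close>

lemma seq_interval: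
  assumes i: "i \<in> {1..k}" and inj: "inj_on (seq i j) {1..k}"
    and "seq i j ` {1..k} \<in> bruhat_interval k n \<beta> \<gamma>"
  shows "elt \<beta> i \<le> j \<and> j \<le> elt \<gamma> i"
proof -
  let ?\<alpha> = "seq i j ` {1..k}"
  have a: "?\<alpha> \<in> ksubsets k n" "elt \<beta> i \<le> elt ?\<alpha> i" "elt ?\<alpha> i \<le> elt \<gamma> i"
    using assms(3) i by (auto simp: bruhat_interval_def bruhat_le_def)
  have "elt \<beta> i \<le> j"
  proof (rule ccontr)
    assume j: "\<not> elt \<beta> i \<le> j"
    have "elt ?\<alpha> i \<le> elt \<beta> i - 1"
    proof (rule elt_upper[OF a(1), where A = "seq i j ` {1..i}"])
      show "i \<le> card (seq i j ` {1..i})"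
        using i by (subst card_image) (auto intro: inj_on_subset[OF inj])
      fix x assume "x \<in> seq i j ` {1..i}"
      then obtain l where l: "l \<in> {1..i}" "x = seq i j l" by blast
      then show "x \<le> elt \<beta> i - 1"
        using j i elt_less[OF \<beta>, of l i] by (cases "l = i") (auto simp: seq_def)
    qed (use i in auto)
    then show False using a(2) j by linarith
  qed
  moreover have "j \<le> elt \<gamma> i"
  proof (rule ccontr)
    assume j: "\<not> j \<le> elt \<gamma> i"
    have "elt \<gamma> i + 1 \<le> elt ?\<alpha> i"
    proof (rule elt_lower[OF a(1), where A = "seq i j ` {i..k}"])
      have "card (seq i j ` {i..k}) = card {i..k}"
        using i by (intro card_image) (auto intro: inj_on_subset[OF inj])
      then show "k + 1 \<le> card (seq i j ` {i..k}) + i" using i by simp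
      fix x assume "x \<in> seq i j ` {i..k}"
      then obtain l where l: "l \<in> {i..k}" "x = seq i j l" by blast
      then show "elt \<gamma> i + 1 \<le> x"
        using j i elt_less[OF \<gamma>, of i l] by (cases "l = i") (auto simp: seq_def)
    qed (use i in auto)
    then show False using a(3) by linarith
  qed
  ultimately show ?thesis ..
qed

lemma seq_image_\<gamma>:
  assumes "i \<in> {1..k}" shows "seq i (elt \<gamma> i) ` {1..k} = delta_set k \<beta> \<gamma> (i - 1)"
proof -
  have "{1..k} = {1..i - 1} \<union> {i - 1 + 1..k}" using assms by auto
  moreover have "seq i (elt \<gamma> i) ` {1..i - 1} = elt \<beta> ` {1..i - 1}"
    by (rule image_cong) (auto simp: seq_def)
  moreover have "seq i (elt \<gamma> i) ` {i - 1 + 1..k} = elt \<gamma> ` {i - 1 + 1..k}"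
    using assms by (intro image_cong) (auto simp: seq_def)
  ultimately show ?thesis unfolding delta_set_def by (metis image_Un)
qed

lemma seq_image_\<beta>:
  assumes "i \<in> {1..k}" shows "seq i (elt \<beta> i) ` {1..k} = delta_set k \<beta> \<gamma> i"
proof -
  have "{1..k} = {1..i} \<union> {i + 1..k}" using assms by auto
  moreover have "seq i (elt \<beta> i) ` {1..i} = elt \<beta> ` {1..i}"
    by (rule image_cong) (auto simp: seq_def)
  moreover have "seq i (elt \<beta> i) ` {i + 1..k} = elt \<gamma> ` {i + 1..k}"
    by (intro image_cong) (auto simp: seq_def)
  ultimately show ?thesis unfolding delta_set_def by (metis image_Un)
qed

lemma delta_ksubset:
  assumes "t \<le> k"
  shows "delta_set k \<beta> \<gamma> t \<in> ksubsets k n"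
proof (cases "t = 0")
  case True
  have "seq 1 (elt \<gamma> 1) ` {1..k} \<in> ksubsets k n"
    using k_pos elt_\<beta>\<gamma>[of 1] elt_range[OF \<gamma>, of 1]
    by (intro image_ksubset strict_mono_on_imp_inj_on[OF seq_mono] seq_range) auto
  then show ?thesis using seq_image_\<gamma>[of 1] k_pos True by simp
next
  case False
  have "seq t (elt \<beta> t) ` {1..k} \<in> ksubsets k n"
    using assms False elt_\<beta>\<gamma>[of t] elt_range[OF \<beta>, of t]
    by (intro image_ksubset strict_mono_on_imp_inj_on[OF seq_mono] seq_range) auto
  then show ?thesis using seq_image_\<beta>[of t] assms False by simp
qed

text \<open>The numerator of the \<open>(i, j)\<close> entry of the matrix that the inverse map recovers from the Pluecker
  coordinates; the denominator is the pivot of row \<open>i\<close>.\<close>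

definition entry :: "nat \<Rightarrow> nat \<Rightarrow> (nat set, 'k::comm_ring_1) mpoly" where
  "entry i j = bracket k (seq i j)"

text \<open>The Pluecker coordinate of \<open>\<delta>\<close> at the index \<open>i - 1\<close>.\<close>

definition pivot :: "nat \<Rightarrow> (nat set, 'k::comm_ring_1) mpoly" where
  "pivot i = Var (delta_set k \<beta> \<gamma> (i - 1))"

lemma entry_polys: "j \<in> {1..n} \<Longrightarrow> entry i j \<in> polys (ksubsets k n)"
  unfolding entry_def by (rule bracket_polys) (rule seq_range)

lemma entry_Var:
  assumes "i \<in> {1..k}" "elt \<beta> i \<le> j" "j \<le> elt \<gamma> i"
  shows "entry i j = Var (seq i j ` {1..k})"
proof -
  have "j \<in> {1..n}" using assms elt_range[OF \<beta>, of i] elt_range[OF \<gamma>, of i] by auto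
  then show ?thesis
    unfolding entry_def by (intro bracket_increasing[where n = n] seq_mono seq_range assms)
qed

lemma entry_\<gamma>: "i \<in> {1..k} \<Longrightarrow> entry i (elt \<gamma> i) = pivot i"
  by (subst entry_Var) (simp_all only: elt_\<beta>\<gamma> order_refl pivot_def seq_image_\<gamma>)

lemma entry_\<beta>: "i \<in> {1..k} \<Longrightarrow> entry i (elt \<beta> i) = Var (delta_set k \<beta> \<gamma> i)"
  by (subst entry_Var) (simp_all only: elt_\<beta>\<gamma> order_refl seq_image_\<beta>)

text \<open>On a generic matrix \<open>X\<close> the numerators form a matrix \<open>C * X\<close>, the rows of \<open>C\<close> being cofactors.
  Its minor on \<open>\<alpha>\<close> is therefore \<open>det C\<close> times that of \<open>X\<close>, with the same factor for every \<open>\<alpha>\<close>.\<close>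

lemma pluecker_relation:
  assumes \<alpha>: "\<alpha> \<in> ksubsets k n"
  shows "maximal_minor k entry \<alpha> * Var \<gamma> - maximal_minor k entry \<gamma> * Var \<alpha>
    \<in> (pluecker_ideal k n :: (nat set, 'k::field) mpoly set)"
proof -
  let ?M = "(\<lambda>i j. Var (i, j)) :: nat \<Rightarrow> nat \<Rightarrow> (nat \<times> nat, 'k) mpoly"
  let ?h = "poly_subst (maximal_minor k ?M)"
  have "\<exists>C. \<forall>j. colminor k ?M (seq i j) = (\<Sum>l<k. C l * ?M (l + 1) j)" if i: "i \<in> {1..k}" for i
  proof -
    obtain C where "\<And>j. colminor k ?M ((seq i 0)(i := j)) = (\<Sum>l<k. C l * ?M (l + 1) j)"
      using colminor_linear[OF i] by blast
    then show ?thesis unfolding seq_upd[symmetric] by blast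
  qed
  then have "\<forall>i\<in>{1..k}. \<exists>C. \<forall>j. colminor k ?M (seq i j) = (\<Sum>l<k. C l * ?M (l + 1) j)" by blast
  from bchoice[OF this] obtain C
    where "\<forall>i\<in>{1..k}. \<forall>j. colminor k ?M (seq i j) = (\<Sum>l<k. C i l * ?M (l + 1) j)" by blast
  then have C: "colminor k ?M (seq i j) = (\<Sum>l<k. C i l * ?M (l + 1) j)" if "i \<in> {1..k}" for i j
    using that by blast
  have minor: "?h (maximal_minor k entry \<alpha>) = det (mat k k (\<lambda>(i, l). C (i + 1) l)) * maximal_minor k ?M \<alpha>"
    if "\<alpha> \<in> ksubsets k n" for \<alpha>
  proof -
    have "?h (maximal_minor k entry \<alpha>) = colminor k (\<lambda>i j. ?h (entry i j)) (elt \<alpha>)"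
      by (simp add: maximal_minor_colminor poly_subst_colminor)
    also have "\<dots> = colminor k (\<lambda>i j. \<Sum>l<k. C i l * ?M (l + 1) j) (elt \<alpha>)"
    proof (rule colminor_cong)
      fix i j assume ij: "i \<in> {1..k}" "j \<in> {1..k}"
      then have "elt \<alpha> j \<in> {1..n}" using elt_range[OF that] by blast
      then show "?h (entry i (elt \<alpha> j)) = (\<Sum>l<k. C i l * ?M (l + 1) (elt \<alpha> j))"
        unfolding entry_def C[OF ij(1), symmetric] by (intro bracket_minor[where n = n] seq_range)
    qed
    finally show ?thesis by (simp only: colminor_mult[where M = ?M] maximal_minor_colminor)
  qed
  have closed: "maximal_minor k entry \<alpha> \<in> polys (ksubsets k n)" if "\<alpha> \<in> ksubsets k n" for \<alpha>
    unfolding maximal_minor_colminor using elt_range[OF that] entry_polys by (intro polys_colminor) blast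
  show ?thesis
    unfolding pluecker_ideal_def a_kernel_def' mem_Collect_eq
  proof
    show "maximal_minor k entry \<alpha> * Var \<gamma> - maximal_minor k entry \<gamma> * Var \<alpha> \<in> polys (ksubsets k n)"
      using closed \<alpha> \<gamma> by blast
    show "?h (maximal_minor k entry \<alpha> * Var \<gamma> - maximal_minor k entry \<gamma> * Var \<alpha>) =
        \<zero>\<^bsub>mpoly_ring ({1..k} \<times> {1..n})\<^esub>"
      using minor[OF \<alpha>] minor[OF \<gamma>] by simp
  qed
qed

lemma Y_nonzero:
  "Y_matrix \<beta> \<gamma> i j \<noteq> 0 \<Longrightarrow> i \<in> {1..k} \<Longrightarrow> elt \<beta> i \<le> j \<and> j \<le> elt \<gamma> i"
  using elt_\<beta>\<gamma>[of i] by (auto simp: Y_matrix_def split: if_splits)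

text \<open>A permutation contributing a nonzero term to the minor on \<open>\<alpha>\<close> matches each row \<open>i\<close> with an element of
  \<open>\<alpha>\<close> between \<open>\<beta>(i)\<close> and \<open>\<gamma>(i)\<close>; by counting, \<open>\<alpha>\<close> then lies in the interval.\<close>

lemma Y_minor_zero:
  assumes \<alpha>: "\<alpha> \<in> ksubsets k n" and out: "\<alpha> \<notin> bruhat_interval k n \<beta> \<gamma>"
  shows "maximal_minor k (Y_matrix \<beta> \<gamma>) \<alpha> = 0"
  unfolding maximal_minor_def
proof (rule det_zero_terms[of _ k], simp, rule ccontr)
  fix \<pi> assume p: "\<pi> permutes {0..<k}"
    and "\<not> (\<exists>i<k. mat k k (\<lambda>(i, j). Y_matrix \<beta> \<gamma> (i + 1) (elt \<alpha> (j + 1))) $$ (i, \<pi> i) = 0)"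
  moreover have lt: "\<pi> a < k" if "a < k" for a using permutes_in_image[OF p, of a] that by simp
  ultimately have nz: "elt \<beta> (a + 1) \<le> elt \<alpha> (\<pi> a + 1) \<and> elt \<alpha> (\<pi> a + 1) \<le> elt \<gamma> (a + 1)" if "a < k" for a
    using that by (intro Y_nonzero) auto
  have inj: "inj_on (\<lambda>a. elt \<alpha> (\<pi> a + 1)) {0..<k}"
  proof (rule inj_onI)
    fix x y assume xy: "x \<in> {0..<k}" "y \<in> {0..<k}" "elt \<alpha> (\<pi> x + 1) = elt \<alpha> (\<pi> y + 1)"
    then have "\<pi> x < k" "\<pi> y < k" using lt by auto
    with xy(3) have "\<pi> x = \<pi> y"
      using inj_onD[OF bij_betw_imp_inj_on[OF elt_bij[OF \<alpha>]], of "\<pi> x + 1" "\<pi> y + 1"] by auto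
    then show "x = y" using permutes_inj[OF p] by (auto dest: injD)
  qed
  have "elt \<alpha> i \<le> elt \<gamma> i" if i: "i \<in> {1..k}" for i
  proof (rule elt_upper[OF \<alpha>, where A = "(\<lambda>a. elt \<alpha> (\<pi> a + 1)) ` {0..<i}"])
    have "card ((\<lambda>a. elt \<alpha> (\<pi> a + 1)) ` {0..<i}) = card {0..<i}"
      using i by (intro card_image inj_on_subset[OF inj]) auto
    then show "i \<le> card ((\<lambda>a. elt \<alpha> (\<pi> a + 1)) ` {0..<i})" by simp
    show "(\<lambda>a. elt \<alpha> (\<pi> a + 1)) ` {0..<i} \<subseteq> \<alpha>"
      using i lt elt_in[OF \<alpha>] by (auto simp: Suc_le_eq)
    fix x assume "x \<in> (\<lambda>a. elt \<alpha> (\<pi> a + 1)) ` {0..<i}"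
    then obtain a where a: "a < i" "x = elt \<alpha> (\<pi> a + 1)" by auto
    then have "x \<le> elt \<gamma> (a + 1)" using nz[of a] i by auto
    also have "\<dots> \<le> elt \<gamma> i" using elt_le[OF \<gamma>] a i by auto
    finally show "x \<le> elt \<gamma> i" .
  qed (use i in auto)
  moreover have "elt \<beta> i \<le> elt \<alpha> i" if i: "i \<in> {1..k}" for i
  proof (rule elt_lower[OF \<alpha>, where A = "(\<lambda>a. elt \<alpha> (\<pi> a + 1)) ` {i - 1..<k}"])
    have "card ((\<lambda>a. elt \<alpha> (\<pi> a + 1)) ` {i - 1..<k}) = card {i - 1..<k}"
      by (intro card_image inj_on_subset[OF inj]) auto
    then show "k + 1 \<le> card ((\<lambda>a. elt \<alpha> (\<pi> a + 1)) ` {i - 1..<k}) + i" using i by auto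
    show "(\<lambda>a. elt \<alpha> (\<pi> a + 1)) ` {i - 1..<k} \<subseteq> \<alpha>"
      using i lt elt_in[OF \<alpha>] by (auto simp: Suc_le_eq)
    fix x assume "x \<in> (\<lambda>a. elt \<alpha> (\<pi> a + 1)) ` {i - 1..<k}"
    then obtain a where a: "i - 1 \<le> a" "a < k" "x = elt \<alpha> (\<pi> a + 1)" by auto
    have "elt \<beta> i \<le> elt \<beta> (a + 1)" using elt_le[OF \<beta>] a i by auto
    also have "\<dots> \<le> x" using nz[of a] a by auto
    finally show "elt \<beta> i \<le> x" .
  qed (use i in auto)
  ultimately show False using out \<alpha> by (auto simp: bruhat_interval_def bruhat_le_def)
qed

text \<open>On these columns, the rows and columns before the \<open>i\<close>-th form an upper triangular block, those after it
  form a lower triangular block, and row \<open>i\<close> is zero off the diagonal.\<close>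

lemma Y_minor_diagonal:
  assumes i: "i \<in> {1..k}"
  shows "colminor k (Y_matrix \<beta> \<gamma>) (seq i j) = (\<Prod>a<k. Y_matrix \<beta> \<gamma> (a + 1) (seq i j (a + 1)))"
proof -
  let ?A = "mat k k (\<lambda>(a, b). Y_matrix \<beta> \<gamma> (a + 1) (seq i j (b + 1)))"
  have "det ?A = (\<Prod>a<k. ?A $$ (a, a))"
  proof (rule det_diagonal_term)
    fix \<pi> assume p: "\<pi> permutes {0..<k}" and "\<And>a. a < k \<Longrightarrow> ?A $$ (a, \<pi> a) \<noteq> 0"
    moreover have lt: "\<pi> a < k" if "a < k" for a using permutes_in_image[OF p, of a] that by simp
    ultimately have nz: "elt \<beta> (a + 1) \<le> seq i j (\<pi> a + 1) \<and> seq i j (\<pi> a + 1) \<le> elt \<gamma> (a + 1)"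
      if "a < k" for a using that by (intro Y_nonzero) auto
    have inj: "a = b" if "\<pi> a = \<pi> b" for a b using permutes_inj[OF p] that by (auto dest: injD)
    have low: "a \<le> \<pi> a" if "a < k" "\<pi> a + 1 < i" for a
    proof (rule ccontr)
      assume "\<not> a \<le> \<pi> a"
      then have "elt \<beta> (\<pi> a + 1) < elt \<beta> (a + 1)" using elt_less[OF \<beta>, of "\<pi> a + 1" "a + 1"] that by simp
      then show False using nz[OF that(1)] that by (simp add: seq_def)
    qed
    have high: "\<pi> a \<le> a" if "a < k" "i < \<pi> a + 1" for a
    proof (rule ccontr)
      assume "\<not> \<pi> a \<le> a"
      then have "elt \<gamma> (a + 1) < elt \<gamma> (\<pi> a + 1)"
        using elt_less[OF \<gamma>, of "a + 1" "\<pi> a + 1"] that lt[OF that(1)] by simp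
      then show False using nz[OF that(1)] that by (simp add: seq_def)
    qed
    have i1: "i - 1 < k" using i by auto
    have mid: "\<pi> (i - 1) = i - 1"
    proof (cases "\<pi> (i - 1) + 1" i rule: linorder_cases)
      case less
      then show ?thesis using low[OF i1] by linarith
    next
      case greater
      then show ?thesis using high[OF i1] by linarith
    qed simp
    have mid': "a = i - 1" if "\<pi> a = i - 1" for a using inj[of a "i - 1"] mid that by simp
    show "\<pi> = id"
    proof (rule permutes_fixed_outwards[OF p, where i = "i - 1"])
      fix l assume l: "l \<in> {0..<k}" "i - 1 \<le> l"
      show "i - 1 \<le> \<pi> l \<and> \<pi> l \<le> l"
        using low[of l] high[of l] l i mid mid'[of l] by (cases "\<pi> l + 1" i rule: linorder_cases) auto
    next
      fix l assume l: "l \<in> {0..<k}" "l < i - 1"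
      show "\<pi> l < i - 1 \<and> l \<le> \<pi> l"
        using low[of l] high[of l] l i mid mid'[of l] by (cases "\<pi> l + 1" i rule: linorder_cases) auto
    qed
  qed simp
  then show ?thesis by (simp add: colminor_def)
qed

lemma Y_minor_entry:
  assumes i: "i \<in> {1..k}" and j: "elt \<beta> i \<le> j" "j \<le> elt \<gamma> i"
  shows "colminor k (Y_matrix \<beta> \<gamma>) (seq i j) =
    Y_matrix \<beta> \<gamma> i j * colminor k (Y_matrix \<beta> \<gamma>) (seq i (elt \<gamma> i))"
proof -
  have i': "i - 1 < k" "i - 1 + 1 = i" using i by auto
  have *: "(\<Prod>a<k. Y_matrix \<beta> \<gamma> (a + 1) (seq i j (a + 1))) =
    Y_matrix \<beta> \<gamma> i j * (\<Prod>a\<in>{..<k} - {i - 1}. Y_matrix \<beta> \<gamma> (a + 1) (seq i 0 (a + 1)))" for j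
  proof -
    have "(\<Prod>a<k. Y_matrix \<beta> \<gamma> (a + 1) (seq i j (a + 1))) = Y_matrix \<beta> \<gamma> (i - 1 + 1) (seq i j (i - 1 + 1)) *
        (\<Prod>a\<in>{..<k} - {i - 1}. Y_matrix \<beta> \<gamma> (a + 1) (seq i j (a + 1)))"
      using i' by (intro prod.remove) auto
    also have "(\<Prod>a\<in>{..<k} - {i - 1}. Y_matrix \<beta> \<gamma> (a + 1) (seq i j (a + 1))) =
        (\<Prod>a\<in>{..<k} - {i - 1}. Y_matrix \<beta> \<gamma> (a + 1) (seq i 0 (a + 1)))"
      by (rule prod.cong) (auto simp: seq_def)
    finally show ?thesis unfolding i'(2) by (simp add: seq_def)
  qed
  show ?thesis
    unfolding Y_minor_diagonal[OF i] *[of j] *[of "elt \<gamma> i"] by (simp add: Y_matrix_def)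
qed

lemma minor_seq:
  assumes "i \<in> {1..k}" "elt \<beta> i \<le> j" "j \<le> elt \<gamma> i"
  shows "maximal_minor k M (seq i j ` {1..k}) = colminor k M (seq i j)"
  unfolding maximal_minor_colminor
  by (rule colminor_cong) (simp only: elt_image[OF refl seq_mono[OF assms]])

text \<open>In the next three lemmas \<open>w\<close> stands for the map from polynomials in the Pluecker coordinates to the
  coordinate ring of \<open>W\<close>, of which only the defining relations matter.\<close>

lemma entry_vanishes:
  assumes "cring S" and w: "w \<in> Ring.ring_hom ring_of_type_algebra S"
    and out: "\<And>\<alpha>. \<alpha> \<in> ksubsets k n - bruhat_interval k n \<beta> \<gamma> \<Longrightarrow> w (Var \<alpha>) = \<zero>\<^bsub>S\<^esub>"
    and ij: "i \<in> {1..k}" "j \<in> {1..n}" "\<not> (elt \<beta> i \<le> j \<and> j \<le> elt \<gamma> i)"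
  shows "w (entry i j :: (nat set, 'k::field) mpoly) = \<zero>\<^bsub>S\<^esub>"
proof -
  interpret S: cring S by fact
  interpret T: cring "ring_of_type_algebra :: (nat set, 'k) mpoly ring" by (rule type_cring)
  interpret w: ring_hom_cring "ring_of_type_algebra :: (nat set, 'k) mpoly ring" S w using w by unfold_locales
  show ?thesis
  proof (cases "inj_on (seq i j) {1..k}")
    case True
    then have "seq i j ` {1..k} \<in> ksubsets k n"
      using seq_range[OF ij(2)] by (intro image_ksubset)
    then have z: "w (Var (seq i j ` {1..k})) = \<zero>\<^bsub>S\<^esub>"
      using seq_interval[OF ij(1) True] ij(3) by (intro out) blast
    obtain \<pi> where b: "entry i j = signof \<pi> * (Var (seq i j ` {1..k}) :: (nat set, 'k) mpoly)"
      unfolding entry_def using bracket_perm[where n = n, OF True seq_range[OF ij(2)]] by metis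
    show ?thesis
      unfolding b using w.hom_mult[of "signof \<pi>" "Var (seq i j ` {1..k})"] w.hom_closed[of "signof \<pi>"] z by simp
  next
    case False
    then show ?thesis using w.hom_zero by (simp add: entry_def bracket_def)
  qed
qed

text \<open>Where the coordinates outside the interval vanish, the matrix of the numerators, restricted to the
  columns \<open>\<gamma>\<close>, is lower triangular with the pivots on the diagonal. Together with \<open>pluecker_relation\<close> and
  \<open>\<Delta>\<^sub>\<gamma> = 1\<close> this evaluates all its maximal minors.\<close>

lemma entry_minor:
  assumes "cring S" and w: "w \<in> Ring.ring_hom ring_of_type_algebra S"
    and ker: "\<And>p. p \<in> (pluecker_ideal k n :: (nat set, 'k::field) mpoly set) \<Longrightarrow> w p = \<zero>\<^bsub>S\<^esub>"
    and out: "\<And>\<alpha>. \<alpha> \<in> ksubsets k n - bruhat_interval k n \<beta> \<gamma> \<Longrightarrow> w (Var \<alpha>) = \<zero>\<^bsub>S\<^esub>"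
    and one: "w (Var \<gamma>) = \<one>\<^bsub>S\<^esub>"
    and \<alpha>: "\<alpha> \<in> ksubsets k n"
  shows "w (maximal_minor k entry \<alpha>) = w (\<Prod>a<k. pivot (a + 1)) \<otimes>\<^bsub>S\<^esub> w (Var \<alpha>)"
proof -
  interpret S: cring S by fact
  interpret T: cring "ring_of_type_algebra :: (nat set, 'k) mpoly ring" by (rule type_cring)
  interpret w: ring_hom_cring "ring_of_type_algebra :: (nat set, 'k) mpoly ring" S w using w by unfold_locales
  have w': "w (x * y) = w x \<otimes>\<^bsub>S\<^esub> w y" "w (x + y) = w x \<oplus>\<^bsub>S\<^esub> w y" "w x \<in> carrier S" "w 0 = \<zero>\<^bsub>S\<^esub>" for x y
    using w.hom_mult[of x y] w.hom_add[of x y] w.hom_closed[of x] w.hom_zero by simp_all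
  let ?N = "maximal_minor k entry"
  have "w (?N \<alpha> * Var \<gamma>) = w ((?N \<alpha> * Var \<gamma> - ?N \<gamma> * Var \<alpha>) + ?N \<gamma> * Var \<alpha>)" by simp
  also have "\<dots> = w (?N \<gamma> * Var \<alpha>)"
    unfolding w'(2) ker[OF pluecker_relation[OF \<alpha>]] by (simp add: w'(3))
  finally have 1: "w (?N \<alpha>) = w (?N \<gamma>) \<otimes>\<^bsub>S\<^esub> w (Var \<alpha>)"
    using w'(3)[of "?N \<alpha>"] by (simp add: w'(1) one)
  \<comment> \<open>The matrix on the columns of \<open>\<gamma>\<close>, with the numerators that vanish under \<open>w\<close> replaced by zero.\<close>
  let ?B = "mat k k (\<lambda>(a, b). if elt \<beta> (a + 1) \<le> elt \<gamma> (b + 1) \<and> elt \<gamma> (b + 1) \<le> elt \<gamma> (a + 1)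
    then entry (a + 1) (elt \<gamma> (b + 1)) else 0) :: (nat set, 'k) mpoly mat"
  have "w (?N \<gamma>) = w (det ?B)"
    unfolding maximal_minor_def
  proof (rule hom_det_cong[OF S.is_cring w])
    fix a b assume ab: "a < k" "b < k"
    then have "elt \<gamma> (b + 1) \<in> {1..n}" by (intro elt_range[OF \<gamma>]) auto
    then have "w (entry (a + 1) (elt \<gamma> (b + 1))) = \<zero>\<^bsub>S\<^esub>"
      if "\<not> (elt \<beta> (a + 1) \<le> elt \<gamma> (b + 1) \<and> elt \<gamma> (b + 1) \<le> elt \<gamma> (a + 1))"
      using ab that by (intro entry_vanishes[OF S.is_cring w out]) auto
    then show "w (mat k k (\<lambda>(i, j). entry (i + 1) (elt \<gamma> (j + 1))) $$ (a, b)) = w (?B $$ (a, b))"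
      using ab by (auto simp: w'(4))
  qed auto
  also have "det ?B = (\<Prod>a<k. ?B $$ (a, a))"
  proof (rule det_diagonal_term)
    fix \<pi> assume p: "\<pi> permutes {0..<k}" and nz: "\<And>a. a < k \<Longrightarrow> ?B $$ (a, \<pi> a) \<noteq> 0"
    have lt: "\<pi> a < k" if "a < k" for a using permutes_in_image[OF p, of a] that by simp
    have "\<pi> a \<le> a" if "a < k" for a
    proof (rule ccontr)
      assume "\<not> \<pi> a \<le> a"
      then have "elt \<gamma> (a + 1) < elt \<gamma> (\<pi> a + 1)"
        using elt_less[OF \<gamma>, of "a + 1" "\<pi> a + 1"] lt[OF that] by simp
      then show False using nz[OF that] that lt[OF that] by simp
    qed
    then show "\<pi> = id" using permutes_fixed_outwards[OF p, of 0] by auto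
  qed simp
  also have "\<dots> = (\<Prod>a<k. pivot (a + 1))"
  proof (rule prod.cong[OF refl])
    fix a assume "a \<in> {..<k}"
    then have a: "a < k" "a + 1 \<in> {1..k}" by auto
    show "?B $$ (a, a) = pivot (a + 1)"
      using a(1) elt_\<beta>\<gamma>[OF a(2)] entry_\<gamma>[OF a(2)] by simp
  qed
  finally show ?thesis using 1 by simp
qed

text \<open>The heart of the argument: substituting \<open>entry i j / pivot i\<close> for the entries of the staircase matrix
  turns its minors into the Pluecker coordinates.\<close>

lemma minor_from_entries:
  assumes "cring S" and w: "w \<in> Ring.ring_hom ring_of_type_algebra S"
    and ker: "\<And>p. p \<in> (pluecker_ideal k n :: (nat set, 'k::field) mpoly set) \<Longrightarrow> w p = \<zero>\<^bsub>S\<^esub>"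
    and out: "\<And>\<alpha>. \<alpha> \<in> ksubsets k n - bruhat_interval k n \<beta> \<gamma> \<Longrightarrow> w (Var \<alpha>) = \<zero>\<^bsub>S\<^esub>"
    and one: "w (Var \<gamma>) = \<one>\<^bsub>S\<^esub>"
    and g: "g \<in> Ring.ring_hom ring_of_type_algebra S"
    and units: "\<And>i. i \<in> {1..k} \<Longrightarrow> w (pivot i) \<in> Units S"
    and entries: "\<And>i j. (i, j) \<in> Y_vars k \<beta> \<gamma> \<Longrightarrow>
      g (Var (i, j) :: (nat \<times> nat, 'k) mpoly) \<otimes>\<^bsub>S\<^esub> w (pivot i) = w (entry i j)"
    and \<alpha>: "\<alpha> \<in> ksubsets k n"
  shows "g (maximal_minor k (Y_matrix \<beta> \<gamma>) \<alpha>) = w (Var \<alpha>)"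
proof -
  interpret S: cring S by fact
  interpret T: cring "ring_of_type_algebra :: (nat set, 'k) mpoly ring" by (rule type_cring)
  interpret U: cring "ring_of_type_algebra :: (nat \<times> nat, 'k) mpoly ring" by (rule type_cring)
  interpret w: ring_hom_cring "ring_of_type_algebra :: (nat set, 'k) mpoly ring" S w using w by unfold_locales
  interpret g: ring_hom_cring "ring_of_type_algebra :: (nat \<times> nat, 'k) mpoly ring" S g using g by unfold_locales
  have w': "w (x * y) = w x \<otimes>\<^bsub>S\<^esub> w y" "w 1 = \<one>\<^bsub>S\<^esub>" "w x \<in> carrier S" for x y
    using w.hom_mult[of x y] w.hom_one w.hom_closed[of x] by simp_all
  have g': "g 1 = \<one>\<^bsub>S\<^esub>" "g 0 = \<zero>\<^bsub>S\<^esub>" "g x \<in> carrier S" for x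
    using g.hom_one g.hom_zero g.hom_closed[of x] by simp_all
  have row: "g (Y_matrix \<beta> \<gamma> i j) \<otimes>\<^bsub>S\<^esub> w (pivot i) = w (entry i j)" if i: "i \<in> {1..k}" and j: "j \<in> {1..n}" for i j
  proof (cases "elt \<beta> i \<le> j \<and> j \<le> elt \<gamma> i")
    case True
    show ?thesis
    proof (cases "j = elt \<gamma> i")
      case True
      then show ?thesis using i by (simp add: Y_matrix_def g' w' entry_\<gamma>)
    next
      case False
      then have "(i, j) \<in> Y_vars k \<beta> \<gamma>" using i True by (auto simp: Y_vars_def)
      then show ?thesis using entries[of i j] True False by (simp add: Y_matrix_def)
    qed
  next
    case False
    then have "Y_matrix \<beta> \<gamma> i j = (0 :: (nat \<times> nat, 'k) mpoly)" using elt_\<beta>\<gamma>[OF i] by (auto simp: Y_matrix_def)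
    moreover have "w (entry i j) = \<zero>\<^bsub>S\<^esub>" by (rule entry_vanishes[OF S.is_cring w out i j False])
    ultimately show ?thesis by (simp add: g' w')
  qed
  let ?D = "\<Prod>a<k. pivot (a + 1)"
  have "g (maximal_minor k (Y_matrix \<beta> \<gamma>) \<alpha>) \<otimes>\<^bsub>S\<^esub> w ?D = w (maximal_minor k entry \<alpha>)"
    unfolding maximal_minor_def
  proof (rule hom_det_scaled[OF S.is_cring g w])
    fix a b assume ab: "a < k" "b < k"
    then have "elt \<alpha> (b + 1) \<in> {1..n}" by (intro elt_range[OF \<alpha>]) auto
    then show "g (mat k k (\<lambda>(i, j). Y_matrix \<beta> \<gamma> (i + 1) (elt \<alpha> (j + 1))) $$ (a, b)) \<otimes>\<^bsub>S\<^esub> w (pivot (a + 1)) =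
        w (mat k k (\<lambda>(i, j). entry (i + 1) (elt \<alpha> (j + 1))) $$ (a, b))"
      using row[of "a + 1" "elt \<alpha> (b + 1)"] ab by simp
  qed auto
  also have "\<dots> = w ?D \<otimes>\<^bsub>S\<^esub> w (Var \<alpha>)" by (rule entry_minor[OF S.is_cring w ker out one \<alpha>])
  finally have eq: "w ?D \<otimes>\<^bsub>S\<^esub> g (maximal_minor k (Y_matrix \<beta> \<gamma>) \<alpha>) = w ?D \<otimes>\<^bsub>S\<^esub> w (Var \<alpha>)"
    using S.m_comm g' w' by simp
  have "w (\<Prod>a\<in>A. pivot (a + 1)) \<in> Units S" if "finite A" "A \<subseteq> {..<k}" for A
    using that by (induction A rule: finite_induct) (auto simp: w' units)
  then have "w ?D \<in> Units S" by simp
  then show ?thesis using eq S.Units_l_cancel g' w' by simp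
qed

end

section \<open>The coordinate rings\<close>

text \<open>All rings in sight are quotients or localizations. They are handled by two kinds of lemmas: those named
  \<open>universal\<close> define homomorphisms out of them, and those named \<open>hom_eqI\<close> say that a homomorphism is
  determined by its values on the classes of polynomials.\<close>

lemma hom_comp:
  assumes "h \<in> Ring.ring_hom R S" "g \<in> Ring.ring_hom S T"
  shows "(\<lambda>x. g (h x)) \<in> Ring.ring_hom R T"
  using ring_hom_trans[OF assms] by (simp add: comp_def)

lemma hom_Units:
  assumes "cring R" "cring S" "h \<in> Ring.ring_hom R S" "u \<in> Units R"
  shows "h u \<in> Units S"
proof -
  interpret R: cring R by fact
  interpret S: cring S by fact
  interpret ring_hom_cring R S h using assms(3) by unfold_locales
  have c: "u \<in> carrier R" "inv\<^bsub>R\<^esub> u \<in> carrier R" using assms(4) by auto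
  have "h u \<otimes>\<^bsub>S\<^esub> h (inv\<^bsub>R\<^esub> u) = \<one>\<^bsub>S\<^esub>" "h (inv\<^bsub>R\<^esub> u) \<otimes>\<^bsub>S\<^esub> h u = \<one>\<^bsub>S\<^esub>"
    using hom_mult[OF c] hom_mult[OF c(2,1)] assms(4) by simp_all
  moreover have "h u \<in> carrier S" "h (inv\<^bsub>R\<^esub> u) \<in> carrier S" using c by auto
  ultimately show ?thesis unfolding Units_def by blast
qed

lemma mult_closure_props:
  assumes "cring R" "E \<subseteq> carrier R"
  shows "cring_submonoid R (mult_closure R E)" "E \<subseteq> mult_closure R E"
    "submonoid H R \<Longrightarrow> E \<subseteq> H \<Longrightarrow> mult_closure R E \<subseteq> H"
proof -
  interpret R: cring R by fact
  have sub: "submonoid (carrier R) R" by unfold_locales auto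
  have "submonoid (mult_closure R E) R"
  proof
    show "mult_closure R E \<subseteq> carrier R"
      unfolding mult_closure_def by (rule hull_minimal[where s = E]) (use assms sub in auto)
    show "\<one>\<^bsub>R\<^esub> \<in> mult_closure R E"
      unfolding mult_closure_def hull_def by (auto dest: submonoid.one_closed)
    show "x \<otimes>\<^bsub>R\<^esub> y \<in> mult_closure R E" if "x \<in> mult_closure R E" "y \<in> mult_closure R E" for x y
      using that unfolding mult_closure_def hull_def by (auto dest: submonoid.m_closed)
  qed
  then show "cring_submonoid R (mult_closure R E)"
    by (intro cring_submonoid.intro R.is_cring)
  show "E \<subseteq> mult_closure R E" unfolding mult_closure_def by (rule hull_subset)
  show "submonoid H R \<Longrightarrow> E \<subseteq> H \<Longrightarrow> mult_closure R E \<subseteq> H"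
    unfolding mult_closure_def by (rule hull_minimal)
qed

lemma mult_closure_Units:
  assumes "cring R" "E \<subseteq> carrier R" "cring T" "h \<in> Ring.ring_hom R T"
    and "\<And>e. e \<in> E \<Longrightarrow> h e \<in> Units T" and "s \<in> mult_closure R E"
  shows "h s \<in> Units T"
proof -
  interpret R: cring R by fact
  interpret T: cring T by fact
  interpret ring_hom_cring R T h using assms(4) by unfold_locales
  have "submonoid {r \<in> carrier R. h r \<in> Units T} R"
    by unfold_locales auto
  then have "mult_closure R E \<subseteq> {r \<in> carrier R. h r \<in> Units T}"
    by (rule mult_closure_props(3)[OF assms(1,2)]) (use assms in auto)
  then show ?thesis using assms(6) by blast
qed

lemma localization_hom_eqI:
  assumes "cring_submonoid R S" "cring T"
    and g: "g \<in> Ring.ring_hom (localization R S) T" and h: "h \<in> Ring.ring_hom (localization R S) T"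
    and eq: "\<And>a. a \<in> carrier R \<Longrightarrow> g (fraction R S a \<one>\<^bsub>R\<^esub>) = h (fraction R S a \<one>\<^bsub>R\<^esub>)"
    and x: "x \<in> carrier (localization R S)"
  shows "g x = h x"
proof -
  interpret cring_submonoid R S by fact
  interpret T: cring T by fact
  obtain a s where as: "a \<in> carrier R" "s \<in> S" and x: "x = fraction R S a s"
    using x unfolding localization_carrier by blast
  have s: "s \<in> carrier R" using as(2) mem_carrier by blast
  let ?u = "fraction R S s \<one>\<^bsub>R\<^esub>"
  have cl: "fraction R S a s \<in> carrier (localization R S)" "?u \<in> carrier (localization R S)"
    using as s by auto
  have unit: "g ?u \<in> Units T"
    by (rule hom_Units[OF localization_cring T.is_cring g fraction_unit[OF as(2)]])
  have "g x \<otimes>\<^bsub>T\<^esub> g ?u = g (fraction R S a \<one>\<^bsub>R\<^esub>)"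
    using ring_hom_mult[OF g cl] fraction_split[OF as] by (simp add: x)
  also have "\<dots> = h x \<otimes>\<^bsub>T\<^esub> h ?u"
    using ring_hom_mult[OF h cl] fraction_split[OF as] as eq by (simp add: x)
  also have "h ?u = g ?u" using eq[OF s] by simp
  finally have "g ?u \<otimes>\<^bsub>T\<^esub> g x = g ?u \<otimes>\<^bsub>T\<^esub> h x"
    using ring_hom_closed[OF g] ring_hom_closed[OF h] cl by (simp add: x T.m_comm)
  then show ?thesis
    using T.Units_l_cancel[OF unit] ring_hom_closed[OF g] ring_hom_closed[OF h] cl by (simp add: x)
qed

lemma ideal_quotient_zero:
  assumes "ideal I R" "x \<in> I"
  shows "I +>\<^bsub>R\<^esub> x = \<zero>\<^bsub>R Quot I\<^esub>"
proof -
  interpret ideal I R by fact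
  have "I +>\<^bsub>R\<^esub> x = I" by (rule a_rcos_const[OF assms(2)])
  then show ?thesis by (simp add: FactRing_def)
qed

lemma genideal_quotient_universal:
  assumes "cring R" "E \<subseteq> carrier R" "cring T" and h: "h \<in> Ring.ring_hom R T"
    and ker: "\<And>e. e \<in> E \<Longrightarrow> h e = \<zero>\<^bsub>T\<^esub>"
  obtains g where "g \<in> Ring.ring_hom (R Quot Idl\<^bsub>R\<^esub> E) T"
    "\<And>a. a \<in> carrier R \<Longrightarrow> g ((Idl\<^bsub>R\<^esub> E) +>\<^bsub>R\<^esub> a) = h a"
proof -
  interpret R: cring R by fact
  interpret T: cring T by fact
  interpret ring_hom_cring R T h using h by unfold_locales
  have "Idl\<^bsub>R\<^esub> E \<subseteq> a_kernel R T h"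
  proof (rule R.genideal_minimal[OF ring.kernel_is_ideal])
    show "E \<subseteq> a_kernel R T h" unfolding a_kernel_def' using assms(2) ker by blast
  qed
  then have ker': "h x = \<zero>\<^bsub>T\<^esub>" if "x \<in> Idl\<^bsub>R\<^esub> E" for x
    using that unfolding a_kernel_def' by blast
  show ?thesis
    by (rule quotient_universal[OF R.genideal_ideal[OF assms(2)] T.ring_axioms h])
      (erule ker', rule that)
qed

context bruhat_pair
begin

text \<open>The polynomial ring in the Pluecker coordinates.\<close>

abbreviation coord_polys :: "(nat set, 'k::field) mpoly ring" where
  "coord_polys \<equiv> mpoly_ring (ksubsets k n)"

lemma coord_polys_cring: "cring coord_polys" by (rule mpoly_ring_cring)

lemma generic_minor_hom:
  "poly_subst (maximal_minor k (\<lambda>i j. Var (i, j))) \<in>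
    Ring.ring_hom coord_polys (mpoly_ring ({1..k} \<times> {1..n}) :: (nat \<times> nat, 'k::field) mpoly ring)"
proof (rule poly_subst_hom)
  fix \<alpha> assume "\<alpha> \<in> ksubsets k n"
  then show "maximal_minor k (\<lambda>i j. Var (i, j)) \<alpha> \<in> polys ({1..k} \<times> {1..n})"
    unfolding maximal_minor_colminor using elt_range by (intro polys_colminor) blast
qed

lemma pluecker_ideal: "ideal (pluecker_ideal k n) (coord_polys :: (nat set, 'k::field) mpoly ring)"
  unfolding pluecker_ideal_def
  by (rule ring_hom_ring.kernel_is_ideal[OF ring_hom_ringI2[OF cring.axioms(1)[OF mpoly_ring_cring]
    cring.axioms(1)[OF mpoly_ring_cring] generic_minor_hom]])

lemma pluecker_ring_cring: "cring (pluecker_ring k n :: (nat set, 'k::field) mpoly set ring)"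
  unfolding pluecker_ring_def by (rule ideal.quotient_is_cring[OF pluecker_ideal coord_polys_cring])

lemma pluecker_class_hom:
  "pluecker_class k n \<in> Ring.ring_hom (coord_polys :: (nat set, 'k::field) mpoly ring) (pluecker_ring k n)"
  unfolding pluecker_ring_def using ideal.rcos_ring_hom[OF pluecker_ideal]
  by (simp add: pluecker_class_def [abs_def])

text \<open>The generators of \<^const>\<open>interval_ideal\<close>.\<close>

abbreviation outside :: "(nat set, 'k::field) mpoly set set" where
  "outside \<equiv> pluecker_class k n ` Var ` (ksubsets k n - bruhat_interval k n \<beta> \<gamma>)"

lemma outside_carrier: "outside \<subseteq> carrier (pluecker_ring k n :: (nat set, 'k::field) mpoly set ring)"
  using ring_hom_closed[OF pluecker_class_hom] by auto

lemma interval_ideal: "ideal (interval_ideal k n \<beta> \<gamma>) (pluecker_ring k n :: (nat set, 'k::field) mpoly set ring)"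
  unfolding interval_ideal_def
  by (rule ring.genideal_ideal[OF cring.axioms(1)[OF pluecker_ring_cring] outside_carrier])

lemma interval_ring_cring: "cring (interval_ring k n \<beta> \<gamma> :: (nat set, 'k::field) mpoly set set ring)"
  unfolding interval_ring_def by (rule ideal.quotient_is_cring[OF interval_ideal pluecker_ring_cring])

lemma interval_class_hom:
  "interval_class k n \<beta> \<gamma> \<in> Ring.ring_hom (coord_polys :: (nat set, 'k::field) mpoly ring) (interval_ring k n \<beta> \<gamma>)"
  unfolding interval_ring_def interval_class_def [abs_def]
  by (rule hom_comp[OF pluecker_class_hom ideal.rcos_ring_hom[OF interval_ideal]])

text \<open>The Pluecker coordinates inverted in \<^const>\<open>B_ring\<close>.\<close>

abbreviation deltas :: "(nat set, 'k::field) mpoly set set set" where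
  "deltas \<equiv> interval_class k n \<beta> \<gamma> ` Var ` delta_set k \<beta> \<gamma> ` {0..k}"

lemma deltas_carrier: "deltas \<subseteq> carrier (interval_ring k n \<beta> \<gamma> :: (nat set, 'k::field) mpoly set set ring)"
  by (auto intro!: ring_hom_closed[OF interval_class_hom] polys_closed(8) delta_ksubset)

lemma B_submonoid:
  "cring_submonoid (interval_ring k n \<beta> \<gamma> :: (nat set, 'k::field) mpoly set set ring) (B_denominators k n \<beta> \<gamma>)"
  unfolding B_denominators_def by (rule mult_closure_props(1)[OF interval_ring_cring deltas_carrier])

lemma B_ring_cring: "cring (B_ring k n \<beta> \<gamma> :: 'k::field B_elem ring)"
  unfolding B_ring_def by (rule cring_submonoid.localization_cring[OF B_submonoid])

lemma B_class_hom: "B_class k n \<beta> \<gamma> \<in> Ring.ring_hom (coord_polys :: (nat set, 'k::field) mpoly ring) (B_ring k n \<beta> \<gamma>)"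
  unfolding B_ring_def B_class_def [abs_def]
  by (rule hom_comp[OF interval_class_hom cring_submonoid.localization_hom[OF B_submonoid]])

text \<open>The generator \<open>\<Delta>\<^sub>\<gamma> - 1\<close> of \<^const>\<open>W_ideal\<close>.\<close>

abbreviation one_relation :: "'k::field B_elem" where
  "one_relation \<equiv> B_class k n \<beta> \<gamma> (Var \<gamma>) \<ominus>\<^bsub>B_ring k n \<beta> \<gamma>\<^esub> \<one>\<^bsub>B_ring k n \<beta> \<gamma>\<^esub>"

lemma one_relation_carrier: "{one_relation} \<subseteq> carrier (B_ring k n \<beta> \<gamma> :: 'k::field B_elem ring)"
proof -
  interpret B: cring "B_ring k n \<beta> \<gamma> :: 'k B_elem ring" by (rule B_ring_cring)
  have "Var \<gamma> \<in> polys (ksubsets k n)" using \<gamma> by blast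
  then show ?thesis using ring_hom_closed[OF B_class_hom] by blast
qed

lemma W_ideal: "ideal (W_ideal k n \<beta> \<gamma>) (B_ring k n \<beta> \<gamma> :: 'k::field B_elem ring)"
  unfolding W_ideal_def
  by (rule ring.genideal_ideal[OF cring.axioms(1)[OF B_ring_cring] one_relation_carrier])

lemma W_ring_cring: "cring (W_ring k n \<beta> \<gamma> :: 'k::field W_elem ring)"
  unfolding W_ring_def by (rule ideal.quotient_is_cring[OF W_ideal B_ring_cring])

lemma W_class_hom: "W_class k n \<beta> \<gamma> \<in> Ring.ring_hom (coord_polys :: (nat set, 'k::field) mpoly ring) (W_ring k n \<beta> \<gamma>)"
  unfolding W_ring_def W_class_def [abs_def]
  by (rule hom_comp[OF B_class_hom ideal.rcos_ring_hom[OF W_ideal]])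

lemma W_class_pluecker:
  assumes "p \<in> (pluecker_ideal k n :: (nat set, 'k::field) mpoly set)"
  shows "W_class k n \<beta> \<gamma> p = \<zero>\<^bsub>W_ring k n \<beta> \<gamma>\<^esub>"
proof -
  interpret PR: cring "coord_polys :: (nat set, 'k) mpoly ring" by (rule coord_polys_cring)
  interpret W: cring "W_ring k n \<beta> \<gamma> :: 'k W_elem ring" by (rule W_ring_cring)
  interpret w: ring_hom_cring "coord_polys :: (nat set, 'k) mpoly ring" "W_ring k n \<beta> \<gamma>" "W_class k n \<beta> \<gamma>"
    using W_class_hom by unfold_locales
  interpret PI: ideal "pluecker_ideal k n" "coord_polys :: (nat set, 'k) mpoly ring" by (rule pluecker_ideal)
  have "0 \<in> (pluecker_ideal k n :: (nat set, 'k) mpoly set)" using PI.zero_closed by simp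
  then have "pluecker_class k n p = pluecker_class k n 0"
    unfolding pluecker_class_def using PI.a_rcos_const assms by simp
  then have "W_class k n \<beta> \<gamma> p = W_class k n \<beta> \<gamma> 0"
    by (simp add: W_class_def B_class_def interval_class_def)
  then show ?thesis using w.hom_zero by simp
qed

lemma W_class_outside:
  assumes "\<alpha> \<in> ksubsets k n - bruhat_interval k n \<beta> \<gamma>"
  shows "W_class k n \<beta> \<gamma> (Var \<alpha>) = (\<zero>\<^bsub>W_ring k n \<beta> \<gamma>\<^esub> :: 'k::field W_elem)"
proof -
  interpret PR: cring "coord_polys :: (nat set, 'k) mpoly ring" by (rule coord_polys_cring)
  interpret W: cring "W_ring k n \<beta> \<gamma> :: 'k W_elem ring" by (rule W_ring_cring)
  interpret A: cring "interval_ring k n \<beta> \<gamma> :: (nat set, 'k) mpoly set set ring" by (rule interval_ring_cring)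
  interpret w: ring_hom_cring "coord_polys :: (nat set, 'k) mpoly ring" "W_ring k n \<beta> \<gamma>" "W_class k n \<beta> \<gamma>"
    using W_class_hom by unfold_locales
  interpret a: ring_hom_cring "coord_polys :: (nat set, 'k) mpoly ring" "interval_ring k n \<beta> \<gamma>" "interval_class k n \<beta> \<gamma>"
    using interval_class_hom by unfold_locales
  have "pluecker_class k n (Var \<alpha> :: (nat set, 'k) mpoly) \<in> interval_ideal k n \<beta> \<gamma>"
    unfolding interval_ideal_def
    by (rule subsetD[OF ring.genideal_self[OF cring.axioms(1)[OF pluecker_ring_cring] outside_carrier]])
      (use assms in blast)
  then have "interval_class k n \<beta> \<gamma> (Var \<alpha> :: (nat set, 'k) mpoly) = \<zero>\<^bsub>interval_ring k n \<beta> \<gamma>\<^esub>"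
    unfolding interval_class_def interval_ring_def by (rule ideal_quotient_zero[OF interval_ideal])
  also have "\<dots> = interval_class k n \<beta> \<gamma> 0" using a.hom_zero by simp
  finally have "W_class k n \<beta> \<gamma> (Var \<alpha> :: (nat set, 'k) mpoly) = W_class k n \<beta> \<gamma> 0"
    by (simp add: W_class_def B_class_def)
  then show ?thesis using w.hom_zero by simp
qed

lemma W_class_\<gamma>: "W_class k n \<beta> \<gamma> (Var \<gamma>) = (\<one>\<^bsub>W_ring k n \<beta> \<gamma>\<^esub> :: 'k::field W_elem)"
proof -
  interpret B: cring "B_ring k n \<beta> \<gamma> :: 'k B_elem ring" by (rule B_ring_cring)
  interpret I: ideal "W_ideal k n \<beta> \<gamma>" "B_ring k n \<beta> \<gamma> :: 'k B_elem ring" by (rule W_ideal)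
  interpret W: cring "B_ring k n \<beta> \<gamma> Quot W_ideal k n \<beta> \<gamma> :: 'k W_elem ring"
    by (rule I.quotient_is_cring[OF B_ring_cring])
  interpret q: ring_hom_cring "B_ring k n \<beta> \<gamma> :: 'k B_elem ring" "B_ring k n \<beta> \<gamma> Quot W_ideal k n \<beta> \<gamma>"
    "(+>\<^bsub>B_ring k n \<beta> \<gamma>\<^esub>) (W_ideal k n \<beta> \<gamma>)"
    using I.rcos_ring_hom by unfold_locales
  let ?g = "B_class k n \<beta> \<gamma> (Var \<gamma>) :: 'k B_elem"
  have g: "?g \<in> carrier (B_ring k n \<beta> \<gamma>)"
    using \<gamma> by (intro ring_hom_closed[OF B_class_hom]) blast
  have "one_relation \<in> (W_ideal k n \<beta> \<gamma> :: 'k B_elem set)"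
    unfolding W_ideal_def using B.genideal_self[OF one_relation_carrier] by blast
  then have "W_ideal k n \<beta> \<gamma> +>\<^bsub>B_ring k n \<beta> \<gamma>\<^esub> (one_relation :: 'k B_elem) = \<zero>\<^bsub>B_ring k n \<beta> \<gamma> Quot W_ideal k n \<beta> \<gamma>\<^esub>"
    by (rule ideal_quotient_zero[OF W_ideal])
  then have "(W_ideal k n \<beta> \<gamma> +>\<^bsub>B_ring k n \<beta> \<gamma>\<^esub> ?g) \<ominus>\<^bsub>B_ring k n \<beta> \<gamma> Quot W_ideal k n \<beta> \<gamma>\<^esub>
      \<one>\<^bsub>B_ring k n \<beta> \<gamma> Quot W_ideal k n \<beta> \<gamma>\<^esub> = \<zero>\<^bsub>B_ring k n \<beta> \<gamma> Quot W_ideal k n \<beta> \<gamma>\<^esub>"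
    using g by (simp add: a_minus_def)
  then show ?thesis
    unfolding W_class_def W_ring_def using g W.r_right_minus_eq by simp
qed

lemma W_class_delta:
  assumes "t \<le> k"
  shows "W_class k n \<beta> \<gamma> (Var (delta_set k \<beta> \<gamma> t)) \<in> Units (W_ring k n \<beta> \<gamma> :: 'k::field W_elem ring)"
proof -
  have "interval_class k n \<beta> \<gamma> (Var (delta_set k \<beta> \<gamma> t)) \<in> (B_denominators k n \<beta> \<gamma> :: (nat set, 'k) mpoly set set set)"
    unfolding B_denominators_def
    using mult_closure_props(2)[OF interval_ring_cring deltas_carrier] assms by auto
  then have "B_class k n \<beta> \<gamma> (Var (delta_set k \<beta> \<gamma> t)) \<in> Units (B_ring k n \<beta> \<gamma> :: 'k B_elem ring)"
    unfolding B_class_def B_ring_def by (rule cring_submonoid.fraction_unit[OF B_submonoid])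
  then show ?thesis
    unfolding W_class_def
    by (rule hom_Units[OF B_ring_cring W_ring_cring ideal.rcos_ring_hom[OF W_ideal, folded W_ring_def]])
qed

lemma W_universal:
  fixes h :: "(nat set, 'k::field) mpoly \<Rightarrow> 't"
  assumes T: "cring T" and h: "h \<in> Ring.ring_hom coord_polys T"
    and ker: "\<And>p. p \<in> pluecker_ideal k n \<Longrightarrow> h p = \<zero>\<^bsub>T\<^esub>"
    and out: "\<And>\<alpha>. \<alpha> \<in> ksubsets k n - bruhat_interval k n \<beta> \<gamma> \<Longrightarrow> h (Var \<alpha>) = \<zero>\<^bsub>T\<^esub>"
    and one: "h (Var \<gamma>) = \<one>\<^bsub>T\<^esub>"
    and units: "\<And>t. t \<le> k \<Longrightarrow> h (Var (delta_set k \<beta> \<gamma> t)) \<in> Units T"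
  obtains g where "g \<in> Ring.ring_hom (W_ring k n \<beta> \<gamma>) T"
    "\<And>p. p \<in> polys (ksubsets k n) \<Longrightarrow> g (W_class k n \<beta> \<gamma> p) = h p"
proof -
  interpret T: cring T by fact
  obtain g1 where g1: "g1 \<in> Ring.ring_hom (pluecker_ring k n) T"
    and g1': "\<And>p. p \<in> polys (ksubsets k n) \<Longrightarrow> g1 (pluecker_class k n p) = h p"
    using quotient_universal[OF pluecker_ideal T.ring_axioms h ker]
    unfolding pluecker_ring_def pluecker_class_def by blast
  have Vk: "Var \<alpha> \<in> polys (ksubsets k n)" if "\<alpha> \<in> ksubsets k n" for \<alpha> using that by blast
  have "g1 e = \<zero>\<^bsub>T\<^esub>" if "e \<in> outside" for e
    using that g1' out Vk by auto
  then obtain g2 where g2: "g2 \<in> Ring.ring_hom (interval_ring k n \<beta> \<gamma>) T"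
    and "\<And>a. a \<in> carrier (pluecker_ring k n) \<Longrightarrow>
      g2 (interval_ideal k n \<beta> \<gamma> +>\<^bsub>pluecker_ring k n\<^esub> a) = g1 a"
    using genideal_quotient_universal[OF pluecker_ring_cring outside_carrier T g1]
    unfolding interval_ring_def interval_ideal_def by metis
  then have g2': "g2 (interval_class k n \<beta> \<gamma> p) = h p" if "p \<in> polys (ksubsets k n)" for p
    unfolding interval_class_def using g1'[OF that] ring_hom_closed[OF pluecker_class_hom that] by simp
  have "g2 s \<in> Units T" if "s \<in> B_denominators k n \<beta> \<gamma>" for s
    using that unfolding B_denominators_def
    by (rule mult_closure_Units[OF interval_ring_cring deltas_carrier T g2, rotated])
      (use g2' Vk delta_ksubset units in auto)
  then obtain g3 where g3: "g3 \<in> Ring.ring_hom (B_ring k n \<beta> \<gamma>) T"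
    and "\<And>a. a \<in> carrier (interval_ring k n \<beta> \<gamma>) \<Longrightarrow>
      g3 (fraction (interval_ring k n \<beta> \<gamma>) (B_denominators k n \<beta> \<gamma>) a \<one>\<^bsub>interval_ring k n \<beta> \<gamma>\<^esub>) = g2 a"
    using cring_submonoid.localization_universal[OF B_submonoid T g2] unfolding B_ring_def by metis
  then have g3': "g3 (B_class k n \<beta> \<gamma> p) = h p" if "p \<in> polys (ksubsets k n)" for p
    unfolding B_class_def using g2'[OF that] ring_hom_closed[OF interval_class_hom that] by simp
  interpret B: cring "B_ring k n \<beta> \<gamma> :: 'k B_elem ring" by (rule B_ring_cring)
  interpret g3: ring_hom_cring "B_ring k n \<beta> \<gamma>" T g3 using g3 by unfold_locales
  have "B_class k n \<beta> \<gamma> (Var \<gamma>) \<in> carrier (B_ring k n \<beta> \<gamma> :: 'k B_elem ring)"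
    using \<gamma> by (intro ring_hom_closed[OF B_class_hom]) blast
  then have "g3 e = \<zero>\<^bsub>T\<^esub>" if "e \<in> {one_relation}" for e
    using that g3'[OF Vk[OF \<gamma>]] one by (simp add: a_minus_def T.r_neg)
  then obtain g where g: "g \<in> Ring.ring_hom (W_ring k n \<beta> \<gamma>) T"
    and "\<And>a. a \<in> carrier (B_ring k n \<beta> \<gamma>) \<Longrightarrow> g (W_ideal k n \<beta> \<gamma> +>\<^bsub>B_ring k n \<beta> \<gamma>\<^esub> a) = g3 a"
    using genideal_quotient_universal[OF B_ring_cring one_relation_carrier T g3]
    unfolding W_ring_def W_ideal_def by metis
  then have "g (W_class k n \<beta> \<gamma> p) = h p" if "p \<in> polys (ksubsets k n)" for p
    unfolding W_class_def using g3'[OF that] ring_hom_closed[OF B_class_hom that] by simp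
  with g show ?thesis by (rule that)
qed

lemma W_hom_eqI:
  assumes T: "cring T" and g: "g \<in> Ring.ring_hom (W_ring k n \<beta> \<gamma>) T" and h: "h \<in> Ring.ring_hom (W_ring k n \<beta> \<gamma>) T"
    and eq: "\<And>p. p \<in> polys (ksubsets k n) \<Longrightarrow> g (W_class k n \<beta> \<gamma> p) = h (W_class k n \<beta> \<gamma> p)"
    and x: "x \<in> carrier (W_ring k n \<beta> \<gamma> :: 'k::field W_elem ring)"
  shows "g x = h x"
proof -
  obtain b where b: "b \<in> carrier (B_ring k n \<beta> \<gamma>)" and x: "x = W_ideal k n \<beta> \<gamma> +>\<^bsub>B_ring k n \<beta> \<gamma>\<^esub> b"
    using x cring.axioms(1)[OF B_ring_cring] unfolding W_ring_def by (auto elim: quotient_carrierE)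
  note q = ideal.rcos_ring_hom[OF W_ideal, folded W_ring_def]
  show ?thesis
    unfolding x
  proof (rule localization_hom_eqI[OF B_submonoid T hom_comp[OF q g, unfolded B_ring_def]
      hom_comp[OF q h, unfolded B_ring_def] _ b[unfolded B_ring_def], folded B_ring_def])
    fix a assume "a \<in> carrier (interval_ring k n \<beta> \<gamma> :: (nat set, 'k) mpoly set set ring)"
    then obtain a' where a': "a' \<in> carrier (pluecker_ring k n)"
      and a: "a = interval_ideal k n \<beta> \<gamma> +>\<^bsub>pluecker_ring k n\<^esub> a'"
      unfolding interval_ring_def using cring.axioms(1)[OF pluecker_ring_cring] by (auto elim: quotient_carrierE)
    from a' obtain p where p: "p \<in> polys (ksubsets k n)" and "a' = pluecker_class k n p"
      unfolding pluecker_ring_def pluecker_class_def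
      using cring.axioms(1)[OF coord_polys_cring] by (auto elim: quotient_carrierE)
    then have a: "a = interval_class k n \<beta> \<gamma> p" by (simp add: a interval_class_def)
    show "g (W_ideal k n \<beta> \<gamma> +>\<^bsub>B_ring k n \<beta> \<gamma>\<^esub>
         fraction (interval_ring k n \<beta> \<gamma>) (B_denominators k n \<beta> \<gamma>) a \<one>\<^bsub>interval_ring k n \<beta> \<gamma>\<^esub>) =
      h (W_ideal k n \<beta> \<gamma> +>\<^bsub>B_ring k n \<beta> \<gamma>\<^esub>
         fraction (interval_ring k n \<beta> \<gamma>) (B_denominators k n \<beta> \<gamma>) a \<one>\<^bsub>interval_ring k n \<beta> \<gamma>\<^esub>)"
      unfolding a using eq[OF p] by (simp only: W_class_def B_class_def)
  qed
qed

text \<open>The polynomial ring in the free entries of the staircase matrix.\<close>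

abbreviation entry_polys_ring :: "(nat \<times> nat, 'k::field) mpoly ring" where
  "entry_polys_ring \<equiv> mpoly_ring (Y_vars k \<beta> \<gamma>)"

text \<open>The entries inverted in \<^const>\<open>Y_ring\<close>.\<close>

abbreviation Y_units :: "(nat \<times> nat, 'k::field) mpoly set" where
  "Y_units \<equiv> {Var (i, elt \<beta> i) | i. i \<in> {1..k} \<and> elt \<beta> i < elt \<gamma> i}"

lemma Y_units_carrier: "Y_units \<subseteq> polys (Y_vars k \<beta> \<gamma>)"
  by (auto simp: Y_vars_def)

lemma Y_submonoid: "cring_submonoid (entry_polys_ring :: (nat \<times> nat, 'k::field) mpoly ring) (Y_denominators k \<beta> \<gamma>)"
  unfolding Y_denominators_def by (rule mult_closure_props(1)[OF mpoly_ring_cring Y_units_carrier])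

lemma Y_ring_cring: "cring (Y_ring k \<beta> \<gamma> :: 'k::field Y_elem ring)"
  unfolding Y_ring_def by (rule cring_submonoid.localization_cring[OF Y_submonoid])

lemma Y_class_hom: "Y_class k \<beta> \<gamma> \<in> Ring.ring_hom (entry_polys_ring :: (nat \<times> nat, 'k::field) mpoly ring) (Y_ring k \<beta> \<gamma>)"
  using cring_submonoid.localization_hom[OF Y_submonoid]
  unfolding Y_ring_def Y_class_def [abs_def] by simp

lemma Y_class_one [simp]: "Y_class k \<beta> \<gamma> 1 = \<one>\<^bsub>Y_ring k \<beta> \<gamma>\<^esub>"
  using ring_hom_one[OF Y_class_hom] by simp

lemma Y_universal:
  fixes h :: "(nat \<times> nat, 'k::field) mpoly \<Rightarrow> 't"
  assumes T: "cring T" and h: "h \<in> Ring.ring_hom entry_polys_ring T"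
    and units: "\<And>i. i \<in> {1..k} \<Longrightarrow> elt \<beta> i < elt \<gamma> i \<Longrightarrow> h (Var (i, elt \<beta> i)) \<in> Units T"
  obtains g where "g \<in> Ring.ring_hom (Y_ring k \<beta> \<gamma>) T"
    "\<And>p. p \<in> polys (Y_vars k \<beta> \<gamma>) \<Longrightarrow> g (Y_class k \<beta> \<gamma> p) = h p"
proof -
  have units': "h s \<in> Units T" if "s \<in> Y_denominators k \<beta> \<gamma>" for s
    using that unfolding Y_denominators_def
    by (rule mult_closure_Units[OF mpoly_ring_cring Y_units_carrier T h, rotated]) (use units in blast)
  show ?thesis
    by (rule cring_submonoid.localization_universal[OF Y_submonoid T h])
      (erule units', rule that, simp_all add: Y_ring_def Y_class_def)
qed

lemma Y_hom_eqI:
  assumes T: "cring T" and g: "g \<in> Ring.ring_hom (Y_ring k \<beta> \<gamma>) T" and h: "h \<in> Ring.ring_hom (Y_ring k \<beta> \<gamma>) T"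
    and eq: "\<And>p. p \<in> polys (Y_vars k \<beta> \<gamma>) \<Longrightarrow> g (Y_class k \<beta> \<gamma> p) = h (Y_class k \<beta> \<gamma> p)"
    and x: "x \<in> carrier (Y_ring k \<beta> \<gamma> :: 'k::field Y_elem ring)"
  shows "g x = h x"
  using localization_hom_eqI[OF Y_submonoid T g[unfolded Y_ring_def] h[unfolded Y_ring_def] _ x[unfolded Y_ring_def]] eq
  by (simp add: Y_class_def)

lemma Y_matrix_polys: "i \<in> {1..k} \<Longrightarrow> Y_matrix \<beta> \<gamma> i j \<in> polys (Y_vars k \<beta> \<gamma>)"
  by (auto simp: Y_matrix_def Y_vars_def)

lemma Y_minor_polys: "maximal_minor k (Y_matrix \<beta> \<gamma>) \<alpha> \<in> polys (Y_vars k \<beta> \<gamma>)"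
  unfolding maximal_minor_colminor by (rule polys_colminor) (rule Y_matrix_polys)

lemma Y_diagonal_unit:
  assumes i: "i \<in> {1..k}"
  shows "Y_class k \<beta> \<gamma> (Y_matrix \<beta> \<gamma> i (elt \<beta> i)) \<in> Units (Y_ring k \<beta> \<gamma> :: 'k::field Y_elem ring)"
proof -
  interpret Y: cring "Y_ring k \<beta> \<gamma> :: 'k Y_elem ring" by (rule Y_ring_cring)
  show ?thesis
  proof (cases "elt \<beta> i = elt \<gamma> i")
    case True
    then show ?thesis by (simp add: Y_matrix_def)
  next
    case False
    then have lt: "elt \<beta> i < elt \<gamma> i" using elt_\<beta>\<gamma>[OF i] by simp
    then have "Var (i, elt \<beta> i) \<in> (Y_denominators k \<beta> \<gamma> :: (nat \<times> nat, 'k) mpoly set)"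
      unfolding Y_denominators_def
      using mult_closure_props(2)[OF mpoly_ring_cring Y_units_carrier] i by blast
    then have "Y_class k \<beta> \<gamma> (Var (i, elt \<beta> i)) \<in> Units (Y_ring k \<beta> \<gamma> :: 'k Y_elem ring)"
      using cring_submonoid.fraction_unit[OF Y_submonoid] unfolding Y_class_def Y_ring_def by simp
    then show ?thesis using lt by (simp add: Y_matrix_def)
  qed
qed

lemma Y_class_prod_Units:
  assumes "finite A" "\<And>a. a \<in> A \<Longrightarrow> f a \<in> polys (Y_vars k \<beta> \<gamma>)"
    "\<And>a. a \<in> A \<Longrightarrow> Y_class k \<beta> \<gamma> (f a) \<in> Units (Y_ring k \<beta> \<gamma> :: 'k::field Y_elem ring)"
  shows "Y_class k \<beta> \<gamma> (prod f A) \<in> Units (Y_ring k \<beta> \<gamma> :: 'k Y_elem ring)"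
  using assms
proof (induction A rule: finite_induct)
  interpret Y: cring "Y_ring k \<beta> \<gamma> :: 'k Y_elem ring" by (rule Y_ring_cring)
  {
    case empty
    show ?case by simp
  next
    case (insert a A)
    have "prod f A \<in> polys (Y_vars k \<beta> \<gamma>)" using insert by (intro polys_prod) auto
    then have "Y_class k \<beta> \<gamma> (f a * prod f A) =
        Y_class k \<beta> \<gamma> (f a) \<otimes>\<^bsub>Y_ring k \<beta> \<gamma>\<^esub> Y_class k \<beta> \<gamma> (prod f A)"
      using ring_hom_mult[OF Y_class_hom, of "f a" "prod f A"] insert by simp
    then show ?case using insert by simp
  }
qed

lemma Y_minor_\<gamma>: "maximal_minor k (Y_matrix \<beta> \<gamma>) \<gamma> = 1"
proof -
  have one: "1 \<in> {1..k}" using k_pos by simp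
  have "maximal_minor k (Y_matrix \<beta> \<gamma>) \<gamma> = colminor k (Y_matrix \<beta> \<gamma>) (seq 1 (elt \<gamma> 1))"
    unfolding maximal_minor_colminor by (rule colminor_cong) (auto simp: seq_def)
  also have "\<dots> = 1"
    unfolding Y_minor_diagonal[OF one] by (intro prod.neutral) (auto simp: seq_def Y_matrix_def)
  finally show ?thesis .
qed

lemma Y_minor_delta_unit:
  assumes "t \<le> k"
  shows "Y_class k \<beta> \<gamma> (maximal_minor k (Y_matrix \<beta> \<gamma>) (delta_set k \<beta> \<gamma> t)) \<in>
    Units (Y_ring k \<beta> \<gamma> :: 'k::field Y_elem ring)"
proof -
  interpret Y: cring "Y_ring k \<beta> \<gamma> :: 'k Y_elem ring" by (rule Y_ring_cring)
  have unit: "Y_class k \<beta> \<gamma> (Y_matrix \<beta> \<gamma> i (elt \<gamma> i)) \<in> Units (Y_ring k \<beta> \<gamma> :: 'k Y_elem ring)" for i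
    by (simp add: Y_matrix_def)
  show ?thesis
  proof (cases "t = 0")
    case True
    have "delta_set k \<beta> \<gamma> t = \<gamma>"
      using bij_betw_imp_surj_on[OF elt_bij[OF \<gamma>]] by (simp add: True delta_set_def)
    then show ?thesis by (simp add: Y_minor_\<gamma>)
  next
    case False
    then have t: "t \<in> {1..k}" using assms by simp
    have eq: "maximal_minor k (Y_matrix \<beta> \<gamma>) (delta_set k \<beta> \<gamma> t) =
        (\<Prod>a<k. Y_matrix \<beta> \<gamma> (a + 1) (seq t (elt \<beta> t) (a + 1)) :: (nat \<times> nat, 'k) mpoly)"
      unfolding seq_image_\<beta>[OF t, symmetric] minor_seq[OF t order_refl elt_\<beta>\<gamma>[OF t]]
      by (rule Y_minor_diagonal[OF t])
    show ?thesis
      unfolding eq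
    proof (rule Y_class_prod_Units)
      fix a assume "a \<in> {..<k}"
      then have a: "a + 1 \<in> {1..k}" by simp
      show "Y_matrix \<beta> \<gamma> (a + 1) (seq t (elt \<beta> t) (a + 1)) \<in> polys (Y_vars k \<beta> \<gamma>)"
        by (rule Y_matrix_polys[OF a])
      have "seq t (elt \<beta> t) (a + 1) = elt \<beta> (a + 1) \<or> seq t (elt \<beta> t) (a + 1) = elt \<gamma> (a + 1)"
        unfolding seq_def by simp
      then show "Y_class k \<beta> \<gamma> (Y_matrix \<beta> \<gamma> (a + 1) (seq t (elt \<beta> t) (a + 1))) \<in>
          Units (Y_ring k \<beta> \<gamma> :: 'k Y_elem ring)"
        by (elim disjE) (simp_all only: unit Y_diagonal_unit[OF a])
    qed simp
  qed
qed

lemma Y_minor_hom: "poly_subst (maximal_minor k (Y_matrix \<beta> \<gamma>)) \<in>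
    Ring.ring_hom coord_polys (entry_polys_ring :: (nat \<times> nat, 'k::field) mpoly ring)"
  by (rule poly_subst_hom) (rule Y_minor_polys)

text \<open>A relation among the minors of the generic matrix holds for the staircase matrix by specialization.\<close>

lemma Y_minor_pluecker:
  assumes "p \<in> pluecker_ideal k n"
  shows "poly_subst (maximal_minor k (Y_matrix \<beta> \<gamma>)) p = (0 :: (nat \<times> nat, 'k::field) mpoly)"
proof -
  let ?s = "\<lambda>(i, j). Y_matrix \<beta> \<gamma> i j :: (nat \<times> nat, 'k) mpoly"
  have p: "p \<in> polys (ksubsets k n)" "poly_subst (maximal_minor k (\<lambda>i j. Var (i, j))) p = (0 :: (nat \<times> nat, 'k) mpoly)"
    using assms by (auto simp: pluecker_ideal_def a_kernel_def')
  have "poly_subst ?s (poly_subst (maximal_minor k (\<lambda>i j. Var (i, j))) p) =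
      poly_subst (maximal_minor k (Y_matrix \<beta> \<gamma>)) p"
    by (rule poly_subst_comp[OF _ p(1)]) (simp add: poly_subst_minor)
  then show ?thesis by (simp add: p(2))
qed

end

section \<open>The isomorphism\<close>

lemma Const_poly_hom: "Const \<in> Ring.ring_hom ring_of_type_algebra (mpoly_ring V :: ('v, 'k::comm_ring_1) mpoly ring)"
  by (rule ring_hom_memI) (simp_all add: Const_add Const_mult Const_one)

context bruhat_pair
begin

lemma natural_map_exists:
  obtains \<phi> :: "'k::field W_elem \<Rightarrow> 'k Y_elem" where "\<phi> \<in> Ring.ring_hom (W_ring k n \<beta> \<gamma>) (Y_ring k \<beta> \<gamma>)"
    "\<And>p. p \<in> polys (ksubsets k n) \<Longrightarrow>
      \<phi> (W_class k n \<beta> \<gamma> p) = Y_class k \<beta> \<gamma> (poly_subst (maximal_minor k (Y_matrix \<beta> \<gamma>)) p)"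
proof (rule W_universal[OF Y_ring_cring hom_comp[OF Y_minor_hom Y_class_hom]])
  have zero: "Y_class k \<beta> \<gamma> 0 = (\<zero>\<^bsub>Y_ring k \<beta> \<gamma>\<^esub> :: 'k Y_elem)"
    using ring_hom_zero[OF Y_class_hom cring.axioms(1)[OF mpoly_ring_cring] cring.axioms(1)[OF Y_ring_cring]]
    by simp
  show "Y_class k \<beta> \<gamma> (poly_subst (maximal_minor k (Y_matrix \<beta> \<gamma>)) p) = (\<zero>\<^bsub>Y_ring k \<beta> \<gamma>\<^esub> :: 'k Y_elem)"
    if "p \<in> pluecker_ideal k n" for p
    by (simp add: Y_minor_pluecker[OF that] zero)
  show "Y_class k \<beta> \<gamma> (poly_subst (maximal_minor k (Y_matrix \<beta> \<gamma>)) (Var \<alpha>)) = (\<zero>\<^bsub>Y_ring k \<beta> \<gamma>\<^esub> :: 'k Y_elem)"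
    if "\<alpha> \<in> ksubsets k n - bruhat_interval k n \<beta> \<gamma>" for \<alpha>
    using that by (simp add: Y_minor_zero zero)
  show "Y_class k \<beta> \<gamma> (poly_subst (maximal_minor k (Y_matrix \<beta> \<gamma>)) (Var \<gamma>)) = (\<one>\<^bsub>Y_ring k \<beta> \<gamma>\<^esub> :: 'k Y_elem)"
    by (simp add: Y_minor_\<gamma>)
  show "Y_class k \<beta> \<gamma> (poly_subst (maximal_minor k (Y_matrix \<beta> \<gamma>)) (Var (delta_set k \<beta> \<gamma> t))) \<in>
      Units (Y_ring k \<beta> \<gamma> :: 'k Y_elem ring)" if "t \<le> k" for t
    using Y_minor_delta_unit[OF that] by simp
qed (rule that)

lemma natural_map_iff:
  fixes \<phi> :: "'k::field W_elem \<Rightarrow> 'k Y_elem"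
  shows "natural_ring_map k n \<beta> \<gamma> \<phi> \<longleftrightarrow> \<phi> \<in> Ring.ring_hom (W_ring k n \<beta> \<gamma>) (Y_ring k \<beta> \<gamma>) \<and>
    (\<forall>p\<in>polys (ksubsets k n).
      \<phi> (W_class k n \<beta> \<gamma> p) = Y_class k \<beta> \<gamma> (poly_subst (maximal_minor k (Y_matrix \<beta> \<gamma>)) p))"
    (is "_ \<longleftrightarrow> ?hom \<and> ?all")
proof
  assume nat: "natural_ring_map k n \<beta> \<gamma> \<phi>"
  then have hom: ?hom by (simp add: natural_ring_map_def)
  moreover have ?all
  proof
    fix p :: "(nat set, 'k) mpoly" assume "p \<in> polys (ksubsets k n)"
    then show "\<phi> (W_class k n \<beta> \<gamma> p) = Y_class k \<beta> \<gamma> (poly_subst (maximal_minor k (Y_matrix \<beta> \<gamma>)) p)"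
      by (rule polys_hom_eqI[OF _ hom_comp[OF W_class_hom hom] hom_comp[OF Y_minor_hom Y_class_hom]])
        (use nat in \<open>simp_all add: natural_ring_map_def\<close>)
  qed
  ultimately show "?hom \<and> ?all" ..
next
  assume r: "?hom \<and> ?all"
  then have all: "\<phi> (W_class k n \<beta> \<gamma> p) = Y_class k \<beta> \<gamma> (poly_subst (maximal_minor k (Y_matrix \<beta> \<gamma>)) p)"
    if "p \<in> polys (ksubsets k n)" for p using that by blast
  show "natural_ring_map k n \<beta> \<gamma> \<phi>"
    unfolding natural_ring_map_def using r by (simp add: all)
qed

text \<open>The inverse map sends the entry \<open>(i, j)\<close> to \<open>entry i j / pivot i\<close>. It extends to the localization because
  for \<open>j = \<beta>(i)\<close> the numerator is itself one of the inverted coordinates.\<close>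

lemma inverse_map_exists:
  obtains \<psi> :: "'k::field Y_elem \<Rightarrow> 'k W_elem" where "\<psi> \<in> Ring.ring_hom (Y_ring k \<beta> \<gamma>) (W_ring k n \<beta> \<gamma>)"
    "\<And>a. \<psi> (Y_class k \<beta> \<gamma> (Const a)) = W_class k n \<beta> \<gamma> (Const a)"
    "\<And>i j. (i, j) \<in> Y_vars k \<beta> \<gamma> \<Longrightarrow>
      \<psi> (Y_class k \<beta> \<gamma> (Var (i, j))) \<otimes>\<^bsub>W_ring k n \<beta> \<gamma>\<^esub> W_class k n \<beta> \<gamma> (pivot i) = W_class k n \<beta> \<gamma> (entry i j)"
    "\<And>\<alpha>. \<alpha> \<in> ksubsets k n \<Longrightarrow>
      \<psi> (Y_class k \<beta> \<gamma> (maximal_minor k (Y_matrix \<beta> \<gamma>) \<alpha>)) = W_class k n \<beta> \<gamma> (Var \<alpha>)"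
proof -
  let ?W = "W_ring k n \<beta> \<gamma> :: 'k W_elem ring" and ?w = "W_class k n \<beta> \<gamma> :: (nat set, 'k) mpoly \<Rightarrow> 'k W_elem"
  interpret W: cring ?W by (rule W_ring_cring)
  have closed: "?w p \<in> carrier ?W" if "p \<in> polys (ksubsets k n)" for p
    by (rule ring_hom_closed[OF W_class_hom that])
  have c: "(\<lambda>a. ?w (Const a)) \<in> Ring.ring_hom ring_of_type_algebra ?W"
    by (rule hom_comp[OF Const_poly_hom W_class_hom])
  have pivot_polys: "pivot i \<in> polys (ksubsets k n)" if "i \<in> {1..k}" for i
    unfolding pivot_def using that delta_ksubset[of "i - 1"] by auto
  have pivot_unit: "?w (pivot i) \<in> Units ?W" if "i \<in> {1..k}" for i
    unfolding pivot_def using that by (intro W_class_delta) auto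
  have entry_closed: "?w (entry i j) \<in> carrier ?W" if "(i, j) \<in> Y_vars k \<beta> \<gamma>" for i j
  proof -
    have "i \<in> {1..k}" "elt \<beta> i \<le> j" "j < elt \<gamma> i" using that by (auto simp: Y_vars_def)
    then have "j \<in> {1..n}" using elt_range[OF \<beta>, of i] elt_range[OF \<gamma>, of i] by auto
    then show ?thesis by (intro closed entry_polys)
  qed
  \<comment> \<open>Evaluation needs a value for every variable of the type; outside the variables in use it is zero.\<close>
  define f where "f \<alpha> = (if \<alpha> \<in> ksubsets k n then ?w (Var \<alpha>) else \<zero>\<^bsub>?W\<^esub>)" for \<alpha>
  define e where "e v = (if v \<in> Y_vars k \<beta> \<gamma> then
    ?w (entry (fst v) (snd v)) \<otimes>\<^bsub>?W\<^esub> inv\<^bsub>?W\<^esub> ?w (pivot (fst v)) else \<zero>\<^bsub>?W\<^esub>)" for v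
  interpret F: poly_evaluation ?W "\<lambda>a. ?w (Const a)" f
    by unfold_locales (use c closed in \<open>auto simp: f_def\<close>)
  have "fst v \<in> {1..k}" if "v \<in> Y_vars k \<beta> \<gamma>" for v using that by (auto simp: Y_vars_def)
  then have e_closed: "e v \<in> carrier ?W" for v
    unfolding e_def using entry_closed[of "fst v" "snd v"] pivot_unit[of "fst v"] by auto
  interpret E: poly_evaluation ?W "\<lambda>a. ?w (Const a)" e
    by unfold_locales (use c e_closed in auto)
  let ?F = "poly_eval ?W (\<lambda>a. ?w (Const a)) f :: (nat set, 'k) mpoly \<Rightarrow> _"
  let ?E = "poly_eval ?W (\<lambda>a. ?w (Const a)) e :: (nat \<times> nat, 'k) mpoly \<Rightarrow> _"
  have F: "?F p = ?w p" if "p \<in> polys (ksubsets k n)" for p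
    using that by (rule polys_hom_eqI[OF _ mpoly_ring_hom_restrict[OF F.poly_eval_hom] W_class_hom])
      (simp_all add: F.poly_eval_Const F.poly_eval_Var f_def)
  have ent: "?E (Var (i, j)) \<otimes>\<^bsub>?W\<^esub> ?w (pivot i) = ?w (entry i j)" if "(i, j) \<in> Y_vars k \<beta> \<gamma>" for i j
  proof -
    have i: "i \<in> {1..k}" using that by (auto simp: Y_vars_def)
    show ?thesis
      using pivot_unit[OF i] W.Units_closed[OF pivot_unit[OF i]] entry_closed[OF that] that
      by (simp add: E.poly_eval_Var e_def W.m_assoc)
  qed
  have minor: "?E (maximal_minor k (Y_matrix \<beta> \<gamma>) \<alpha>) = ?w (Var \<alpha>)" if "\<alpha> \<in> ksubsets k n" for \<alpha>
  proof -
    have "?E (maximal_minor k (Y_matrix \<beta> \<gamma>) \<alpha>) = ?F (Var \<alpha>)"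
    proof (rule minor_from_entries[OF W.is_cring F.poly_eval_hom _ _ _ E.poly_eval_hom _ _ that])
      show "?F p = \<zero>\<^bsub>?W\<^esub>" if "p \<in> pluecker_ideal k n" for p
        using F[of p] W_class_pluecker[OF that] ideal.Icarr[OF pluecker_ideal that] by simp
      show "?F (Var \<alpha>) = \<zero>\<^bsub>?W\<^esub>" if "\<alpha> \<in> ksubsets k n - bruhat_interval k n \<beta> \<gamma>" for \<alpha>
        using F[of "Var \<alpha>"] W_class_outside[OF that] that by simp
      show "?F (Var \<gamma>) = \<one>\<^bsub>?W\<^esub>" using F[of "Var \<gamma>"] W_class_\<gamma> \<gamma> by simp
      show "?F (pivot i) \<in> Units ?W" if "i \<in> {1..k}" for i
        using F[OF pivot_polys[OF that]] pivot_unit[OF that] by simp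
      show "?E (Var (i, j)) \<otimes>\<^bsub>?W\<^esub> ?F (pivot i) = ?F (entry i j)" if v: "(i, j) \<in> Y_vars k \<beta> \<gamma>" for i j
      proof -
        have i: "i \<in> {1..k}" and "elt \<beta> i \<le> j" "j < elt \<gamma> i" using v by (auto simp: Y_vars_def)
        then have "j \<in> {1..n}" using elt_range[OF \<beta>, of i] elt_range[OF \<gamma>, of i] by auto
        then show ?thesis using ent[OF v] F[OF pivot_polys[OF i]] F[OF entry_polys] by simp
      qed
    qed
    then show ?thesis using F[of "Var \<alpha>"] that by simp
  qed
  have unit: "?E (Var (i, elt \<beta> i)) \<in> Units ?W" if i: "i \<in> {1..k}" and lt: "elt \<beta> i < elt \<gamma> i" for i
  proof -
    have "(i, elt \<beta> i) \<in> Y_vars k \<beta> \<gamma>" using i lt by (simp add: Y_vars_def)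
    moreover have "?w (entry i (elt \<beta> i)) \<in> Units ?W"
      using W_class_delta[of i] i by (simp add: entry_\<beta>)
    ultimately show ?thesis using pivot_unit[OF i] by (simp add: E.poly_eval_Var e_def)
  qed
  show ?thesis
  proof (rule Y_universal[OF W.is_cring mpoly_ring_hom_restrict[OF E.poly_eval_hom]])
    show "?E (Var (i, elt \<beta> i)) \<in> Units ?W" if "i \<in> {1..k}" "elt \<beta> i < elt \<gamma> i" for i
      by (rule unit[OF that])
    fix g assume g: "g \<in> Ring.ring_hom (Y_ring k \<beta> \<gamma>) ?W"
      and gE: "\<And>p. p \<in> polys (Y_vars k \<beta> \<gamma>) \<Longrightarrow> g (Y_class k \<beta> \<gamma> p) = ?E p"
    show ?thesis
    proof (rule that[of g])
      show "g (Y_class k \<beta> \<gamma> (Const a)) = ?w (Const a)" for a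
        by (simp add: gE E.poly_eval_Const)
      show "g (Y_class k \<beta> \<gamma> (Var (i, j))) \<otimes>\<^bsub>?W\<^esub> ?w (pivot i) = ?w (entry i j)"
        if "(i, j) \<in> Y_vars k \<beta> \<gamma>" for i j
        using ent[OF that] that by (simp add: gE)
      show "g (Y_class k \<beta> \<gamma> (maximal_minor k (Y_matrix \<beta> \<gamma>) \<alpha>)) = ?w (Var \<alpha>)"
        if "\<alpha> \<in> ksubsets k n" for \<alpha>
        using minor[OF that] by (simp add: gE Y_minor_polys)
    qed (rule g)
  qed
qed

lemma natural_map_inverse:
  fixes \<phi> :: "'k::field W_elem \<Rightarrow> 'k Y_elem"
  assumes nat: "natural_ring_map k n \<beta> \<gamma> \<phi>"
  obtains \<psi> where "\<psi> \<in> Ring.ring_hom (Y_ring k \<beta> \<gamma>) (W_ring k n \<beta> \<gamma>)"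
    "\<And>x. x \<in> carrier (W_ring k n \<beta> \<gamma>) \<Longrightarrow> \<psi> (\<phi> x) = x"
    "\<And>y. y \<in> carrier (Y_ring k \<beta> \<gamma>) \<Longrightarrow> \<phi> (\<psi> y) = y"
proof -
  let ?W = "W_ring k n \<beta> \<gamma> :: 'k W_elem ring" and ?w = "W_class k n \<beta> \<gamma> :: (nat set, 'k) mpoly \<Rightarrow> 'k W_elem"
  let ?Y = "Y_ring k \<beta> \<gamma> :: 'k Y_elem ring" and ?y = "Y_class k \<beta> \<gamma> :: (nat \<times> nat, 'k) mpoly \<Rightarrow> 'k Y_elem"
  let ?m = "poly_subst (maximal_minor k (Y_matrix \<beta> \<gamma>)) :: (nat set, 'k) mpoly \<Rightarrow> (nat \<times> nat, 'k) mpoly"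
  interpret W: cring ?W by (rule W_ring_cring)
  interpret Y: cring ?Y by (rule Y_ring_cring)
  have \<phi>: "\<phi> \<in> Ring.ring_hom ?W ?Y" and \<phi>w: "\<And>p. p \<in> polys (ksubsets k n) \<Longrightarrow> \<phi> (?w p) = ?y (?m p)"
    using nat unfolding natural_map_iff by auto
  obtain \<psi> where \<psi>: "\<psi> \<in> Ring.ring_hom ?Y ?W"
    and \<psi>C: "\<And>a. \<psi> (?y (Const a)) = ?w (Const a)"
    and \<psi>V: "\<And>i j. (i, j) \<in> Y_vars k \<beta> \<gamma> \<Longrightarrow> \<psi> (?y (Var (i, j))) \<otimes>\<^bsub>?W\<^esub> ?w (pivot i) = ?w (entry i j)"
    and \<psi>M: "\<And>\<alpha>. \<alpha> \<in> ksubsets k n \<Longrightarrow> \<psi> (?y (maximal_minor k (Y_matrix \<beta> \<gamma>) \<alpha>)) = ?w (Var \<alpha>)"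
    using inverse_map_exists by blast
  have idW: "(\<lambda>x. x) \<in> Ring.ring_hom ?W ?W" and idY: "(\<lambda>x. x) \<in> Ring.ring_hom ?Y ?Y"
    by (rule ring_hom_memI; simp)+
  have \<psi>\<phi>: "\<psi> (\<phi> (?w p)) = ?w p" if p: "p \<in> polys (ksubsets k n)" for p
  proof -
    have "\<psi> (?y (?m p)) = ?w p"
      by (rule polys_hom_eqI[OF p hom_comp[OF Y_minor_hom hom_comp[OF Y_class_hom \<psi>]] W_class_hom])
        (simp_all add: \<psi>C \<psi>M)
    then show ?thesis by (simp add: \<phi>w[OF p])
  qed
  have \<phi>\<psi>: "\<phi> (\<psi> (?y p)) = ?y p" if p: "p \<in> polys (Y_vars k \<beta> \<gamma>)" for p
  proof (rule polys_hom_eqI[OF p hom_comp[OF Y_class_hom hom_comp[OF \<psi> \<phi>]] Y_class_hom])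
    show "\<phi> (\<psi> (?y (Const a))) = ?y (Const a)" for a by (simp add: \<psi>C \<phi>w)
    fix v assume v: "v \<in> Y_vars k \<beta> \<gamma>"
    obtain i j where ij: "v = (i, j)" by (cases v)
    have i: "i \<in> {1..k}" and j: "elt \<beta> i \<le> j" "j < elt \<gamma> i" using v by (auto simp: Y_vars_def ij)
    have jn: "j \<in> {1..n}" using j elt_range[OF \<beta> i] elt_range[OF \<gamma> i] by auto
    have pivot: "pivot i \<in> polys (ksubsets k n)"
      unfolding pivot_def using delta_ksubset[of "i - 1"] i by auto
    have mp: "?m (pivot i) = colminor k (Y_matrix \<beta> \<gamma>) (seq i (elt \<gamma> i))"
      unfolding pivot_def seq_image_\<gamma>[OF i, symmetric] poly_subst_simps
      by (rule minor_seq[OF i elt_\<beta>\<gamma>[OF i] order_refl])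
    have "?m (entry i j) = colminor k (Y_matrix \<beta> \<gamma>) (seq i j)"
      unfolding entry_Var[OF i j(1) less_imp_le[OF j(2)]] poly_subst_simps
      by (rule minor_seq[OF i j(1) less_imp_le[OF j(2)]])
    also have "\<dots> = Var (i, j) * ?m (pivot i)"
      unfolding mp Y_minor_entry[OF i j(1) less_imp_le[OF j(2)]] using j by (simp add: Y_matrix_def)
    finally have me: "?m (entry i j) = Var (i, j) * ?m (pivot i)" .
    have Vp: "Var (i, j) \<in> polys (Y_vars k \<beta> \<gamma>)" "?m (pivot i) \<in> polys (Y_vars k \<beta> \<gamma>)"
      using v ij ring_hom_closed[OF Y_minor_hom pivot] by auto
    have yc: "?y (Var (i, j)) \<in> carrier ?Y" by (rule ring_hom_closed[OF Y_class_hom Vp(1)])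
    have wc: "?w (pivot i) \<in> carrier ?W" by (rule ring_hom_closed[OF W_class_hom pivot])
    have pc: "\<psi> (?y (Var (i, j))) \<in> carrier ?W" by (rule ring_hom_closed[OF \<psi> yc])
    have unit: "?y (?m (pivot i)) \<in> Units ?Y"
      unfolding pivot_def poly_subst_simps using i by (intro Y_minor_delta_unit) auto
    have "\<phi> (\<psi> (?y (Var (i, j)))) \<otimes>\<^bsub>?Y\<^esub> ?y (?m (pivot i)) = \<phi> (?w (entry i j))"
      using ring_hom_mult[OF \<phi> pc wc] \<psi>V[of i j] v ij by (simp add: \<phi>w[OF pivot])
    also have "\<dots> = ?y (Var (i, j) * ?m (pivot i))"
      by (simp add: \<phi>w[OF entry_polys[OF jn]] me)
    also have "\<dots> = ?y (Var (i, j)) \<otimes>\<^bsub>?Y\<^esub> ?y (?m (pivot i))"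
      using ring_hom_mult[OF Y_class_hom Vp] by simp
    finally have "?y (?m (pivot i)) \<otimes>\<^bsub>?Y\<^esub> \<phi> (\<psi> (?y (Var (i, j)))) = ?y (?m (pivot i)) \<otimes>\<^bsub>?Y\<^esub> ?y (Var (i, j))"
      using Y.m_comm[OF Y.Units_closed[OF unit]] ring_hom_closed[OF \<phi> pc] yc by simp
    then show "\<phi> (\<psi> (?y (Var v))) = ?y (Var v)"
      using Y.Units_l_cancel[OF unit ring_hom_closed[OF \<phi> pc] yc] by (simp add: ij)
  qed
  show ?thesis
  proof (rule that[OF \<psi>])
    show "\<psi> (\<phi> x) = x" if "x \<in> carrier ?W" for x
      by (rule W_hom_eqI[OF W.is_cring hom_comp[OF \<phi> \<psi>] idW _ that]) (rule \<psi>\<phi>)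
    show "\<phi> (\<psi> y) = y" if "y \<in> carrier ?Y" for y
      by (rule Y_hom_eqI[OF Y.is_cring hom_comp[OF \<psi> \<phi>] idY _ that]) (rule \<phi>\<psi>)
  qed
qed

end

theorem theorem7:
  fixes k n :: nat and \<beta> \<gamma> :: "nat set"
  assumes "1 \<le> k" and "k \<le> n"
    and "\<beta> \<in> ksubsets k n" and "\<gamma> \<in> ksubsets k n"
    and "bruhat_le k \<beta> \<gamma>"
  shows "\<exists>\<phi> :: 'k::field W_elem \<Rightarrow> 'k Y_elem.
    natural_ring_map k n \<beta> \<gamma> \<phi> \<and>
    (\<forall>\<psi>. natural_ring_map k n \<beta> \<gamma> \<psi> \<longrightarrow> (\<forall>x \<in> carrier (W_ring k n \<beta> \<gamma>). \<psi> x = \<phi> x)) \<and>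
    scheme_iso_over (Spec (ground_ring :: 'k ring))
      (Spec (Y_ring k \<beta> \<gamma>))
      (Spec_map ground_ring (Y_ring k \<beta> \<gamma>) (\<lambda>c. Y_class k \<beta> \<gamma> (Const c)))
      (Spec (W_ring k n \<beta> \<gamma>))
      (Spec_map ground_ring (W_ring k n \<beta> \<gamma>) (\<lambda>c. W_class k n \<beta> \<gamma> (Const c)))
      (Spec_map (W_ring k n \<beta> \<gamma>) (Y_ring k \<beta> \<gamma>) \<phi>)"
proof -
  interpret bruhat_pair k n \<beta> \<gamma> using assms by unfold_locales
  let ?W = "W_ring k n \<beta> \<gamma> :: 'k W_elem ring" and ?Y = "Y_ring k \<beta> \<gamma> :: 'k Y_elem ring"
  obtain \<phi> :: "'k W_elem \<Rightarrow> 'k Y_elem" where nat: "natural_ring_map k n \<beta> \<gamma> \<phi>"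
    using natural_map_exists natural_map_iff by metis
  then have \<phi>: "\<phi> \<in> Ring.ring_hom ?W ?Y" by (simp add: natural_ring_map_def)
  obtain \<psi> where \<psi>: "\<psi> \<in> Ring.ring_hom ?Y ?W"
    and inv: "\<And>x. x \<in> carrier ?W \<Longrightarrow> \<psi> (\<phi> x) = x" "\<And>y. y \<in> carrier ?Y \<Longrightarrow> \<phi> (\<psi> y) = y"
    using natural_map_inverse[OF nat] by blast
  have K: "cring (ground_ring :: 'k ring)" unfolding ground_ring_def by (rule type_cring)
  note homs = cring_hom.intro cring_hom_axioms.intro
  show ?thesis
  proof (intro exI[of _ \<phi>] conjI allI impI ballI)
    show "natural_ring_map k n \<beta> \<gamma> \<phi>" by (rule nat)
  next
    fix \<chi> :: "'k W_elem \<Rightarrow> 'k Y_elem" and x assume \<chi>: "natural_ring_map k n \<beta> \<gamma> \<chi>" and x: "x \<in> carrier ?W"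
    then have "\<chi> \<in> Ring.ring_hom ?W ?Y" by (simp add: natural_ring_map_def)
    then show "\<chi> x = \<phi> x"
      by (rule W_hom_eqI[OF Y_ring_cring _ \<phi> _ x]) (use \<chi> nat in \<open>simp add: natural_map_iff\<close>)
  next
    show "scheme_iso_over (Spec (ground_ring :: 'k ring)) (Spec ?Y)
      (Spec_map ground_ring ?Y (\<lambda>c. Y_class k \<beta> \<gamma> (Const c))) (Spec ?W)
      (Spec_map ground_ring ?W (\<lambda>c. W_class k n \<beta> \<gamma> (Const c))) (Spec_map ?W ?Y \<phi>)"
    proof (rule Spec_map_scheme_iso_over)
      show "cring_hom ?W ?Y \<phi>" by (intro homs W_ring_cring Y_ring_cring \<phi>)
      show "cring_hom ?Y ?W \<psi>" by (intro homs W_ring_cring Y_ring_cring \<psi>)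
      show "cring_hom ground_ring ?W (\<lambda>c. W_class k n \<beta> \<gamma> (Const c))"
        using hom_comp[OF Const_poly_hom W_class_hom]
        by (intro homs W_ring_cring K) (simp add: ground_ring_def)
      show "cring_hom ground_ring ?Y (\<lambda>c. Y_class k \<beta> \<gamma> (Const c))"
        using hom_comp[OF Const_poly_hom Y_class_hom]
        by (intro homs Y_ring_cring K) (simp add: ground_ring_def)
      show "\<phi> (W_class k n \<beta> \<gamma> (Const c)) = Y_class k \<beta> \<gamma> (Const c)" for c
        using nat by (simp add: natural_ring_map_def)
    qed (rule inv, assumption)+
  qed
qed

end
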